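(* Let $\mathbb{F}\in\{\mathbb{R},\mathbb{C},\mathbb{H}\}$, let $q\in\mathbb{N}$, and let $\nu$ be a probability measure on $\Pi_q$ with $m_4(\nu):=\int_{\Pi_q}\|s\|^4\,d\nu(s)<\infty$. Put $\sigma^2:=\int_{\Pi_q}s^2\,d\nu(s)\in\Pi_q$. Let $(p_n)_{n\ge1}$ be a sequence of integers $p_n\ge q$ with $\lim_{n\to\infty}n^2/p_n=0$. Then the $H_q$-valued random variables $$\frac{1}{\sqrt n}\left(\phi_{p_n}(S_n^{p_n})^2-n\sigma^2\right)$$ converge in distribution for $n\to\infty$ to the normal distribution $N(0,\Sigma^2)$ on $H_q$, where $\Sigma^2$ is the covariance matrix of the $H_q$-valued random variable $\phi_{p_n}(X_1^{p_n})^2$ (which is independent of $p_n$).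
   Context: $\mathbb{F}$ is $\mathbb{R}$, $\mathbb{C}$ or the quaternions $\mathbb{H}$. $M_{p,q}$ is the space of $p\times q$ matrices over $\mathbb{F}$, $x^*:=\overline{x}^t$, and $H_q=\{x\in M_{q,q}:x=x^*\}$ is the real vector space of Hermitian $q\times q$ matrices over $\mathbb{F}$, with Euclidean scalar product $\langle x,y\rangle=\mathrm{Re}\,\mathrm{tr}(x^*y)$. $\Pi_q\subset H_q$ is the cone of positive semidefinite matrices, and $\|s\|=(\mathrm{tr}\,s^2)^{1/2}$ for $s\in\Pi_q$. The map $\phi_p:M_{p,q}\to\Pi_q$ is $\phi_p(x):=(x^*x)^{1/2}$ (positive semidefinite square root). A measure on $M_{p,q}$ is called radial if it is invariant under left multiplication $x\mapsto ux$ by all $u$ in the unitary group $U_p(\mathbb{F})$ (i.e. $u^*u=I$). For $p\ge q$, $\nu_p$ denotes the unique radial probability measure on $M_{p,q}$ whose image under $\phi_p$ is $\nu$. For each such $p$, $(X_k^p)_{k\ge1}$ are i.i.d. $M_{p,q}$-valued random variables with law $\nu_p$, and $S_n^p:=\sum_{k=1}^nX_k^p$. Normal distributions may be degenerate. *)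

theory Defs
  imports "HOL-Probability.Probability"
begin

section \<open>Quaternions\<close>

datatype quat = Quat (qre: real) (qi: real) (qj: real) (qk: real)

lemma quat_eq_iff:
  "x = y \<longleftrightarrow> qre x = qre y \<and> qi x = qi y \<and> qj x = qj y \<and> qk x = qk y"
  by (cases x; cases y) auto

instantiation quat :: ab_group_add
begin

definition zero_quat :: quat where
  "0 = Quat 0 0 0 0"

definition plus_quat :: "quat \<Rightarrow> quat \<Rightarrow> quat" where
  "x + y = Quat (qre x + qre y) (qi x + qi y) (qj x + qj y) (qk x + qk y)"

definition uminus_quat :: "quat \<Rightarrow> quat" where
  "- x = Quat (- qre x) (- qi x) (- qj x) (- qk x)"

definition minus_quat :: "quat \<Rightarrow> quat \<Rightarrow> quat" where
  "x - y = Quat (qre x - qre y) (qi x - qi y) (qj x - qj y) (qk x - qk y)"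

instance
  by standard
    (auto simp: quat_eq_iff zero_quat_def plus_quat_def uminus_quat_def minus_quat_def)

end

instantiation quat :: ring_1
begin

definition one_quat :: quat where
  "1 = Quat 1 0 0 0"

definition times_quat :: "quat \<Rightarrow> quat \<Rightarrow> quat" where
  "x * y = Quat
     (qre x * qre y - qi x * qi y - qj x * qj y - qk x * qk y)
     (qre x * qi y + qi x * qre y + qj x * qk y - qk x * qj y)
     (qre x * qj y - qi x * qk y + qj x * qre y + qk x * qi y)
     (qre x * qk y + qi x * qj y - qj x * qi y + qk x * qre y)"

instance
proof
  fix x y z :: quat
  show "x * y * z = x * (y * z)"
    by (simp add: quat_eq_iff times_quat_def distrib_left distrib_right right_diff_distrib
        left_diff_distrib)
  show "(x + y) * z = x * z + y * z" "x * (y + z) = x * y + x * z"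
    by (simp_all add: quat_eq_iff plus_quat_def times_quat_def distrib_left distrib_right)
qed (simp_all add: quat_eq_iff zero_quat_def one_quat_def times_quat_def)

end

definition qconj :: "quat \<Rightarrow> quat" where
  "qconj x = Quat (qre x) (- qi x) (- qj x) (- qk x)"

instantiation quat :: real_algebra_1
begin

definition scaleR_quat :: "real \<Rightarrow> quat \<Rightarrow> quat" where
  "scaleR r x = Quat (r * qre x) (r * qi x) (r * qj x) (r * qk x)"

instance
  by standard (auto simp: quat_eq_iff plus_quat_def times_quat_def scaleR_quat_def algebra_simps)

end

lemmas quat_ops_defs = zero_quat_def one_quat_def plus_quat_def uminus_quat_def minus_quat_def
  times_quat_def scaleR_quat_def qconj_def

instantiation quat :: real_normed_div_algebra
begin

definition norm_quat :: "quat \<Rightarrow> real" where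
  "norm x = sqrt ((qre x)\<^sup>2 + (qi x)\<^sup>2 + (qj x)\<^sup>2 + (qk x)\<^sup>2)"

definition sgn_quat :: "quat \<Rightarrow> quat" where
  "sgn x = x /\<^sub>R norm x" for x :: quat

definition dist_quat :: "quat \<Rightarrow> quat \<Rightarrow> real" where
  "dist x y = norm (x - y)" for x y :: quat

definition uniformity_quat :: "(quat \<times> quat) filter" where
  "uniformity = (INF e\<in>{0 <..}. principal {(x :: quat, y). dist x y < e})"

definition open_quat :: "quat set \<Rightarrow> bool" where
  "open U \<longleftrightarrow> (\<forall>x\<in>U. eventually (\<lambda>(x', y). x' = x \<longrightarrow> y \<in> U) uniformity)" for U :: "quat set"

definition inverse_quat :: "quat \<Rightarrow> quat" where
  "inverse x = qconj x /\<^sub>R (norm x)\<^sup>2"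

definition divide_quat :: "quat \<Rightarrow> quat \<Rightarrow> quat" where
  "divide x y = x * inverse y" for x y :: quat

lemma quat_norm_eq_0: "norm x = 0 \<longleftrightarrow> x = 0" for x :: quat
  by (simp add: norm_quat_def zero_quat_def quat_eq_iff add_nonneg_eq_0_iff)

lemma quat_norm_square: "(norm x)\<^sup>2 = (qre x)\<^sup>2 + (qi x)\<^sup>2 + (qj x)\<^sup>2 + (qk x)\<^sup>2"
  for x :: quat
  by (simp add: norm_quat_def)

lemma quat_norm_mult: "norm (x * y) = norm x * norm y" for x y :: quat
  unfolding norm_quat_def real_sqrt_mult [symmetric] times_quat_def quat.sel
  by (rule arg_cong [where f = sqrt]) algebra

lemma quat_norm_triangle: "norm (x + y) \<le> norm x + norm y" for x y :: quat
proof -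
  let ?d = "qre x * qre y + qi x * qi y + qj x * qj y + qk x * qk y"
  have nonneg: "0 \<le> norm z" for z :: quat
    by (simp add: norm_quat_def)
  have "?d = qre (qconj x * y)"
    by (simp add: qconj_def times_quat_def)
  also have "\<dots> \<le> norm (qconj x * y)"
    unfolding norm_quat_def by (rule real_le_rsqrt) simp
  also have "\<dots> = norm x * norm y"
    by (simp only: quat_norm_mult) (simp add: norm_quat_def qconj_def)
  finally have "?d \<le> norm x * norm y" .
  moreover have "(norm (x + y))\<^sup>2 = (norm x)\<^sup>2 + (norm y)\<^sup>2 + 2 * ?d"
    unfolding quat_norm_square plus_quat_def quat.sel by algebra
  ultimately have "(norm (x + y))\<^sup>2 \<le> (norm x + norm y)\<^sup>2"
    by (simp add: power2_sum)
  then show ?thesis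
    by (rule power2_le_imp_le) (simp add: nonneg)
qed

instance
proof
  fix x y :: quat and r :: real
  show "norm (scaleR r x) = \<bar>r\<bar> * norm x"
    unfolding norm_quat_def real_sqrt_abs [symmetric] real_sqrt_mult [symmetric] scaleR_quat_def
      quat.sel
    by (rule arg_cong [where f = sqrt]) algebra
  show "inverse x * x = 1" if "x \<noteq> 0"
  proof -
    have "(norm x)\<^sup>2 \<noteq> 0" using that by (simp add: quat_norm_eq_0)
    moreover have "qconj x * x = scaleR ((norm x)\<^sup>2) 1"
      unfolding quat_norm_square by (simp add: quat_ops_defs power2_eq_square)
    ultimately show ?thesis by (simp add: inverse_quat_def)
  qed
  show "x * inverse x = 1" if "x \<noteq> 0"
  proof -
    have "(norm x)\<^sup>2 \<noteq> 0" using that by (simp add: quat_norm_eq_0)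
    moreover have "x * qconj x = scaleR ((norm x)\<^sup>2) 1"
      unfolding quat_norm_square by (simp add: quat_ops_defs power2_eq_square)
    ultimately show ?thesis by (simp add: inverse_quat_def)
  qed
  show "inverse (0::quat) = 0"
    by (simp add: inverse_quat_def quat_ops_defs)
qed (simp_all add: quat_norm_eq_0 quat_norm_mult quat_norm_triangle divide_quat_def sgn_quat_def
      dist_quat_def uniformity_quat_def open_quat_def)

end

instantiation quat :: real_inner
begin

definition inner_quat :: "quat \<Rightarrow> quat \<Rightarrow> real" where
  "inner x y = qre x * qre y + qi x * qi y + qj x * qj y + qk x * qk y"

instance
proof
  fix x y z :: quat and r :: real
  show "inner x x = 0 \<longleftrightarrow> x = 0"
    by (simp add: inner_quat_def zero_quat_def quat_eq_iff add_nonneg_eq_0_iff)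
  show "norm x = sqrt (inner x x)"
    by (simp add: inner_quat_def norm_quat_def power2_eq_square)
qed (simp_all add: inner_quat_def quat_ops_defs algebra_simps)

end

instantiation quat :: euclidean_space
begin

definition Basis_quat :: "quat set" where
  "Basis = {Quat 1 0 0 0, Quat 0 1 0 0, Quat 0 0 1 0, Quat 0 0 0 1}"

instance
proof
  fix u v x :: quat
  show "(Basis :: quat set) \<noteq> {}" "finite (Basis :: quat set)"
    by (simp_all add: Basis_quat_def)
  show "inner u v = (if u = v then 1 else 0)" if "u \<in> Basis" "v \<in> Basis"
    using that unfolding Basis_quat_def by (elim insertE emptyE) (simp_all add: inner_quat_def)
  show "(\<forall>u\<in>Basis. inner x u = 0) \<longleftrightarrow> x = 0"
    by (simp add: Basis_quat_def inner_quat_def zero_quat_def quat_eq_iff [of x])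
qed

end


section \<open>The skew fields R, C and H\<close>

text \<open>
  A type of this class is, by its very axioms, an isometric copy of one of the three *-algebras
  R, C (spanned by 1 and i inside H) and H: the map \<open>to_quat\<close> is a norm preserving embedding of real
  unital *-algebras into the quaternions whose range is one of the three. The types \<open>real\<close>,
  \<open>complex\<close> and \<open>quat\<close> are instances, with their usual conjugations.
\<close>

class rch = real_normed_div_algebra + euclidean_space +
  fixes conjugate :: "'a \<Rightarrow> 'a"
    and to_quat :: "'a \<Rightarrow> quat"
  assumes to_quat_add: "to_quat (x + y) = to_quat x + to_quat y"
    and to_quat_scaleR: "to_quat (scaleR r x) = scaleR r (to_quat x)"
    and to_quat_mult: "to_quat (x * y) = to_quat x * to_quat y"
    and to_quat_one: "to_quat 1 = 1"
    and norm_to_quat: "norm (to_quat x) = norm x"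
    and to_quat_conjugate: "to_quat (conjugate x) = qconj (to_quat x)"
    and range_to_quat:
      "range to_quat = range of_real \<or> range to_quat = {z. qj z = 0 \<and> qk z = 0}
       \<or> range to_quat = UNIV"

instantiation real :: rch
begin

definition conjugate_real :: "real \<Rightarrow> real" where
  "conjugate x = x" for x :: real

definition to_quat_real :: "real \<Rightarrow> quat" where
  "to_quat x = of_real x" for x :: real

instance
proof
  show "to_quat (conjugate x) = qconj (to_quat x)" for x :: real
    by (simp add: conjugate_real_def to_quat_real_def of_real_def one_quat_def scaleR_quat_def
        qconj_def)
  have "range (to_quat :: real \<Rightarrow> quat) = range of_real"
    by (rule image_cong) (simp_all add: to_quat_real_def)
  then show "range (to_quat :: real \<Rightarrow> quat) = range of_real
      \<or> range (to_quat :: real \<Rightarrow> quat) = {z. qj z = 0 \<and> qk z = 0}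
      \<or> range (to_quat :: real \<Rightarrow> quat) = UNIV"
    by blast
qed (simp_all add: to_quat_real_def scaleR_conv_of_real)

end

instantiation complex :: rch
begin

definition conjugate_complex :: "complex \<Rightarrow> complex" where
  "conjugate z = cnj z"

definition to_quat_complex :: "complex \<Rightarrow> quat" where
  "to_quat z = Quat (Re z) (Im z) 0 0"

instance
proof
  have "z \<in> range (to_quat :: complex \<Rightarrow> quat)" if "qj z = 0 \<and> qk z = 0" for z :: quat
    by (rule image_eqI [where x = "Complex (qre z) (qi z)"])
      (use that in \<open>simp_all add: to_quat_complex_def quat_eq_iff\<close>)
  then have "range (to_quat :: complex \<Rightarrow> quat) = {z. qj z = 0 \<and> qk z = 0}"
    by (auto simp: to_quat_complex_def)
  then show "range (to_quat :: complex \<Rightarrow> quat) = range of_real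
      \<or> range (to_quat :: complex \<Rightarrow> quat) = {z. qj z = 0 \<and> qk z = 0}
      \<or> range (to_quat :: complex \<Rightarrow> quat) = UNIV"
    by blast
qed (simp_all add: conjugate_complex_def to_quat_complex_def quat_ops_defs norm_quat_def
      norm_complex_def)

end

instantiation quat :: rch
begin

definition conjugate_quat :: "quat \<Rightarrow> quat" where
  "conjugate x = qconj x"

definition to_quat_quat :: "quat \<Rightarrow> quat" where
  "to_quat x = x" for x :: quat

instance
  by standard (auto simp: conjugate_quat_def to_quat_quat_def)

end

definition re :: "'f::rch \<Rightarrow> real" where
  "re x = qre (to_quat x)"


section \<open>Hermitian matrices\<close>

definition adjoint_matrix :: "'f::rch ^ 'q ^ 'q \<Rightarrow> 'f ^ 'q ^ 'q" where
  "adjoint_matrix x = (\<chi> i j. conjugate (x $ j $ i))"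

definition Herm :: "('f::rch ^ 'q ^ 'q) set" where
  "Herm = {x. x = adjoint_matrix x}"

text \<open>
  The next lemmas show that the library's inner product and norm on square matrices are those
  of the mathematical text: the scalar product is Re tr(x* y), and on Hermitian matrices
  the norm is the square root of tr(s s), which is a real number.
\<close>

lemma to_quat_diff: "to_quat (x - y) = to_quat x - to_quat (y :: 'f::rch)"
  by (metis add_diff_cancel_right' diff_add_cancel to_quat_add)

lemma inner_to_quat: "inner (to_quat x) (to_quat y) = inner x (y :: 'f::rch)"
  by (simp add: dot_norm norm_to_quat flip: to_quat_add)

lemma inner_eq_re: "inner x y = re (conjugate x * y)" for x y :: "'f::rch"
proof -
  have "inner x y = inner (to_quat x) (to_quat y)"
    by (simp add: inner_to_quat)
  also have "\<dots> = qre (qconj (to_quat x) * to_quat y)"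
    by (simp add: inner_quat_def qconj_def times_quat_def)
  finally show ?thesis
    by (simp add: re_def to_quat_mult to_quat_conjugate)
qed

lemma re_sum: "re (\<Sum>i\<in>A. f i) = (\<Sum>i\<in>A. re (f i :: 'f::rch))"
proof (induction A rule: infinite_finite_induct)
  case (insert a A)
  then show ?case
    by (simp add: re_def to_quat_add plus_quat_def)
qed (use to_quat_scaleR [of 0 "0 :: 'f"] in \<open>simp_all add: re_def zero_quat_def\<close>)

lemma inner_matrix_eq: "inner x y = re (trace (adjoint_matrix x ** y))"
  for x y :: "'f::rch ^ 'q ^ 'q"
proof -
  have "inner x y = (\<Sum>i\<in>UNIV. \<Sum>j\<in>UNIV. re (conjugate (x $ i $ j) * y $ i $ j))"
    by (simp add: inner_vec_def inner_eq_re)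
  also have "\<dots> = (\<Sum>j\<in>UNIV. \<Sum>i\<in>UNIV. re (conjugate (x $ i $ j) * y $ i $ j))"
    by (rule sum.swap)
  finally show ?thesis
    by (simp add: trace_def matrix_matrix_mult_def adjoint_matrix_def re_sum)
qed

lemma norm_Herm: "norm s = sqrt (re (trace (s ** s)))" if "s \<in> Herm"
  using that by (simp add: norm_eq_sqrt_inner inner_matrix_eq Herm_def)

lemma conjugate_mult_self: "conjugate x * x = of_real ((norm x)\<^sup>2)" for x :: "'f::rch"
proof -
  have inj: "to_quat a = to_quat b \<Longrightarrow> a = b" for a b :: 'f
    by (metis norm_to_quat norm_eq_zero right_minus_eq to_quat_diff)
  have "qconj z * z = scaleR ((norm z)\<^sup>2) 1" for z :: quat
    unfolding quat_norm_square by (simp add: quat_ops_defs power2_eq_square)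
  then show ?thesis
    by (intro inj)
      (simp add: of_real_def to_quat_mult to_quat_conjugate to_quat_scaleR to_quat_one norm_to_quat)
qed

lemma trace_square_Herm: "trace (s ** s) = of_real ((norm s)\<^sup>2)"
  if "s \<in> Herm" for s :: "'f::rch ^ 'q ^ 'q"
proof -
  have "trace (s ** s) = trace (adjoint_matrix s ** s)"
    using that by (simp add: Herm_def)
  also have "\<dots> = (\<Sum>j\<in>UNIV. \<Sum>i\<in>UNIV. of_real ((norm (s $ i $ j))\<^sup>2))"
    by (simp add: trace_def matrix_matrix_mult_def adjoint_matrix_def conjugate_mult_self)
  also have "\<dots> = (\<Sum>i\<in>UNIV. \<Sum>j\<in>UNIV. of_real ((norm (s $ i $ j))\<^sup>2))"
    by (rule sum.swap)
  also have "\<dots> = of_real ((norm s)\<^sup>2)"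
    by (simp add: power2_norm_eq_inner inner_vec_def)
  finally show ?thesis .
qed

definition psd_cone :: "('f::rch ^ 'q ^ 'q) set" where
  "psd_cone = {s \<in> Herm.
     \<forall>v :: 'f ^ 'q. 0 \<le> re (\<Sum>i\<in>UNIV. \<Sum>j\<in>UNIV. conjugate (v $ i) * s $ i $ j * v $ j)}"

definition psd_sqrt :: "'f::rch ^ 'q ^ 'q \<Rightarrow> 'f ^ 'q ^ 'q" where
  "psd_sqrt a = (THE s. s \<in> psd_cone \<and> s ** s = a)"


section \<open>Rectangular matrices with a variable number of rows\<close>

text \<open>
  A matrix with p rows and columns indexed by the type \<open>'q\<close> is the family of its rows, an
  element of \<open>{..<p} \<rightarrow>\<^sub>E UNIV\<close>; here \<open>p\<close> is a natural number that may vary. The finite product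
  sigma algebra is the Borel sigma algebra of this Euclidean space.
\<close>

definition mat_space :: "nat \<Rightarrow> (nat \<Rightarrow> 'f::rch ^ 'q) measure" where
  "mat_space p = PiM {..<p} (\<lambda>_. borel)"

definition gram :: "nat \<Rightarrow> (nat \<Rightarrow> 'f::rch ^ 'q) \<Rightarrow> 'f ^ 'q ^ 'q" where
  "gram p x = (\<chi> j k. \<Sum>i<p. conjugate (x i $ j) * x i $ k)"

definition phi :: "nat \<Rightarrow> (nat \<Rightarrow> 'f::rch ^ 'q) \<Rightarrow> 'f ^ 'q ^ 'q" where
  "phi p x = psd_sqrt (gram p x)"

definition unitary_group :: "nat \<Rightarrow> (nat \<Rightarrow> nat \<Rightarrow> 'f::rch) set" where
  "unitary_group p =
     {u. \<forall>i<p. \<forall>j<p. (\<Sum>k<p. conjugate (u k i) * u k j) = (if i = j then 1 else 0)}"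

text \<open>The operator \<open>*s\<close> multiplies all components of a row by a scalar from the left.\<close>

definition left_mult :: "nat \<Rightarrow> (nat \<Rightarrow> nat \<Rightarrow> 'f::rch) \<Rightarrow> (nat \<Rightarrow> 'f ^ 'q) \<Rightarrow> nat \<Rightarrow> 'f ^ 'q" where
  "left_mult p u x = (\<lambda>i\<in>{..<p}. \<Sum>k<p. u i k *s x k)"

definition radial :: "nat \<Rightarrow> (nat \<Rightarrow> 'f::rch ^ 'q) measure \<Rightarrow> bool" where
  "radial p \<mu> \<longleftrightarrow> (\<forall>u\<in>unitary_group p. distr \<mu> (mat_space p) (left_mult p u) = \<mu>)"

definition radial_lift ::
    "nat \<Rightarrow> ('f::rch ^ 'q ^ 'q) measure \<Rightarrow> (nat \<Rightarrow> 'f ^ 'q) measure \<Rightarrow> bool" where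
  "radial_lift p \<nu> \<mu> \<longleftrightarrow> prob_space \<mu> \<and> sets \<mu> = sets (mat_space p) \<and> radial p \<mu> \<and>
     distr \<mu> (restrict_space borel psd_cone) (phi p) = \<nu>"

definition iid_with_law ::
    "'w measure \<Rightarrow> 'a measure \<Rightarrow> 'a measure \<Rightarrow> (nat \<Rightarrow> 'w \<Rightarrow> 'a) \<Rightarrow> bool" where
  "iid_with_law M E \<mu> X \<longleftrightarrow> prob_space M \<and> prob_space.indep_vars M (\<lambda>_. E) X {1..} \<and>
     (\<forall>k\<ge>1. distr M E (X k) = \<mu>)"

definition partial_sum ::
    "nat \<Rightarrow> (nat \<Rightarrow> 'w \<Rightarrow> nat \<Rightarrow> 'f::rch ^ 'q) \<Rightarrow> nat \<Rightarrow> 'w \<Rightarrow> nat \<Rightarrow> 'f ^ 'q" where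
  "partial_sum p X n \<omega> = (\<lambda>i\<in>{..<p}. \<Sum>k=1..n. X k \<omega> i)"


section \<open>Covariance, normal distributions, convergence in distribution\<close>

text \<open>
  Covariance matrices are represented without choosing a basis, as bilinear forms. With respect
  to an orthonormal basis \<open>b\<^sub>1, \<dots>, b\<^sub>d\<close> of the subspace in question, the entries of the
  covariance matrix are the values \<open>covariance M Y b\<^sub>i b\<^sub>j\<close>.
\<close>

definition covariance :: "'w measure \<Rightarrow> ('w \<Rightarrow> 'a::euclidean_space) \<Rightarrow> 'a \<Rightarrow> 'a \<Rightarrow> real" where
  "covariance M Y a b =
     (\<integral>\<omega>. (a \<bullet> Y \<omega> - (\<integral>\<omega>'. a \<bullet> Y \<omega>' \<partial>M)) * (b \<bullet> Y \<omega> - (\<integral>\<omega>'. b \<bullet> Y \<omega>' \<partial>M)) \<partial>M)"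

definition normal_law_real :: "real \<Rightarrow> real \<Rightarrow> real measure" where
  "normal_law_real m v =
     (if v = 0 then return borel m else density lborel (normal_density m (sqrt v)))"

text \<open>
  \<open>N\<close> is the (possibly degenerate) normal distribution with mean \<open>m\<close> and covariance form \<open>C\<close> on
  the linear subspace \<open>V\<close>: every linear functional on \<open>V\<close>, that is, every \<open>x \<mapsto> a \<bullet> x\<close>
  with \<open>a \<in> V\<close>, is normally distributed with the appropriate parameters.
\<close>

definition is_normal_on ::
    "'a::euclidean_space set \<Rightarrow> 'a \<Rightarrow> ('a \<Rightarrow> 'a \<Rightarrow> real) \<Rightarrow> 'a measure \<Rightarrow> bool" where
  "is_normal_on V m C N \<longleftrightarrow> prob_space N \<and> sets N = sets (restrict_space borel V) \<and>
     (\<forall>a\<in>V. distr N borel (\<lambda>x. a \<bullet> x) = normal_law_real (a \<bullet> m) (C a a))"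

text \<open>
  Weak convergence of the laws of the \<open>V\<close>-valued random variables \<open>Y 1\<close>, \<open>Y 2\<close>, ... to \<open>N\<close>.
  Each \<open>Y n\<close> may live on its own probability space \<open>M n\<close>.
\<close>

definition converges_in_distribution ::
    "'a::topological_space set \<Rightarrow> (nat \<Rightarrow> 'w measure) \<Rightarrow> (nat \<Rightarrow> 'w \<Rightarrow> 'a) \<Rightarrow> 'a measure \<Rightarrow> bool" where
  "converges_in_distribution V M Y N \<longleftrightarrow>
     (\<forall>n\<ge>1. Y n \<in> measurable (M n) (restrict_space borel V)) \<and>
     (\<forall>f :: 'a \<Rightarrow> real. continuous_on V f \<longrightarrow> bounded (f ` V) \<longrightarrow>
        (\<lambda>n. \<integral>\<omega>. f (Y n \<omega>) \<partial>M n) \<longlonglongrightarrow> (\<integral>x. f x \<partial>N))"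

end

theory Submission
  imports Defs
begin

text \<open>
  The square of \<open>phi p x\<close> is the Gram matrix \<open>x\<^sup>* x\<close>. For a sum \<open>S = X 1 + \<dots> + X n\<close> it splits into
  the diagonal part, the sum of the \<open>(X k)\<^sup>* X k\<close>, and the off-diagonal part, the sum of the
  \<open>(X k)\<^sup>* X l\<close> with \<open>k \<noteq> l\<close>.

  The diagonal summands are independent and distributed as \<open>s ** s\<close> with \<open>s\<close> drawn from \<open>\<nu>\<close>, whatever
  \<open>p\<close> is; this law has a finite second moment, mean \<open>\<sigma>2\<close>, and the covariance of the limit. The
  diagonal part therefore obeys the classical central limit theorem (\<open>char_power_tendsto\<close>), uniformly
  in \<open>p\<close>.

  The off-diagonal part is negligible. A radial law is invariant under sign changes and permutations
  of the rows, so the rows of \<open>X k\<close> are orthogonal in mean square and share its second moment \<open>m\<close>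
  equally. Hence \<open>y\<^sup>* X k\<close> has mean square \<open>m / p\<close> times the squared norm of \<open>y\<close>
  (\<open>cross_second_moment\<close>), and since \<open>X k\<close> may be replaced by its negative, the increments of the
  off-diagonal part are orthogonal. Its mean square is thus at most \<open>2 n\<^sup>2 m\<^sup>2 / p\<close>
  (\<open>second_moment_remainder\<close>). After division by \<open>sqrt n\<close> this becomes a multiple of \<open>n / p\<close>, which
  tends to zero.

  Three tools are built for this. Square roots of positive semidefinite operators
  (\<open>psd_operator_sqrt\<close>) show that \<open>phi\<close> is well defined over all three skew fields, and construct
  Gaussian measures with a given covariance (\<open>centred_gaussian_exists\<close>). A continuity theorem for
  characteristic functions on Euclidean spaces (\<open>levy_continuity_euclidean\<close>) reduces convergence in
  distribution to the real random variables \<open>a \<bullet> Y\<close>. It is derived from the one-dimensional theorem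
  and the approximation of continuous functions by trigonometric polynomials that are bounded on the
  whole space.
\<close>

section \<open>Levy continuity in Euclidean space\<close>

text \<open>
  With \<open>a = 0\<close> or a phase shift the generators include the constants and the sines, so this is
  the algebra of real trigonometric polynomials; the presentation as sums of single waves makes
  the integral of such a function a real linear image of characteristic function values.
\<close>
inductive trig_poly :: "('a::real_inner \<Rightarrow> real) \<Rightarrow> bool" where
  wave: "trig_poly (\<lambda>x. k * cos (a \<bullet> x + c))"
| add: "trig_poly f \<Longrightarrow> trig_poly g \<Longrightarrow> trig_poly (\<lambda>x. f x + g x)"

lemma trig_poly_const: "trig_poly (\<lambda>x. k)"
  using wave [of k 0 0] by simp

text \<open>
  The product-to-sum formula for cosines is what makes the sums of waves an algebra.
\<close>
lemma trig_poly_wave_mult: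
  assumes "trig_poly g"
  shows "trig_poly (\<lambda>x. (k * cos (a \<bullet> x + c)) * g x)"
  using assms
proof induction
  case (wave l b d)
  have "(k * cos (a \<bullet> x + c)) * (l * cos (b \<bullet> x + d)) =
      k * l / 2 * cos ((a - b) \<bullet> x + (c - d)) + k * l / 2 * cos ((a + b) \<bullet> x + (c + d))" for x
  proof -
    have e: "(a - b) \<bullet> x + (c - d) = (a \<bullet> x + c) - (b \<bullet> x + d)"
      "(a + b) \<bullet> x + (c + d) = (a \<bullet> x + c) + (b \<bullet> x + d)"
      by (simp_all add: inner_diff_left inner_add_left)
    show ?thesis
      unfolding e cos_diff cos_add by (simp add: field_simps)
  qed
  then show ?case
    by (simp only:) (intro trig_poly.intros)
next
  case (add f g)
  then show ?case
    by (simp add: distrib_left trig_poly.add)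
qed

lemma trig_poly_mult:
  assumes "trig_poly f" "trig_poly g"
  shows "trig_poly (\<lambda>x. f x * g x)"
  using assms
proof induction
  case (wave k a c)
  then show ?case
    by (rule trig_poly_wave_mult)
next
  case (add f f')
  then show ?case
    unfolding distrib_right by (intro trig_poly.add)
qed

lemma trig_poly_sum: "(\<And>i. i \<in> A \<Longrightarrow> trig_poly (f i)) \<Longrightarrow> trig_poly (\<lambda>x. \<Sum>i\<in>A. f i x)"
  by (induction A rule: infinite_finite_induct) (simp_all add: trig_poly_const trig_poly.add)

definition sin_vec :: "real \<Rightarrow> 'a::euclidean_space \<Rightarrow> 'a" where
  "sin_vec L x = (\<Sum>b\<in>Basis. sin ((b \<bullet> x) / L) *\<^sub>R b)"

text \<open>
  Each coordinate of \<open>sin_vec L x\<close> is a single wave in \<open>x\<close>, and trigonometric polynomials form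
  an algebra.
\<close>
lemma trig_poly_polynomial_sin_vec:
  assumes "real_polynomial_function g"
  shows "trig_poly (\<lambda>x. g (sin_vec L x))"
  using assms
proof induction
  case (linear f)
  have "trig_poly (\<lambda>x. sin ((b \<bullet> x) / L) * f b)" for b
  proof -
    have "sin ((b \<bullet> x) / L) * f b = f b * cos ((b /\<^sub>R L) \<bullet> x + - (pi / 2))" for x
      by (simp add: cos_diff inverse_eq_divide)
    then show ?thesis
      by (simp only: wave)
  qed
  moreover have "f (sin_vec L x) = (\<Sum>b\<in>Basis. sin ((b \<bullet> x) / L) * f b)" for x
    using linear unfolding sin_vec_def
    by (simp add: bounded_linear.linear linear_sum linear_scale)
  ultimately show ?case
    by (simp only: trig_poly_sum)
next
  case (const c)
  show ?case
    by (rule trig_poly_const)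
next
  case (add f g)
  then show ?case
    by (intro trig_poly.add)
next
  case (mult f g)
  then show ?case
    by (intro trig_poly_mult)
qed

lemma bounded_continuous_integrable:
  fixes f :: "'a::euclidean_space \<Rightarrow> real"
  assumes "prob_space N" "sets N = sets borel" "continuous_on UNIV f" "\<And>x. \<bar>f x\<bar> \<le> B"
  shows "integrable N f"
proof -
  interpret prob_space N by fact
  have "f \<in> borel_measurable N"
    using borel_measurable_continuous_onI [OF assms(3)] assms(2) by (simp cong: measurable_cong_sets)
  then show ?thesis
    using assms(4) by (intro integrable_const_bound [of _ B]) auto
qed

lemma trig_poly_continuous: "trig_poly g \<Longrightarrow> continuous_on UNIV g"
  by (induction rule: trig_poly.induct) (auto intro!: continuous_intros)

lemma trig_poly_bounded: "trig_poly g \<Longrightarrow> \<exists>B. \<forall>x. \<bar>g x\<bar> \<le> B"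
proof (induction rule: trig_poly.induct)
  case (wave k a c)
  have "\<bar>k * cos (a \<bullet> x + c)\<bar> \<le> \<bar>k\<bar>" for x
    by (simp add: abs_mult mult_left_le)
  then show ?case by blast
next
  case (add f g)
  then obtain A B where "\<forall>x. \<bar>f x\<bar> \<le> A" "\<forall>x. \<bar>g x\<bar> \<le> B" by blast
  then have "\<bar>f x + g x\<bar> \<le> A + B" for x
    by (meson abs_triangle_ineq add_mono order_trans)
  then show ?case by blast
qed

lemma trig_poly_integrable:
  fixes N :: "'a::euclidean_space measure"
  assumes "trig_poly g" "prob_space N" "sets N = sets borel"
  shows "integrable N g"
  using trig_poly_bounded [OF assms(1)] trig_poly_continuous [OF assms(1)]
    bounded_continuous_integrable [OF assms(2,3)] by blast

lemma integrable_iexp_inner: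
  fixes N :: "'a::euclidean_space measure"
  assumes "prob_space N" "sets N = sets borel"
  shows "integrable N (\<lambda>x. iexp (a \<bullet> x))"
proof -
  interpret prob_space N by fact
  have "(\<lambda>x. complex_of_real (a \<bullet> x)) \<in> borel_measurable N"
    using assms(2) by (simp cong: measurable_cong_sets)
  then show ?thesis by (intro integrable_iexp) auto
qed

lemma integral_wave:
  fixes N :: "'a::euclidean_space measure"
  assumes "prob_space N" "sets N = sets borel"
  shows "(\<integral>x. k * cos (a \<bullet> x + c) \<partial>N) = Re (k * iexp c * (\<integral>x. iexp (a \<bullet> x) \<partial>N))"
proof -
  note i = integrable_iexp_inner [OF assms, of a]
  have "Re (k * iexp c * (\<integral>x. iexp (a \<bullet> x) \<partial>N)) = Re (\<integral>x. k * iexp c * iexp (a \<bullet> x) \<partial>N)"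
    by simp
  also have "\<dots> = (\<integral>x. Re (k * iexp c * iexp (a \<bullet> x)) \<partial>N)"
    using i by (intro integral_Re [symmetric]) auto
  also have "\<dots> = (\<integral>x. k * cos (a \<bullet> x + c) \<partial>N)"
    by (simp add: cos_add Re_exp Im_exp right_diff_distrib mult_ac)
  finally show ?thesis ..
qed

lemma trig_poly_integral_tendsto:
  fixes N :: "'a::euclidean_space measure"
  assumes N: "prob_space N" "sets N = sets borel"
    and Ns: "\<And>n. prob_space (Ns n)" "\<And>n. sets (Ns n) = sets borel"
    and conv: "\<And>a. (\<lambda>n. \<integral>x. iexp (a \<bullet> x) \<partial>Ns n) \<longlonglongrightarrow> (\<integral>x. iexp (a \<bullet> x) \<partial>N)"
    and "trig_poly g"
  shows "(\<lambda>n. \<integral>x. g x \<partial>Ns n) \<longlonglongrightarrow> (\<integral>x. g x \<partial>N)"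
  using \<open>trig_poly g\<close>
proof induction
  case (wave k a c)
  show ?case
    unfolding integral_wave [OF N] integral_wave [OF Ns] by (intro tendsto_intros conv)
next
  case (add f g)
  then show ?case
    by (simp add: trig_poly_integrable N Ns tendsto_add)
qed

text \<open>
  The values of the characteristic function on the line through \<open>a\<close> are the characteristic
  function of the image law on the real line, so the one-dimensional theorem applies. This gives
  the control of the tails in the multidimensional theorem.
\<close>
lemma weak_conv_inner:
  fixes N :: "'a::euclidean_space measure"
  assumes N: "prob_space N" "sets N = sets borel"
    and Ns: "\<And>n. prob_space (Ns n)" "\<And>n. sets (Ns n) = sets borel"
    and conv: "\<And>a. (\<lambda>n. \<integral>x. iexp (a \<bullet> x) \<partial>Ns n) \<longlonglongrightarrow> (\<integral>x. iexp (a \<bullet> x) \<partial>N)"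
    and h: "continuous_on UNIV h" "\<And>t. \<bar>h t\<bar> \<le> (B :: real)"
  shows "(\<lambda>n. \<integral>x. h (a \<bullet> x) \<partial>Ns n) \<longlonglongrightarrow> (\<integral>x. h (a \<bullet> x) \<partial>N)"
proof -
  have meas: "(\<lambda>x. a \<bullet> x) \<in> borel_measurable K" if "sets K = sets borel" for K :: "'a measure"
    using that by (simp cong: measurable_cong_sets)
  have distr: "real_distribution (distr K borel (\<lambda>x. a \<bullet> x))"
    if "prob_space K" "sets K = sets borel" for K :: "'a measure"
    using that meas by (intro prob_space.real_distribution_distr)
  have char: "char (distr K borel (\<lambda>x. a \<bullet> x)) t = (\<integral>x. iexp ((t *\<^sub>R a) \<bullet> x) \<partial>K)"
    if "sets K = sets borel" for K :: "'a measure" and t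
    unfolding char_def using meas [OF that] by (subst integral_distr) simp_all
  have weak: "weak_conv_m (\<lambda>n. distr (Ns n) borel (\<lambda>x. a \<bullet> x)) (distr N borel (\<lambda>x. a \<bullet> x))"
    by (rule levy_continuity) (simp_all only: distr N Ns char conv)
  have hm: "h \<in> borel_measurable borel"
    using h(1) by (rule borel_measurable_continuous_onI)
  have "(\<lambda>n. integral\<^sup>L (distr (Ns n) borel (\<lambda>x. a \<bullet> x)) h)
      \<longlonglongrightarrow> integral\<^sup>L (distr N borel (\<lambda>x. a \<bullet> x)) h"
    using h by (intro weak_conv_imp_integral_bdd_continuous_conv [where B = B] distr N Ns weak)
      (auto simp: continuous_on_eq_continuous_at)
  then show ?thesis
    by (simp add: integral_distr meas N Ns hm)
qed

text \<open>
  A continuous majorant of the indicator of the complement of the box of radius \<open>L + 1\<close>, built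
  from functions of a single coordinate so that its integrals converge by the one-dimensional
  theory.
\<close>
definition tail :: "real \<Rightarrow> 'a::euclidean_space \<Rightarrow> real" where
  "tail L x = (\<Sum>b\<in>Basis. min 1 (max 0 (\<bar>b \<bullet> x\<bar> - L)))"

lemma tail_nonneg: "0 \<le> tail L x"
  unfolding tail_def by (intro sum_nonneg) auto

lemma tail_le: "tail L (x :: 'a::euclidean_space) \<le> DIM('a)"
proof -
  have "tail L x \<le> (\<Sum>b\<in>(Basis :: 'a set). 1)"
    unfolding tail_def by (intro sum_mono) auto
  then show ?thesis by simp
qed

lemma tail_ge_1:
  assumes "b \<in> Basis" "L + 1 \<le> \<bar>b \<bullet> x\<bar>"
  shows "1 \<le> tail L x"
proof -
  have "1 = min 1 (max 0 (\<bar>b \<bullet> x\<bar> - L))"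
    using assms by auto
  also have "\<dots> \<le> tail L x"
    unfolding tail_def using assms by (intro member_le_sum) auto
  finally show ?thesis .
qed

lemma continuous_tail: "continuous_on UNIV (tail L)"
  unfolding tail_def by (intro continuous_intros)

lemma integral_tail_tendsto_0:
  fixes N :: "'a::euclidean_space measure"
  assumes N: "prob_space N" "sets N = sets borel"
  shows "(\<lambda>n. \<integral>x. tail (real n) x \<partial>N) \<longlonglongrightarrow> 0"
proof -
  interpret prob_space N by fact
  have "(\<lambda>n. \<integral>x. tail (real n) x \<partial>N) \<longlonglongrightarrow> (\<integral>x. 0 \<partial>N)"
  proof (rule integral_dominated_convergence)
    show "tail (real n) \<in> borel_measurable N" for n
      using borel_measurable_continuous_onI [OF continuous_tail] N(2)
      by (simp cong: measurable_cong_sets)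
    have "(\<lambda>n. tail (real n) x) \<longlonglongrightarrow> 0" for x :: 'a
    proof -
      have "\<forall>\<^sub>F n in sequentially. tail (real n) x = 0"
        using eventually_ge_at_top [of "nat \<lceil>norm x\<rceil>"]
      proof eventually_elim
        case (elim n)
        have "\<bar>b \<bullet> x\<bar> \<le> real n" if "b \<in> Basis" for b
        proof -
          have "norm x \<le> real n"
            using elim by (simp add: nat_le_iff ceiling_le_iff)
          then show ?thesis
            using Basis_le_norm [OF that, of x] by (simp add: inner_commute)
        qed
        then show ?case
          by (simp add: tail_def)
      qed
      then show ?thesis
        by (rule tendsto_eventually)
    qed
    then show "AE x in N. (\<lambda>n. tail (real n) x) \<longlonglongrightarrow> 0"
      by simp
    show "AE x in N. norm (tail (real n) x) \<le> real DIM('a)" for n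
      using tail_nonneg [of n "_ :: 'a"] tail_le [of n "_ :: 'a"] by simp
  qed simp_all
  then show ?thesis by simp
qed

text \<open>
  On the cube, Weierstrass approximates by a polynomial \<open>P\<close> the function that \<open>f\<close> becomes in the
  coordinates \<open>s = sin_vec K x\<close>. As \<open>sin_vec\<close> takes all its values in the cube, \<open>x \<mapsto> P (sin_vec K x)\<close>
  stays bounded by about \<open>B\<close> on the whole space, while it is close to \<open>f\<close> on the box where the
  coordinate change is invertible. Without this global bound a uniform approximation on a compact
  set would say nothing about integrals.
\<close>
lemma sin_vec_surrogate:
  fixes f :: "'a::euclidean_space \<Rightarrow> real"
  assumes f: "continuous_on UNIV f" and B: "\<And>x. \<bar>f x\<bar> \<le> B" and e: "0 < e" "e \<le> 1" and L: "0 \<le> L"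
  obtains g where "trig_poly g" "\<And>x. \<bar>f x - g x\<bar> \<le> e + (2 * B + 1) * tail L x"
proof -
  \<comment> \<open>The scale for which the box of radius L + 1 corresponds to arguments of sine in
    [-pi/2, pi/2], where arcsine is its inverse.\<close>
  define K where "K = (L + 1) * 2 / pi"
  define C where "C = cbox (- One :: 'a) One"
  define h where "h s = f (\<Sum>b\<in>Basis. (K * arcsin (b \<bullet> s)) *\<^sub>R b)" for s
  have K: "0 < K"
    using L by (simp add: K_def)
  have C: "s \<in> C \<longleftrightarrow> (\<forall>b\<in>Basis. \<bar>b \<bullet> s\<bar> \<le> 1)" for s
    by (auto simp: C_def mem_box inner_commute [of s] abs_le_iff inner_sum_right inner_Basis if_distrib
        cong: if_cong)
  have "continuous_on C h"
    unfolding h_def using C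
    by (intro continuous_on_compose2 [OF f] continuous_intros) (auto simp: abs_le_iff)
  moreover have "compact C"
    by (simp add: C_def)
  ultimately obtain P where P: "real_polynomial_function P" "\<And>s. s \<in> C \<Longrightarrow> \<bar>h s - P s\<bar> < e"
    using Stone_Weierstrass_real_polynomial_function e by metis
  have sin_vec: "b \<bullet> sin_vec K x = sin ((b \<bullet> x) / K)" if "b \<in> Basis" for b x
    unfolding sin_vec_def using that by
        (simp add: inner_sum_right inner_Basis if_distrib cong: if_cong)
  have inC: "sin_vec K x \<in> C" for x
    by (simp add: C sin_vec)
  show thesis
  proof
    show "trig_poly (\<lambda>x. P (sin_vec K x))"
      using P(1) by (rule trig_poly_polynomial_sin_vec)
    fix x
    show "\<bar>f x - P (sin_vec K x)\<bar> \<le> e + (2 * B + 1) * tail L x"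
    proof (cases "\<exists>b\<in>Basis. L + 1 \<le> \<bar>b \<bullet> x\<bar>")
      case True
      then have "1 \<le> tail L x"
        by (auto intro: tail_ge_1)
      moreover have "0 \<le> B"
        using B [of x] by simp
      ultimately have "2 * B + 1 \<le> (2 * B + 1) * tail L x"
        by (simp add: mult_le_cancel_left1)
      moreover have "\<bar>h (sin_vec K x)\<bar> \<le> B" "\<bar>f x\<bar> \<le> B"
        unfolding h_def by (fact B)+
      ultimately show ?thesis
        using P(2) [OF inC, of x] e by linarith
    next
      case False
      have "arcsin (sin ((b \<bullet> x) / K)) = (b \<bullet> x) / K" if "b \<in> Basis" for b
      proof (rule arcsin_sin)
        have "\<bar>b \<bullet> x\<bar> / K \<le> (L + 1) / K"
          using False that K by (intro divide_right_mono) (auto simp: not_le less_imp_le)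
        also have "(L + 1) / K = pi / 2"
          using L by (simp add: K_def field_simps)
        finally have "\<bar>(b \<bullet> x) / K\<bar> \<le> pi / 2"
          using K by simp
        then show "- (pi / 2) \<le> (b \<bullet> x) / K" "(b \<bullet> x) / K \<le> pi / 2"
          by linarith+
      qed
      then have "h (sin_vec K x) = f (\<Sum>b\<in>Basis. (b \<bullet> x) *\<^sub>R b)"
        unfolding h_def using K by (simp add: sin_vec)
      also have "\<dots> = f x"
        by (simp add: euclidean_representation inner_commute [of _ x])
      finally have "\<bar>f x - P (sin_vec K x)\<bar> \<le> e"
        using P(2) [OF inC, of x] by simp
      moreover have "0 \<le> (2 * B + 1) * tail L x"
        using B [of x] tail_nonneg by (intro mult_nonneg_nonneg) auto
      ultimately show ?thesis
        by linarith
    qed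
  qed
qed

text \<open>
  Replace \<open>f\<close> by its trigonometric surrogate. The integrals of the surrogate converge because the
  characteristic functions do. Up to a constant, the error is \<open>e\<close> plus the integral of \<open>tail\<close>,
  which is small for the limit and hence, by convergence in each coordinate, for all late members
  of the sequence.
\<close>
theorem levy_continuity_euclidean:
  fixes N :: "'a::euclidean_space measure" and f :: "'a \<Rightarrow> real"
  assumes N: "prob_space N" "sets N = sets borel"
    and Ns: "\<And>n. prob_space (Ns n)" "\<And>n. sets (Ns n) = sets borel"
    and conv: "\<And>a. (\<lambda>n. \<integral>x. iexp (a \<bullet> x) \<partial>Ns n) \<longlonglongrightarrow> (\<integral>x. iexp (a \<bullet> x) \<partial>N)"
    and f: "continuous_on UNIV f" and B: "\<And>x. \<bar>f x\<bar> \<le> B"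
  shows "(\<lambda>n. \<integral>x. f x \<partial>Ns n) \<longlonglongrightarrow> (\<integral>x. f x \<partial>N)"
proof (rule LIMSEQ_I)
  fix r :: real assume "0 < r"
  have B0: "0 \<le> B"
    using B [of 0] by simp
  define e where "e = min 1 (r / 8)"
  define D where "D = 2 * B + 1"
  have e: "0 < e" "e \<le> 1" "8 * e \<le> r"
    using \<open>0 < r\<close> by (auto simp: e_def)
  have D: "0 < D"
    using B0 by (simp add: D_def)
  have "\<forall>\<^sub>F n in sequentially. (\<integral>x. tail (real n) x \<partial>N) < e / D"
    using order_tendstoD(2) [OF integral_tail_tendsto_0 [OF N], of "e / D"] e D by simp
  then obtain m where m: "(\<integral>x. tail (real m) x \<partial>N) < e / D"
    by (auto simp: eventually_sequentially)
  define T where "T = (tail (real m) :: 'a \<Rightarrow> real)"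
  have "(\<lambda>n. \<integral>x. T x \<partial>Ns n) \<longlonglongrightarrow> (\<integral>x. T x \<partial>N)"
  proof -
    have *: "(\<integral>x. T x \<partial>K) = (\<Sum>b\<in>Basis. \<integral>x. min 1 (max 0 (\<bar>b \<bullet> x\<bar> - real m)) \<partial>K)"
      if "prob_space K" "sets K = sets borel" for K
      unfolding T_def tail_def
      by (intro Bochner_Integration.integral_sum bounded_continuous_integrable [OF that, of _ 1])
        (auto intro!: continuous_intros)
    show ?thesis
      unfolding * [OF N] * [OF Ns]
      by (intro tendsto_sum weak_conv_inner [OF N Ns conv, of _ 1]) (auto intro!: continuous_intros)
  qed
  then have T_conv: "\<forall>\<^sub>F n in sequentially. (\<integral>x. T x \<partial>Ns n) < e / D"
    using m unfolding T_def by (rule order_tendstoD)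
  obtain g where g: "trig_poly g" "\<And>x. \<bar>f x - g x\<bar> \<le> e + D * T x"
    using sin_vec_surrogate [OF f B e(1,2), of "real m"] unfolding T_def D_def by auto
  have "(\<lambda>n. \<integral>x. g x \<partial>Ns n) \<longlonglongrightarrow> (\<integral>x. g x \<partial>N)"
    by (rule trig_poly_integral_tendsto [OF N Ns conv g(1)])
  then have g_conv: "\<forall>\<^sub>F n in sequentially. dist (\<integral>x. g x \<partial>Ns n) (\<integral>x. g x \<partial>N) < e"
    using e(1) by (rule tendstoD)
  have approx: "\<bar>(\<integral>x. f x \<partial>K) - (\<integral>x. g x \<partial>K)\<bar> \<le> 2 * e"
    if K: "prob_space K" "sets K = sets borel" and small: "(\<integral>x. T x \<partial>K) < e / D" for K
  proof -
    interpret prob_space K by fact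
    have i: "integrable K f" "integrable K g" "integrable K T"
      using bounded_continuous_integrable [OF K f B] trig_poly_integrable [OF g(1) K]
        bounded_continuous_integrable [OF K continuous_tail, of "real m" "real DIM('a)"]
        tail_nonneg [of "real m" "_ :: 'a"] tail_le [where 'a = 'a] by (auto simp: T_def)
    have "\<bar>(\<integral>x. f x \<partial>K) - (\<integral>x. g x \<partial>K)\<bar> = \<bar>\<integral>x. f x - g x \<partial>K\<bar>"
      using i by simp
    also have "\<dots> \<le> (\<integral>x. \<bar>f x - g x\<bar> \<partial>K)"
      by (rule integral_abs_bound)
    also have "\<dots> \<le> (\<integral>x. e + D * T x \<partial>K)"
      using i g(2) by (intro integral_mono) auto
    also have "\<dots> = e + D * (\<integral>x. T x \<partial>K)"
      using i by (simp add: prob_space)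
    also have "\<dots> \<le> 2 * e"
      using small D by (simp add: field_simps)
    finally show ?thesis .
  qed
  have "\<forall>\<^sub>F n in sequentially. norm ((\<integral>x. f x \<partial>Ns n) - (\<integral>x. f x \<partial>N)) < r"
    using T_conv g_conv
  proof eventually_elim
    case (elim n)
    show ?case
      using approx [OF N m [folded T_def]] approx [OF Ns elim(1)] elim(2) e
      by (simp add: dist_real_def)
  qed
  then show "\<exists>no. \<forall>n\<ge>no. norm ((\<integral>x. f x \<partial>Ns n) - (\<integral>x. f x \<partial>N)) < r"
    by (simp add: eventually_sequentially)
qed

section \<open>Square roots of positive semidefinite operators\<close>

text \<open>
  Positive semidefinite matrices over any of the three skew fields act as symmetric positive
  semidefinite real operators, and so do covariance forms. One existence theorem for square roots
  of operators serves both; to conclude that the root of a matrix is again a matrix, the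
  construction is carried out inside a closed subalgebra.
\<close>
definition psd_operator :: "('a::euclidean_space \<Rightarrow>\<^sub>L 'a) \<Rightarrow> bool" where
  "psd_operator T \<longleftrightarrow> (\<forall>v w. T v \<bullet> w = v \<bullet> T w) \<and> (\<forall>v. 0 \<le> v \<bullet> T v)"

definition closed_subalgebra :: "('a::euclidean_space \<Rightarrow>\<^sub>L 'a) set \<Rightarrow> bool" where
  "closed_subalgebra A \<longleftrightarrow> closed A \<and> subspace A \<and> id_blinfun \<in> A \<and> (\<forall>S\<in>A. \<forall>T\<in>A. S o\<^sub>L T \<in> A)"

lemma closed_symmetric_operators: "closed {T :: 'a::euclidean_space \<Rightarrow>\<^sub>L 'a. \<forall>v w. T v \<bullet> w = v \<bullet> T w}"
  by (intro closed_Collect_all closed_Collect_eq continuous_intros)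

lemma closed_psd_operators: "closed {T :: 'a::euclidean_space \<Rightarrow>\<^sub>L 'a. psd_operator T}"
  unfolding psd_operator_def
  by (intro closed_Collect_conj closed_Collect_all closed_Collect_eq closed_Collect_le continuous_intros)

text \<open>
  The equation says \<open>(1 - s)\<^sup>2 = 1 - b\<close>. On a ball of radius \<open>r < 1\<close> the map
  \<open>s \<mapsto> (b + s\<^sup>2) / 2\<close> has Lipschitz constant \<open>r\<close>, so the contraction principle applies.
\<close>
lemma fixpoint_half_square:
  fixes b :: "'a::euclidean_space \<Rightarrow>\<^sub>L 'a"
  assumes A: "closed_subalgebra A" and b: "b \<in> A" "\<And>v w. b v \<bullet> w = v \<bullet> b w" "norm b < 1"
  obtains s where "s \<in> A" "\<And>v w. s v \<bullet> w = v \<bullet> s w" "norm s \<le> 1" "2 *\<^sub>R s = b + (s o\<^sub>L s)"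
proof -
  \<comment> \<open>The smaller root of (norm b + r * r) / 2 = r, so that the ball of radius r is mapped to
    itself.\<close>
  define r where "r = 1 - sqrt (1 - norm b)"
  have r: "0 \<le> r" "r < 1"
    using b(3) by (auto simp: r_def)
  have "(1 - r)\<^sup>2 = 1 - norm b"
    using b(3) by (simp add: r_def)
  then have r2: "norm b + r\<^sup>2 = 2 * r"
    by (simp add: power2_diff)
  define S where "S = A \<inter> {T :: 'a \<Rightarrow>\<^sub>L 'a. \<forall>v w. T v \<bullet> w = v \<bullet> T w} \<inter> cball 0 r"
  define F where "F s = (1/2) *\<^sub>R (b + (s o\<^sub>L s))" for s
  have alg: "closed A" "subspace A" "\<And>S T. S \<in> A \<Longrightarrow> T \<in> A \<Longrightarrow> S o\<^sub>L T \<in> A"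
    using A by (auto simp: closed_subalgebra_def)
  have "\<exists>!s. s \<in> S \<and> F s = s"
  proof (rule Banach_fix)
    show "Topological_Spaces.complete S"
      unfolding S_def complete_eq_closed
      by (intro closed_Int alg closed_symmetric_operators closed_cball)
    have "0 \<in> S"
      using r alg by (auto simp: S_def subspace_0)
    then show "S \<noteq> {}"
      by blast
    show "F ` S \<subseteq> S"
    proof
      fix t assume "t \<in> F ` S"
      then obtain s where s: "s \<in> S" "t = F s" by blast
      have "norm (s o\<^sub>L s) \<le> r * r"
        using s(1) r by (intro order_trans [OF norm_blinfun_compose] mult_mono) (auto simp: S_def)
      then have "norm t \<le> (norm b + r * r) / 2"
        using norm_triangle_ineq [of b "s o\<^sub>L s"] s(2) by (simp add: F_def)
      then have "norm t \<le> r"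
        using r2 by (simp add: power2_eq_square)
      moreover have "t \<in> A"
        using s b(1) alg by (auto simp: F_def S_def intro: subspace_scale subspace_add)
      moreover have "t v \<bullet> w = v \<bullet> t w" for v w
        using s b(2) by (simp add: F_def S_def blinfun.bilinear_simps inner_add_left inner_add_right)
      ultimately show "t \<in> S"
        by (simp add: S_def)
    qed
    show "dist (F s) (F t) \<le> r * dist s t" if "s \<in> S" "t \<in> S" for s t
    proof -
      have "F s - F t = (1/2) *\<^sub>R ((s o\<^sub>L (s - t)) + ((s - t) o\<^sub>L t))"
        by (rule blinfun_eqI) (simp add: F_def blinfun.bilinear_simps algebra_simps)
      also have "norm \<dots> \<le> (1/2) * (norm s * norm (s - t) + norm (s - t) * norm t)"
        using norm_triangle_ineq [of "s o\<^sub>L (s - t)" "(s - t) o\<^sub>L t"]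
          norm_blinfun_compose [of s "s - t"] norm_blinfun_compose [of "s - t" t] by simp
      also have "\<dots> \<le> (1/2) * (r * norm (s - t) + norm (s - t) * r)"
        using that r by (intro mult_left_mono add_mono mult_mono) (auto simp: S_def)
      finally show ?thesis
        by (simp add: dist_norm)
    qed
  qed (use r in auto)
  then obtain s where s: "s \<in> S" "F s = s" by blast
  show thesis
  proof
    show "2 *\<^sub>R s = b + (s o\<^sub>L s)"
      using arg_cong [OF s(2), of "scaleR 2"] by (simp add: F_def)
  qed (use s r in \<open>auto simp: S_def\<close>)
qed

text \<open>
  After division by a large constant \<open>c\<close> a strictly positive operator has the form \<open>1 - b\<close> with
  \<open>norm b < 1\<close>. This follows from expanding \<open>(norm (b v))\<^sup>2\<close>, whose linear term
  \<open>- 2 (v \<bullet> T v) / c\<close> beats the quadratic one.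
\<close>
lemma psd_operator_sqrt_strict:
  fixes T :: "'a::euclidean_space \<Rightarrow>\<^sub>L 'a"
  assumes A: "closed_subalgebra A" and T: "T \<in> A" "psd_operator T"
    and e: "0 < e" "\<And>v. e * (norm v)\<^sup>2 \<le> v \<bullet> T v"
  obtains S where "S \<in> A" "psd_operator S" "S o\<^sub>L S = T"
proof -
  define K where "K = norm T"
  \<comment> \<open>This choice minimizes the bound 1 - 2 e / c + K^2 / c^2 for the squared norm of b below.\<close>
  define c where "c = K\<^sup>2 / e"
  have alg: "subspace A" "id_blinfun \<in> A"
    using A by (auto simp: closed_subalgebra_def)
  have eK: "e \<le> K"
  proof -
    obtain v :: 'a where v: "norm v = 1"
      using SOME_Basis norm_Basis by blast
    have "e \<le> v \<bullet> T v"
      using e(2) [of v] v by simp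
    also have "\<dots> \<le> norm v * norm (T v)"
      by (rule norm_cauchy_schwarz)
    also have "\<dots> \<le> K"
      using norm_blinfun [of T v] v by (simp add: K_def)
    finally show ?thesis .
  qed
  then have c: "0 < c"
    using e by (simp add: c_def)
  define b where "b = id_blinfun - (1 / c) *\<^sub>R T"
  define q where "q = 1 - e\<^sup>2 / K\<^sup>2"
  have q: "0 \<le> q" "q < 1"
    using eK e(1) by (auto simp: q_def power_mono)
  have "norm (b v) \<le> sqrt q * norm v" for v
  proof (rule power2_le_imp_le)
    have "norm (T v) \<le> K * norm v"
      by (simp add: K_def norm_blinfun)
    then have Tv: "(norm (T v))\<^sup>2 \<le> K\<^sup>2 * (norm v)\<^sup>2"
      by (metis norm_ge_zero power_mono power_mult_distrib)
    have "(norm (b v))\<^sup>2 = (norm v)\<^sup>2 - 2 / c * (v \<bullet> T v) + (norm (T v))\<^sup>2 / c\<^sup>2"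
      unfolding power2_norm_eq_inner b_def
      by (simp add: blinfun.bilinear_simps inner_diff_left inner_diff_right inner_commute
          power2_eq_square)
    also have "\<dots> \<le> (norm v)\<^sup>2 - 2 / c * (e * (norm v)\<^sup>2) + K\<^sup>2 * (norm v)\<^sup>2 / c\<^sup>2"
      using e(2) [of v] Tv c by (intro add_mono diff_mono mult_left_mono divide_right_mono) auto
    also have "\<dots> = q * (norm v)\<^sup>2"
      using e(1) eK by (simp add: c_def q_def field_simps power2_eq_square)
    finally show "(norm (b v))\<^sup>2 \<le> (sqrt q * norm v)\<^sup>2"
      using q by (simp add: power_mult_distrib)
  qed (use q in simp)
  then have "norm b \<le> sqrt q"
    using q by (intro norm_blinfun_bound) auto
  then have norm_b: "norm b < 1"
    using q by (metis real_sqrt_lt_1_iff order_le_less_trans)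
  have b: "b \<in> A" "\<And>v w. b v \<bullet> w = v \<bullet> b w"
    using T alg by (auto simp: b_def psd_operator_def blinfun.bilinear_simps inner_diff_left
        inner_diff_right intro!: subspace_diff subspace_scale)
  obtain s where s: "s \<in> A" "\<And>v w. s v \<bullet> w = v \<bullet> s w" "norm s \<le> 1" "2 *\<^sub>R s = b + (s o\<^sub>L s)"
    using fixpoint_half_square [OF A b norm_b] by blast
  define S where "S = sqrt c *\<^sub>R (id_blinfun - s)"
  show thesis
  proof
    show "S \<in> A"
      using s alg by (auto simp: S_def intro!: subspace_diff subspace_scale)
    have "0 \<le> v \<bullet> S v" for v
    proof -
      have "v \<bullet> s v \<le> norm v * norm (s v)"
        by (rule norm_cauchy_schwarz)
      also have "\<dots> \<le> norm v * norm v"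
        using norm_blinfun [of s v] s(3)
        by (meson mult_left_le_one_le mult_left_mono norm_ge_zero order_trans)
      finally show ?thesis
        using c by (simp add: S_def
            blinfun.bilinear_simps inner_diff_right dot_square_norm power2_eq_square)
    qed
    then show "psd_operator S"
      using s(2) by (simp add: psd_operator_def S_def blinfun.bilinear_simps inner_diff_left
          inner_diff_right)
    have "S o\<^sub>L S = c *\<^sub>R (id_blinfun - (2 *\<^sub>R s - (s o\<^sub>L s)))"
      using c by (intro blinfun_eqI)
        (simp add: S_def blinfun.bilinear_simps algebra_simps scaleR_2)
    also have "\<dots> = T"
      using c by (simp add: s(4) b_def)
    finally show "S o\<^sub>L S = T" .
  qed
qed

text \<open>
  The roots of \<open>T + 1 / (n + 1)\<close> are uniformly bounded, since \<open>(norm (S v))\<^sup>2 = v \<bullet> S (S v)\<close> for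
  symmetric \<open>S\<close>; a limit point of them is a root of \<open>T\<close>.
\<close>
theorem psd_operator_sqrt:
  fixes T :: "'a::euclidean_space \<Rightarrow>\<^sub>L 'a"
  assumes A: "closed_subalgebra A" and T: "T \<in> A" "psd_operator T"
  obtains S where "S \<in> A" "psd_operator S" "S o\<^sub>L S = T"
proof -
  define Tn where "Tn n = T + inverse (real (Suc n)) *\<^sub>R id_blinfun" for n
  have alg: "subspace A" "id_blinfun \<in> A" "closed A"
    using A by (auto simp: closed_subalgebra_def)
  have "\<exists>S. S \<in> A \<and> psd_operator S \<and> S o\<^sub>L S = Tn n" for n
  proof -
    have "inverse (real (Suc n)) * (norm v)\<^sup>2 \<le> v \<bullet> Tn n v" for v
      using T(2) by (simp add: Tn_def psd_operator_def blinfun.bilinear_simps inner_add_right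
          dot_square_norm)
    moreover have "Tn n \<in> A"
      using T alg by (auto simp: Tn_def intro!: subspace_add subspace_scale)
    moreover have "psd_operator (Tn n)"
      using T(2) by (auto simp: Tn_def psd_operator_def blinfun.bilinear_simps inner_add_right
          inner_add_left)
    ultimately show ?thesis
      using psd_operator_sqrt_strict [OF A, of "Tn n" "inverse (real (Suc n))"] by auto
  qed
  then obtain Sn where Sn: "\<And>n. Sn n \<in> A" "\<And>n. psd_operator (Sn n)" "\<And>n. Sn n o\<^sub>L Sn n = Tn n"
    by metis
  have "norm (Sn n) \<le> sqrt (norm T + 1)" for n
  proof (rule norm_blinfun_bound)
    fix v
    have "norm (Tn n) \<le> norm T + inverse (real (Suc n)) * norm (id_blinfun :: 'a \<Rightarrow>\<^sub>L 'a)"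
      unfolding Tn_def by (rule order_trans [OF norm_triangle_ineq]) simp
    also have "\<dots> \<le> norm T + 1 * 1"
      by (intro add_mono mult_mono norm_blinfun_id_le) (auto simp: divide_simps)
    finally have Tn: "norm (Tn n) \<le> norm T + 1" by simp
    have "(norm (Sn n v))\<^sup>2 = v \<bullet> (Sn n o\<^sub>L Sn n) v"
      using Sn(2) [of n] by (simp add: psd_operator_def power2_norm_eq_inner)
    also have "\<dots> \<le> norm v * norm (Tn n v)"
      unfolding Sn(3) by (rule norm_cauchy_schwarz)
    also have "\<dots> \<le> norm v * ((norm T + 1) * norm v)"
      by (intro mult_left_mono order_trans [OF norm_blinfun] mult_right_mono Tn) auto
    also have "\<dots> = (sqrt (norm T + 1) * norm v)\<^sup>2"
      by (simp add: power_mult_distrib) (simp add: power2_eq_square)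
    finally show "norm (Sn n v) \<le> sqrt (norm T + 1) * norm v"
      by (rule power2_le_imp_le) simp
  qed simp
  then have "bounded (range Sn)"
    by (auto simp: bounded_iff)
  then obtain S r where r: "strict_mono r" and lim: "(Sn \<circ> r) \<longlonglongrightarrow> S"
    using bounded_imp_convergent_subsequence by blast
  show thesis
  proof
    show "S \<in> A"
      using alg(3) lim Sn(1) unfolding closed_sequential_limits by (metis comp_apply)
    show "psd_operator S"
      using closed_psd_operators lim Sn(2) unfolding closed_sequential_limits
      by (metis (mono_tags, lifting) comp_apply mem_Collect_eq)
    have "(\<lambda>n. (Sn \<circ> r) n o\<^sub>L (Sn \<circ> r) n) \<longlonglongrightarrow> (S o\<^sub>L S)"
      by (intro bounded_bilinear.tendsto [OF bounded_bilinear_blinfun_compose] lim)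
    moreover have "(\<lambda>n. (Sn \<circ> r) n o\<^sub>L (Sn \<circ> r) n) \<longlonglongrightarrow> T"
    proof -
      have "(\<lambda>n. T + inverse (real (Suc n)) *\<^sub>R id_blinfun) \<longlonglongrightarrow> T + 0 *\<^sub>R (id_blinfun :: 'a \<Rightarrow>\<^sub>L 'a)"
        by (intro tendsto_intros LIMSEQ_inverse_real_of_nat)
      then have "Tn \<longlonglongrightarrow> T"
        unfolding Tn_def by simp
      from LIMSEQ_subseq_LIMSEQ [OF this r] show ?thesis
        by (simp add: Sn(3) comp_def)
    qed
    ultimately show "S o\<^sub>L S = T"
      by (rule LIMSEQ_unique)
  qed
qed

section \<open>Hermitian matrices as real operators\<close>

lemma to_quat_inject: "to_quat x = to_quat y \<longleftrightarrow> x = (y :: 'f::rch)"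
  by (metis norm_to_quat norm_eq_zero right_minus_eq to_quat_diff)

lemma conjugate_add: "conjugate (x + y) = conjugate x + conjugate (y :: 'f::rch)"
  by (subst to_quat_inject [symmetric])
    (simp add: to_quat_conjugate to_quat_add qconj_def plus_quat_def)

lemma conjugate_scaleR: "conjugate (r *\<^sub>R x) = r *\<^sub>R conjugate (x :: 'f::rch)"
  by (subst to_quat_inject [symmetric])
    (simp add: to_quat_conjugate to_quat_scaleR qconj_def scaleR_quat_def)

lemma linear_conjugate: "linear (conjugate :: 'f::rch \<Rightarrow> 'f)"
  by (intro linearI conjugate_add conjugate_scaleR)

lemma conjugate_conjugate: "conjugate (conjugate x) = (x :: 'f::rch)"
  by (subst to_quat_inject [symmetric]) (simp add: to_quat_conjugate qconj_def)

lemma conjugate_mult: "conjugate (x * y) = conjugate y * conjugate (x :: 'f::rch)"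
  by (subst to_quat_inject [symmetric])
    (simp add: to_quat_conjugate to_quat_mult qconj_def times_quat_def algebra_simps)

lemma conjugate_1: "conjugate (1 :: 'f::rch) = 1"
  by (subst to_quat_inject [symmetric]) (simp add: to_quat_conjugate to_quat_one qconj_def
      one_quat_def)

lemma norm_conjugate: "norm (conjugate x) = norm (x :: 'f::rch)"
  by (simp add: to_quat_conjugate norm_quat_def qconj_def flip: norm_to_quat)

lemma continuous_on_conjugate [continuous_intros]:
  "continuous_on S f \<Longrightarrow> continuous_on S (\<lambda>x. conjugate (f x :: 'f::rch))"
  using linear_conjugate
  by (intro continuous_on_compose2 [OF linear_continuous_on [of conjugate UNIV]])
    (auto simp flip: linear_conv_bounded_linear)

lemma conjugate_measurable [measurable]: "(conjugate :: 'f::rch \<Rightarrow> 'f) \<in> borel_measurable borel"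
  by (intro borel_measurable_continuous_onI continuous_intros)

lemma re_mult_commute: "re (x * y) = re (y * (x :: 'f::rch))"
  by (simp add: re_def to_quat_mult times_quat_def)

lemma inner_mult_left: "(a * x) \<bullet> y = x \<bullet> (conjugate a * (y :: 'f::rch))"
  by (simp add: inner_eq_re conjugate_mult mult.assoc)

lemma inner_conjugate: "conjugate x \<bullet> conjugate y = x \<bullet> (y :: 'f::rch)"
  using re_mult_commute [of x "conjugate y"] inner_commute [of x y]
  by (simp add: inner_eq_re conjugate_conjugate)

lemma adjoint_adjoint: "adjoint_matrix (adjoint_matrix s) = s"
  by (simp add: adjoint_matrix_def conjugate_conjugate vec_eq_iff)

lemma inner_adjoint: "adjoint_matrix x \<bullet> adjoint_matrix y = x \<bullet> y"
  unfolding inner_vec_def adjoint_matrix_def by (simp add: inner_conjugate) (rule sum.swap)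

lemma norm_adjoint: "norm (adjoint_matrix x) = norm x"
  by (simp add: norm_eq_sqrt_inner inner_adjoint)

lemma adjoint_mult: "adjoint_matrix (x ** y) = adjoint_matrix y ** adjoint_matrix x"
  by (simp add: adjoint_matrix_def matrix_matrix_mult_def vec_eq_iff linear_sum [OF linear_conjugate]
      conjugate_mult)

lemma linear_adjoint_matrix: "linear (adjoint_matrix :: 'f::rch ^ 'q ^ 'q \<Rightarrow> _)"
  by (intro linearI) (simp_all add: adjoint_matrix_def vec_eq_iff conjugate_add conjugate_scaleR)

lemma subspace_Herm: "subspace (Herm :: ('f::rch ^ 'q ^ 'q) set)"
  using linear_adjoint_matrix [where 'f = 'f and 'q = 'q]
  by (auto simp: subspace_def Herm_def linear_0 linear_add linear_scale)

lemma closed_Herm: "closed (Herm :: ('f::rch ^ 'q ^ 'q) set)"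
  using subspace_Herm by (rule closed_subspace)

text \<open>
  Although the scalars need not commute, a matrix acting on columns is real linear, and its
  adjoint for the real inner product is the conjugate transpose.
\<close>
lemma inner_matrix_vector_mult:
  fixes s :: "'f::rch ^ 'q ^ 'q"
  shows "(s *v v) \<bullet> w = v \<bullet> (adjoint_matrix s *v w)"
proof -
  have "(s *v v) \<bullet> w = (\<Sum>i\<in>UNIV. \<Sum>j\<in>UNIV. v $ j \<bullet> (conjugate (s $ i $ j) * w $ i))"
    by (simp add: inner_vec_def matrix_vector_mult_def inner_sum_left inner_mult_left)
  also have "\<dots> = (\<Sum>j\<in>UNIV. \<Sum>i\<in>UNIV. v $ j \<bullet> (conjugate (s $ i $ j) * w $ i))"
    by (rule sum.swap)
  finally show ?thesis
    by (simp add: inner_vec_def matrix_vector_mult_def adjoint_matrix_def inner_sum_right)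
qed

lemma re_quadratic_form:
  fixes s :: "'f::rch ^ 'q ^ 'q"
  shows "re (\<Sum>i\<in>UNIV. \<Sum>j\<in>UNIV. conjugate (v $ i) * s $ i $ j * v $ j) = v \<bullet> (s *v v)"
  by (simp add: inner_vec_def matrix_vector_mult_def inner_eq_re re_sum sum_distrib_left mult.assoc)

lemma Herm_iff_symmetric:
  fixes s :: "'f::rch ^ 'q ^ 'q"
  shows "s \<in> Herm \<longleftrightarrow> (\<forall>v w. (s *v v) \<bullet> w = v \<bullet> (s *v w))"
proof
  assume "s \<in> Herm"
  then show "\<forall>v w. (s *v v) \<bullet> w = v \<bullet> (s *v w)"
    by (simp add: Herm_def inner_matrix_vector_mult)
next
  assume *: "\<forall>v w. (s *v v) \<bullet> w = v \<bullet> (s *v w)"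
  have "v \<bullet> (adjoint_matrix s *v w) = v \<bullet> (s *v w)" for v w
    using * inner_matrix_vector_mult [of s v w] by metis
  then have "adjoint_matrix s *v w = s *v w" for w
    using vector_eq_ldot by blast
  then show "s \<in> Herm"
    unfolding Herm_def by (simp add: matrix_eq)
qed

lemma psd_cone_iff:
  fixes s :: "'f::rch ^ 'q ^ 'q"
  shows "s \<in> psd_cone \<longleftrightarrow> s \<in> Herm \<and> (\<forall>v. 0 \<le> v \<bullet> (s *v v))"
  by (simp add: psd_cone_def re_quadratic_form)

lemma matrix_vector_mult_scaleR: "s *v (r *\<^sub>R v) = r *\<^sub>R (s *v v)" for s :: "'f::rch ^ 'q ^ 'q"
  by (simp add: matrix_vector_mult_def vec_eq_iff scaleR_sum_right)

lemma linear_matrix_vector: "linear (\<lambda>v. s *v v)" for s :: "'f::rch ^ 'q ^ 'q"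
  by (intro linearI matrix_vector_mult_scaleR) (simp add: matrix_vector_right_distrib)

lemma linear_matrix_vector_left: "linear (\<lambda>s. s *v v)" for v :: "'f::rch ^ 'q"
  by (intro linearI) (simp_all add: matrix_vector_mult_def vec_eq_iff
      scaleR_sum_right distrib_right sum.distrib)

lemma closed_psd_cone: "closed (psd_cone :: ('f::rch ^ 'q ^ 'q) set)"
proof -
  have "continuous_on UNIV (\<lambda>s :: 'f ^ 'q ^ 'q. s *v v)" for v
    using linear_matrix_vector_left [of v]
    by (intro linear_continuous_on) (simp only: linear_conv_bounded_linear)
  then have "closed {s :: 'f ^ 'q ^ 'q. s \<in> Herm \<and> (\<forall>v. 0 \<le> v \<bullet> (s *v v))}"
    by (intro closed_Collect_conj closed_Collect_all closed_Collect_le continuous_intros)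
      (simp add: closed_Herm)
  moreover have "psd_cone = {s :: 'f ^ 'q ^ 'q. s \<in> Herm \<and> (\<forall>v. 0 \<le> v \<bullet> (s *v v))}"
    by (auto simp: psd_cone_iff)
  ultimately show ?thesis
    by simp
qed

text \<open>
  The matrices embed into the real operators on columns; the image is the commutant of the right
  multiplications by scalars, which makes it visibly a closed subalgebra.
\<close>
definition matrix_op :: "'f::rch ^ 'q ^ 'q \<Rightarrow> ('f ^ 'q) \<Rightarrow>\<^sub>L ('f ^ 'q)" where
  "matrix_op s = Blinfun (\<lambda>v. s *v v)"

lemma matrix_op_apply: "matrix_op s v = s *v v"
  unfolding matrix_op_def using linear_matrix_vector [of s]
  by (simp add: bounded_linear_Blinfun_apply linear_conv_bounded_linear)

lemma matrix_op_inject: "matrix_op s = matrix_op t \<longleftrightarrow> s = t"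
  by (metis matrix_eq matrix_op_apply)

lemma matrix_op_mult: "matrix_op (s ** t) = matrix_op s o\<^sub>L matrix_op t"
  by (rule blinfun_eqI) (simp add: matrix_op_apply matrix_vector_mul_assoc)

definition scale_right :: "'f::rch ^ 'q \<Rightarrow> 'f \<Rightarrow> 'f ^ 'q" where
  "scale_right v c = (\<chi> i. v $ i * c)"

lemma range_matrix_op:
  "range (matrix_op :: 'f::rch ^ 'q ^ 'q \<Rightarrow> _) =
    {B :: ('f ^ 'q) \<Rightarrow>\<^sub>L ('f ^ 'q). \<forall>v c. B (scale_right v c) = scale_right (B v) c}"
proof (intro equalityI subsetI)
  fix B :: "('f ^ 'q) \<Rightarrow>\<^sub>L ('f ^ 'q)" 
  assume "B \<in> {B :: ('f ^ 'q) \<Rightarrow>\<^sub>L ('f ^ 'q). \<forall>v c. B (scale_right v c) = scale_right (B v) c}"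
  then have B: "B (scale_right v c) = scale_right (B v) c" for v c
    by blast
  define s :: "'f ^ 'q ^ 'q" where "s = (\<chi> i j. B (axis j 1) $ i)"
  have "B v = s *v v" for v
  proof -
    have "v = (\<Sum>j\<in>UNIV. scale_right (axis j 1) (v $ j))"
      by (simp add: vec_eq_iff scale_right_def axis_def if_distrib [of "\<lambda>x. x * _"] cong: if_cong)
    then have "B v = (\<Sum>j\<in>UNIV. scale_right (B (axis j 1)) (v $ j))"
      by (metis (no_types, lifting) B blinfun.sum_right sum.cong)
    then show ?thesis
      by (simp add: vec_eq_iff scale_right_def s_def matrix_vector_mult_def)
  qed
  then have "B = matrix_op s"
    by (intro blinfun_eqI) (simp add: matrix_op_apply)
  then show "B \<in> range matrix_op" by blast
qed (auto simp: matrix_op_apply scale_right_def matrix_vector_mult_def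
    vec_eq_iff sum_distrib_right mult.assoc)

lemma closed_subalgebra_matrix_op: "closed_subalgebra (range (matrix_op :: 'f::rch ^ 'q ^ 'q \<Rightarrow> _))"
  unfolding closed_subalgebra_def
proof (intro conjI)
  show "closed (range (matrix_op :: 'f ^ 'q ^ 'q \<Rightarrow> _))"
    unfolding range_matrix_op scale_right_def
    by (intro closed_Collect_all closed_Collect_eq continuous_intros continuous_on_vec_lambda)
  show "subspace (range (matrix_op :: 'f ^ 'q ^ 'q \<Rightarrow> _))"
    unfolding range_matrix_op subspace_def
    by (auto simp: scale_right_def vec_eq_iff blinfun.bilinear_simps distrib_right)
  show "id_blinfun \<in> range (matrix_op :: 'f ^ 'q ^ 'q \<Rightarrow> _)"
    unfolding range_matrix_op by simp
  show "\<forall>S\<in>range (matrix_op :: 'f ^ 'q ^ 'q \<Rightarrow> _). \<forall>T\<in>range matrix_op. S o\<^sub>L T \<in> range matrix_op"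
    unfolding range_matrix_op by simp
qed

lemma psd_operator_matrix_op: "psd_operator (matrix_op s) \<longleftrightarrow> s \<in> psd_cone"
  by (simp add: psd_operator_def matrix_op_apply psd_cone_iff Herm_iff_symmetric)

lemma psd_sqrt_exists:
  assumes "a \<in> psd_cone"
  shows "\<exists>s\<in>psd_cone. s ** s = a"
proof -
  have "psd_operator (matrix_op a)"
    using assms by (simp add: psd_operator_matrix_op)
  then obtain S where S: "S \<in> range matrix_op" "psd_operator S" "S o\<^sub>L S = matrix_op a"
    using psd_operator_sqrt [OF closed_subalgebra_matrix_op rangeI] by metis
  then obtain s where s: "S = matrix_op s"
    by blast
  have "s \<in> psd_cone"
    using S(2) by (simp add: s psd_operator_matrix_op)
  moreover have "s ** s = a"
    using S(3) unfolding s matrix_op_mult [symmetric] matrix_op_inject .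
  ultimately show ?thesis
    by blast
qed

text \<open>
  Otherwise moving \<open>v\<close> a little against the direction \<open>s *v v\<close> would make the form negative.
\<close>
lemma psd_form_eq_0:
  fixes s :: "'f::rch ^ 'q ^ 'q"
  assumes s: "s \<in> psd_cone" and v: "v \<bullet> (s *v v) = 0"
  shows "s *v v = 0"
proof (rule ccontr)
  assume "s *v v \<noteq> 0"
  define w where "w = s *v v"
  define K where "K = w \<bullet> (s *v w)"
  \<comment> \<open>A step so small that the quadratic term r * r * K does not exceed half of the linear
    term 2 * r * (w \<bullet> w).\<close>
  define r where "r = (w \<bullet> w) / (K + 1)"
  have w: "0 < w \<bullet> w"
    using \<open>s *v v \<noteq> 0\<close> by (simp add: w_def)
  have K: "0 \<le> K"
    using s by (simp add: K_def psd_cone_iff)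
  have sym: "v \<bullet> (s *v w) = w \<bullet> w"
    using s by (simp add: psd_cone_iff Herm_iff_symmetric w_def)
  have "0 \<le> (v - r *\<^sub>R w) \<bullet> (s *v (v - r *\<^sub>R w))"
    using s by (simp add: psd_cone_iff)
  also have "\<dots> = r * (r * K - 2 * (w \<bullet> w))"
    using linear_matrix_vector [of s] v sym
    by (simp add: linear_diff linear_scale inner_diff_left inner_diff_right K_def inner_commute
        algebra_simps flip: w_def)
  finally have "0 \<le> r * (r * K - 2 * (w \<bullet> w))" .
  moreover have "0 < r"
    using w K by (simp add: r_def)
  moreover have "r * K \<le> w \<bullet> w"
    using w K by (simp add: r_def field_simps)
  ultimately show False
    using w by (simp add: zero_le_mult_iff)
qed

text \<open>
  The inner product of \<open>d\<close> and \<open>s ** d\<close> is the sum of the values of the form \<open>s\<close> on the columns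
  of \<open>d\<close>.
\<close>
lemma inner_matrix_mult_psd:
  fixes s d :: "'f::rch ^ 'q ^ 'q"
  assumes s: "s \<in> psd_cone"
  shows "0 \<le> d \<bullet> (s ** d)" and "d \<bullet> (s ** d) = 0 \<Longrightarrow> s ** d = 0"
proof -
  have col: "column k (s ** d) = s *v column k d" for k
    by (simp add: column_def vec_eq_iff matrix_vector_mult_def matrix_matrix_mult_def)
  have eq: "d \<bullet> (s ** d) = (\<Sum>k\<in>UNIV. column k d \<bullet> (s *v column k d))"
    unfolding col [symmetric] unfolding inner_vec_def column_def by simp (rule sum.swap)
  have nonneg: "0 \<le> column k d \<bullet> (s *v column k d)" for k
    using s by (simp add: psd_cone_iff)
  show "0 \<le> d \<bullet> (s ** d)"
    unfolding eq by (intro sum_nonneg nonneg)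
  assume "d \<bullet> (s ** d) = 0"
  then have "column k d \<bullet> (s *v column k d) = 0" for k
    unfolding eq using nonneg by (simp add: sum_nonneg_eq_0_iff)
  then have "column k (s ** d) = 0" for k
    unfolding col using psd_form_eq_0 [OF s] by blast
  then show "s ** d = 0"
    by (simp add: column_def vec_eq_iff)
qed

lemma matrix_diff_right: "x ** (y - z) = x ** y - x ** z" for x y z :: "'f::rch ^ 'q ^ 'q"
  by (simp add: matrix_matrix_mult_def vec_eq_iff right_diff_distrib sum_subtractf)

lemma matrix_diff_left: "(x - y) ** z = x ** z - y ** z" for x y z :: "'f::rch ^ 'q ^ 'q"
  by (simp add: matrix_matrix_mult_def vec_eq_iff left_diff_distrib sum_subtractf)

text \<open>
  For \<open>d = s - t\<close> the hypothesis reads \<open>s ** d + d ** t = 0\<close>. Pairing with \<open>d\<close> gives a sum of two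
  nonnegative numbers, so \<open>s ** d = t ** d = 0\<close>, hence \<open>d ** d = 0\<close>, and a Hermitian matrix with
  square zero vanishes.
\<close>
lemma psd_sqrt_unique:
  fixes s t :: "'f::rch ^ 'q ^ 'q"
  assumes s: "s \<in> psd_cone" and t: "t \<in> psd_cone" and eq: "s ** s = t ** t"
  shows "s = t"
proof -
  define d where "d = s - t"
  have herm: "adjoint_matrix s = s" "adjoint_matrix t = t"
    using s t by (simp_all add: psd_cone_def Herm_def)
  then have d: "adjoint_matrix d = d"
    by (simp add: d_def linear_diff [OF linear_adjoint_matrix])
  have "s ** d + d ** t = 0"
    by (simp add: d_def matrix_diff_right matrix_diff_left eq)
  then have "d \<bullet> (s ** d) + d \<bullet> (d ** t) = 0"
    by (metis inner_add_right inner_zero_right)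
  moreover have "d \<bullet> (d ** t) = d \<bullet> (t ** d)"
    using inner_adjoint [of d "d ** t"] by (simp add: adjoint_mult herm d)
  ultimately have "d \<bullet> (s ** d) = 0" "d \<bullet> (t ** d) = 0"
    using inner_matrix_mult_psd(1) [OF s, of d] inner_matrix_mult_psd(1) [OF t, of d] by auto
  then have "s ** d = 0" "t ** d = 0"
    using inner_matrix_mult_psd(2) s t by blast+
  then have "d ** d = 0"
    unfolding d_def by (simp add: matrix_diff_left)
  then have "d \<bullet> d = re (trace (0 :: 'f ^ 'q ^ 'q))"
    by (simp add: inner_matrix_eq d)
  also have "\<dots> = 0"
    using to_quat_scaleR [of 0 "0 :: 'f"] by (simp add: trace_def re_def zero_quat_def)
  finally show ?thesis
    by (simp add: d_def)
qed

lemma psd_sqrt: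
  assumes "a \<in> psd_cone"
  shows "psd_sqrt a \<in> psd_cone" and "psd_sqrt a ** psd_sqrt a = a"
proof -
  have "\<exists>!s. s \<in> psd_cone \<and> s ** s = a"
    using psd_sqrt_exists [OF assms] psd_sqrt_unique by metis
  from theI' [OF this] show "psd_sqrt a \<in> psd_cone" "psd_sqrt a ** psd_sqrt a = a"
    by (simp_all add: psd_sqrt_def)
qed

lemma continuous_on_matrix_mult [continuous_intros]:
  fixes f g :: "'a::topological_space \<Rightarrow> 'f::rch ^ 'q ^ 'q"
  assumes "continuous_on S f" "continuous_on S g"
  shows "continuous_on S (\<lambda>x. f x ** g x)"
  unfolding matrix_matrix_mult_def using assms by (intro continuous_intros continuous_on_vec_lambda)

lemma square_in_psd_cone:
  fixes s :: "'f::rch ^ 'q ^ 'q"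
  assumes "s \<in> Herm"
  shows "s ** s \<in> psd_cone"
proof -
  have s: "adjoint_matrix s = s"
    using assms by (simp add: Herm_def)
  have "v \<bullet> (s ** s *v v) = (s *v v) \<bullet> (s *v v)" for v
    by (simp add: inner_matrix_vector_mult s matrix_vector_mul_assoc)
  then show ?thesis
    by (simp add: psd_cone_iff) (simp add: Herm_def adjoint_mult s)
qed

lemma norm_psd_square:
  assumes "s \<in> psd_cone"
  shows "(norm s)\<^sup>2 = re (trace (s ** s))"
proof -
  have "adjoint_matrix s = s"
    using assms by (simp add: psd_cone_def Herm_def)
  then show ?thesis
    by (simp add: power2_norm_eq_inner inner_matrix_eq)
qed

text \<open>
  Squaring is continuous, so the image is a countable union of compact sets. These images are the
  preimages of closed sets under the square root, whose measurability follows.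
\<close>
lemma square_psd_image_measurable:
  assumes F: "closed F"
  shows "(\<lambda>s. s ** s) ` (F \<inter> (psd_cone :: ('f::rch ^ 'q ^ 'q) set)) \<in> sets borel"
proof -
  have "(\<lambda>s. s ** s) ` (F \<inter> (psd_cone :: ('f::rch ^ 'q ^ 'q) set)) =
      (\<Union>n. (\<lambda>s. s ** s) ` (F \<inter> psd_cone \<inter> cball 0 (real n)))"
  proof -
    have "\<exists>n. s \<in> cball 0 (real n)" for s :: "'f ^ 'q ^ 'q"
      using real_arch_simple [of "norm s"] by auto
    then show ?thesis by blast
  qed
  moreover have "closed ((\<lambda>s. s ** s) ` (F \<inter> psd_cone \<inter> cball (0 :: 'f ^ 'q ^ 'q) (real n)))" for n
    by (intro compact_imp_closed compact_continuous_image continuous_intros closed_Int_compact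
        closed_Int F closed_psd_cone compact_cball)
  ultimately show ?thesis
    by auto
qed

lemma psd_sqrt_measurable:
  "(psd_sqrt :: 'f::rch ^ 'q ^ 'q \<Rightarrow> _)
      \<in> measurable (restrict_space borel psd_cone) (restrict_space borel psd_cone)"
proof (rule measurable_restrict_space2)
  show "(psd_sqrt :: 'f ^ 'q ^ 'q \<Rightarrow> _) \<in> borel_measurable (restrict_space borel psd_cone)"
    unfolding borel_eq_closed [where 'a = "'f ^ 'q ^ 'q"]
  proof (rule measurable_measure_of)
    fix F :: "('f ^ 'q ^ 'q) set" assume "F \<in> Collect closed"
    then have F: "closed F" by simp
    have "psd_sqrt -` F \<inter> psd_cone = (\<lambda>s. s ** s) ` (F \<inter> psd_cone)"
    proof (intro equalityI subsetI)
      fix a assume "a \<in> psd_sqrt -` F \<inter> psd_cone"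
      then show "a \<in> (\<lambda>s. s ** s) ` (F \<inter> psd_cone)"
        using psd_sqrt [of a] by (intro image_eqI [of _ _ "psd_sqrt a"]) auto
    next
      fix a assume "a \<in> (\<lambda>s. s ** s) ` (F \<inter> psd_cone)"
      then obtain s where s: "s \<in> F" "s \<in> psd_cone" "a = s ** s" by auto
      have "s ** s \<in> psd_cone"
        using s by (intro square_in_psd_cone) (simp add: psd_cone_def)
      moreover from this have "psd_sqrt (s ** s) = s"
        using psd_sqrt_unique psd_sqrt s(2) by blast
      ultimately show "a \<in> psd_sqrt -` F \<inter> psd_cone"
        using s by simp
    qed
    then show "psd_sqrt -` F \<inter> space (restrict_space (sigma UNIV (Collect closed)) psd_cone)
        \<in> sets (restrict_space (sigma UNIV (Collect closed)) (psd_cone :: ('f ^ 'q ^ 'q) set))"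
      unfolding borel_eq_closed [where 'a = "'f ^ 'q ^ 'q", symmetric]
      using closed_psd_cone [where 'f = 'f and 'q = 'q] square_psd_image_measurable [OF F]
      by (auto simp: sets_restrict_space_iff space_restrict_space)
  qed auto
  show "(psd_sqrt :: 'f ^ 'q ^ 'q \<Rightarrow> _) \<in> space (restrict_space borel psd_cone) \<rightarrow> psd_cone"
    by (simp add: space_restrict_space psd_sqrt)
qed

section \<open>Gram matrices of families of rows\<close>

definition cross :: "nat \<Rightarrow> (nat \<Rightarrow> 'f::rch ^ 'q) \<Rightarrow> (nat \<Rightarrow> 'f ^ 'q) \<Rightarrow> 'f ^ 'q ^ 'q" where
  "cross p x y = (\<chi> j k. \<Sum>i<p. conjugate (x i $ j) * y i $ k)"

lemma gram_eq_cross: "gram p x = cross p x x"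
  by (simp add: gram_def cross_def)

lemma adjoint_cross: "adjoint_matrix (cross p x y) = cross p y x"
  by (simp add: adjoint_matrix_def cross_def vec_eq_iff linear_sum [OF linear_conjugate]
      conjugate_mult conjugate_conjugate)

lemma gram_psd: "gram p x \<in> psd_cone"
proof -
  have "gram p x \<in> Herm"
    by (simp add: Herm_def gram_eq_cross adjoint_cross)
  moreover have "0 \<le> v \<bullet> (gram p x *v v)" for v
  proof -
    have "v \<bullet> (gram p x *v v)
        = (\<Sum>j\<in>UNIV. \<Sum>k\<in>UNIV. \<Sum>i<p. v $ j \<bullet> (conjugate (x i $ j) * x i $ k * v $ k))"
      by (simp add: inner_vec_def gram_def matrix_vector_mult_def inner_sum_right sum_distrib_right)
    also have "\<dots> = (\<Sum>i<p. \<Sum>j\<in>UNIV. \<Sum>k\<in>UNIV. (x i $ j * v $ j) \<bullet> (x i $ k * v $ k))"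
      by (subst sum.swap [of _ "{..<p}"], subst sum.swap [of _ "{..<p}"])
          (simp add: inner_mult_left mult.assoc)
    also have "\<dots> = (\<Sum>i<p. (\<Sum>j\<in>UNIV. x i $ j * v $ j) \<bullet> (\<Sum>j\<in>UNIV. x i $ j * v $ j))"
      unfolding inner_sum_left unfolding inner_sum_right ..
    finally show ?thesis
      by (simp add: sum_nonneg)
  qed
  ultimately show ?thesis
    by (simp add: psd_cone_iff)
qed

lemma phi_psd: "phi p x \<in> psd_cone" and phi_square: "phi p x ** phi p x = gram p x"
  by (simp_all add: phi_def psd_sqrt gram_psd)

lemma measurable_matrix [measurable (raw)]:
  fixes f :: "'a \<Rightarrow> 'q::finite \<Rightarrow> 'q \<Rightarrow> 'f::rch"
  assumes [measurable]: "\<And>j k. (\<lambda>x. f x j k) \<in> borel_measurable M"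
  shows "(\<lambda>x. \<chi> j k. f x j k) \<in> borel_measurable M"
proof -
  have "(\<lambda>x. f x j k \<bullet> b) \<in> borel_measurable M" for j k b
    by measurable
  then show ?thesis
    by (subst borel_measurable_euclidean_space) (auto simp: Basis_vec_def inner_axis)
qed

lemma measurable_row [measurable]:
  "i < p \<Longrightarrow> (\<lambda>x :: nat \<Rightarrow> 'f::rch ^ 'q. x i) \<in> borel_measurable (mat_space p)"
  unfolding mat_space_def by (intro measurable_component_singleton) simp

lemma measurable_row_entry [measurable]: 
  "i < p \<Longrightarrow> (\<lambda>x :: nat \<Rightarrow> 'f::rch ^ 'q. x i $ j) \<in> borel_measurable (mat_space p)"
proof -
  assume [simp]: "i < p"
  have "(\<lambda>v :: 'f ^ 'q. v $ j) \<in> borel_measurable borel"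
    by (intro borel_measurable_continuous_onI continuous_intros)
  then show ?thesis by measurable
qed

definition sq_norm :: "nat \<Rightarrow> (nat \<Rightarrow> 'f::rch ^ 'q) \<Rightarrow> real" where
  "sq_norm p x = (\<Sum>i<p. (norm (x i))\<^sup>2)"

lemma power2_norm_vec: "(norm v)\<^sup>2 = (\<Sum>j\<in>UNIV. (norm (v $ j))\<^sup>2)" for v :: "'a::real_inner ^ 'n"
  by (simp add: power2_norm_eq_inner inner_vec_def)

lemma sq_norm_eq_norm_phi: "sq_norm p x = (norm (phi p x))\<^sup>2"
proof -
  have "(norm (phi p x))\<^sup>2 = re (trace (gram p x))"
    by (simp add: norm_psd_square phi_psd phi_square)
  also have "\<dots> = (\<Sum>j\<in>UNIV. \<Sum>i<p. (norm (x i $ j))\<^sup>2)"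
    by (simp add: trace_def gram_def re_sum power2_norm_eq_inner flip: inner_eq_re)
  also have "\<dots> = sq_norm p x"
    unfolding sq_norm_def power2_norm_vec by (rule sum.swap)
  finally show ?thesis ..
qed

lemma measurable_cross [measurable (raw)]:
  assumes f: "f \<in> measurable N (mat_space p)" and g: "g \<in> measurable N (mat_space p)"
  shows "(\<lambda>x. cross p (f x) (g x)) \<in> borel_measurable N"
proof -
  have [measurable]: "(\<lambda>x. f x i $ j) \<in> borel_measurable N" "(\<lambda>x. g x i $ j) \<in> borel_measurable N"
    if "i < p" for i j
    using measurable_compose [OF f measurable_row_entry [OF that]]
      measurable_compose [OF g measurable_row_entry [OF that]] by blast+
  show ?thesis
    unfolding cross_def by measurable
qed

lemma measurable_gram [measurable (raw)]:
  "f \<in> measurable N (mat_space p) \<Longrightarrow> (\<lambda>x. gram p (f x)) \<in> borel_measurable N"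
  unfolding gram_eq_cross by (rule measurable_cross)

lemma measurable_sq_norm [measurable (raw)]:
  assumes f: "f \<in> measurable N (mat_space p)"
  shows "(\<lambda>x. sq_norm p (f x)) \<in> borel_measurable N"
proof -
  have [measurable]: "(\<lambda>x. f x i) \<in> borel_measurable N" if "i < p" for i
    using measurable_compose [OF f measurable_row [OF that]] .
  show ?thesis
    unfolding sq_norm_def by measurable
qed

lemma measurable_phi: "phi p \<in> measurable (mat_space p) (restrict_space borel psd_cone)"
proof -
  have "gram p \<in> measurable (mat_space p) (restrict_space borel psd_cone)"
    using gram_psd by (intro measurable_restrict_space2) auto
  from measurable_compose [OF this psd_sqrt_measurable] show ?thesis
    by (simp add: phi_def [abs_def])
qed

lemma measurable_into_mat_space:
  assumes "\<And>i. i < p \<Longrightarrow> (\<lambda>x. f x i) \<in> borel_measurable N"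
  shows "(\<lambda>x. \<lambda>i\<in>{..<p}. f x i) \<in> measurable N (mat_space p)"
  unfolding mat_space_def using assms by (intro measurable_restrict) auto

section \<open>Second moments of radial measures\<close>

text \<open>
  Diagonal matrices with entries 1 and -1 are unitary.
\<close>
lemma nn_integral_radial_signs:
  fixes \<mu> :: "(nat \<Rightarrow> 'f::rch ^ 'q) measure"
  assumes \<mu>: "radial p \<mu>" "sets \<mu> = sets (mat_space p)"
    and s: "\<And>i. s i = 1 \<or> s i = (-1 :: real)"
    and f: "f \<in> borel_measurable (mat_space p)"
  shows "(\<integral>\<^sup>+x. f (\<lambda>i\<in>{..<p}. s i *\<^sub>R x i) \<partial>\<mu>) = (\<integral>\<^sup>+x. f x \<partial>\<mu>)"
proof -
  define u :: "nat \<Rightarrow> nat \<Rightarrow> 'f" where "u i k = (if i = k then of_real (s i) else 0)" for i k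
  have "conjugate (of_real r) = (of_real r :: 'f)" for r
    by (simp add: of_real_def conjugate_scaleR conjugate_1)
  moreover have "s i * s i = 1" for i
    using s [of i] by auto
  then have "of_real (s i) * of_real (s i) = (1 :: 'f)" for i
    by (metis of_real_1 of_real_mult)
  ultimately have "u \<in> unitary_group p"
    using linear_0 [OF linear_conjugate [where 'f = 'f]]
    by (auto simp: unitary_group_def u_def if_distrib [of conjugate] if_distrib [of "\<lambda>x. x * _"]
        if_distrib [of "(*) _"] cong: if_cong)
  moreover have "left_mult p u x = (\<lambda>i\<in>{..<p}. s i *\<^sub>R x i)" for x
    unfolding left_mult_def
  proof (intro restrict_ext)
    fix i assume "i \<in> {..<p}"
    then have "(\<Sum>k<p. u i k *s x k) = (\<Sum>k<p. if i = k then of_real (s i) *s x i else 0)"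
      by (intro sum.cong) (auto simp: u_def)
    then show "(\<Sum>k<p. u i k *s x k) = s i *\<^sub>R x i"
      using \<open>i \<in> {..<p}\<close> by (simp add: vec_eq_iff flip: scaleR_conv_of_real)
  qed
  ultimately have \<mu>_eq: "distr \<mu> (mat_space p) (\<lambda>x. \<lambda>i\<in>{..<p}. s i *\<^sub>R x i) = \<mu>"
    using \<mu>(1) unfolding radial_def by (metis (no_types, lifting) ext)
  have "(\<lambda>x :: nat \<Rightarrow> 'f ^ 'q. \<lambda>i\<in>{..<p}. s i *\<^sub>R x i) \<in> measurable \<mu> (mat_space p)"
    unfolding measurable_cong_sets [OF \<mu>(2) refl] by (intro measurable_into_mat_space) measurable
  from nn_integral_distr [OF this, of f] f show ?thesis
    by (simp add: \<mu>_eq measurable_cong_sets [OF \<mu>(2) refl])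
qed

text \<open>
  Permutation matrices of transpositions are unitary, so all rows have the same law.
\<close>
lemma nn_integral_radial_swap:
  fixes \<mu> :: "(nat \<Rightarrow> 'f::rch ^ 'q) measure"
  assumes \<mu>: "radial p \<mu>" "sets \<mu> = sets (mat_space p)"
    and ab: "a < p" "b < p"
    and f: "f \<in> borel_measurable borel"
  shows "(\<integral>\<^sup>+x. f (x a) \<partial>\<mu>) = (\<integral>\<^sup>+x. f (x b) \<partial>\<mu>)"
proof -
  define t where "t = Transposition.transpose a b"
  define u :: "nat \<Rightarrow> nat \<Rightarrow> 'f" where "u i k = (if i = t k then 1 else 0)" for i k
  have t: "t i < p \<longleftrightarrow> i < p" "t (t i) = i" "t i = t j \<longleftrightarrow> i = j" for i j
    using ab by (auto simp: t_def Transposition.transpose_def)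
  have "(\<Sum>k<p. conjugate (u k i) * u k j) = (if i = j then 1 else 0)" if "i < p" for i j
  proof -
    have "(\<Sum>k<p. conjugate (u k i) * u k j) = (\<Sum>k<p. if k = t i then (if i = j then 1 else 0) else 0)"
      using linear_0 [OF linear_conjugate [where 'f = 'f]]
      by (intro sum.cong refl) (auto simp: u_def conjugate_1 t)
    then show ?thesis
      using that t by simp
  qed
  then have "u \<in> unitary_group p"
    by (simp add: unitary_group_def)
  moreover have "left_mult p u x = (\<lambda>i\<in>{..<p}. x (t i))" for x
    unfolding left_mult_def
  proof (intro restrict_ext)
    fix i assume "i \<in> {..<p}"
    then have "(\<Sum>k<p. u i k *s x k) = (\<Sum>k<p. if k = t i then x k else 0)"
      by (intro sum.cong) (auto simp: u_def t)
    then show "(\<Sum>k<p. u i k *s x k) = x (t i)"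
      using \<open>i \<in> {..<p}\<close> t by simp
  qed
  ultimately have \<mu>_eq: "distr \<mu> (mat_space p) (\<lambda>x. \<lambda>i\<in>{..<p}. x (t i)) = \<mu>"
    using \<mu>(1) unfolding radial_def by (metis (no_types, lifting) ext)
  have meas: "(\<lambda>x :: nat \<Rightarrow> 'f ^ 'q. \<lambda>i\<in>{..<p}. x (t i)) \<in> measurable \<mu> (mat_space p)"
    unfolding measurable_cong_sets [OF \<mu>(2) refl]
    using t by (intro measurable_into_mat_space measurable_row) auto
  have "(\<integral>\<^sup>+x. f (x a) \<partial>\<mu>) = (\<integral>\<^sup>+x. f (x a) \<partial>distr \<mu> (mat_space p) (\<lambda>x. \<lambda>i\<in>{..<p}. x (t i)))"
    by (simp only: \<mu>_eq)
  also have "\<dots> = (\<integral>\<^sup>+x. f ((\<lambda>i\<in>{..<p}. x (t i)) a) \<partial>\<mu>)"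
    using ab f by (intro nn_integral_distr meas measurable_compose [OF measurable_row]) auto
  also have "\<dots> = (\<integral>\<^sup>+x. f (x b) \<partial>\<mu>)"
    using ab by (simp add: t_def)
  finally show ?thesis .
qed

text \<open>
  Mixed terms are removed from second moments by this averaging rather than by showing that they
  have integral zero, which keeps all integrands nonnegative.
\<close>
lemma nn_integral_symmetrise:
  assumes [measurable]: "f \<in> borel_measurable M" "(\<lambda>x. f (g x)) \<in> borel_measurable M" "h
      \<in> borel_measurable M"
    and inv: "(\<integral>\<^sup>+x. f (g x) \<partial>M) = (\<integral>\<^sup>+x. f x \<partial>M)"
    and sym: "\<And>x. f x + f (g x) = 2 * (h x :: ennreal)"
  shows "(\<integral>\<^sup>+x. f x \<partial>M) = (\<integral>\<^sup>+x. h x \<partial>M)"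
proof -
  have "2 * (\<integral>\<^sup>+x. h x \<partial>M) = (\<integral>\<^sup>+x. f x + f (g x) \<partial>M)"
    by (simp add: sym nn_integral_cmult)
  also have "\<dots> = (\<integral>\<^sup>+x. f x \<partial>M) + (\<integral>\<^sup>+x. f (g x) \<partial>M)"
    by (rule nn_integral_add) measurable
  also have "\<dots> = 2 * (\<integral>\<^sup>+x. f x \<partial>M)"
    by (simp only: inv mult_2)
  finally show ?thesis
    by (simp add: ennreal_mult_cancel_left)
qed

lemma parallelogram:
  "(norm (x + y))\<^sup>2 + (norm (x - y))\<^sup>2 = 2 * ((norm x)\<^sup>2 + (norm y)\<^sup>2)" for x y :: "'a::real_inner"
  by (simp add: power2_norm_eq_inner inner_add_left inner_add_right inner_diff_left inner_diff_right)

lemma ennreal_add_eq_double: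
  assumes "0 \<le> a" "0 \<le> b" "0 \<le> c" "0 \<le> d" "a + b = 2 * (c + d)"
  shows "ennreal a + ennreal b = 2 * (ennreal c + ennreal d)"
proof -
  have "ennreal a + ennreal b = ennreal (2 * (c + d))"
    using assms by (simp flip: ennreal_plus)
  then show ?thesis
    using assms by (simp add: ennreal_mult distrib_left)
qed

lemma ennreal_parallelogram:
  "ennreal ((norm (x + y))\<^sup>2) + ennreal ((norm (x - y))\<^sup>2) = 2 * (ennreal ((norm x)\<^sup>2)
      + ennreal ((norm y)\<^sup>2))"
  for x y :: "'a::real_inner"
  by (intro ennreal_add_eq_double) (simp_all add: parallelogram)

text \<open>
  Different rows are orthogonal in mean square: changing the sign of one row leaves the law
  unchanged, and the parallelogram law removes the mixed terms. The rows are added one by one.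
\<close>
lemma radial_row_combination:
  fixes \<mu> :: "(nat \<Rightarrow> 'f::rch ^ 'q) measure"
  assumes \<mu>: "radial p \<mu>" "sets \<mu> = sets (mat_space p)" and I: "I \<subseteq> {..<p}"
  shows "(\<integral>\<^sup>+x. (norm (\<Sum>i\<in>I. c i * x i $ k))\<^sup>2 \<partial>\<mu>)
      = (\<Sum>i\<in>I. (norm (c i))\<^sup>2 * (\<integral>\<^sup>+x. (norm (x i $ k))\<^sup>2 \<partial>\<mu>))"
proof -
  note [measurable_cong] = \<mu>(2)
  have "finite I"
    using I finite_subset by blast
  then show ?thesis
    using I
  proof (induction I)
    case empty
    then show ?case by simp
  next
    case (insert a I)
    have [measurable]: "(\<lambda>x :: nat \<Rightarrow> 'f ^ 'q. x i $ k)
        \<in> borel_measurable (mat_space p)" if "i \<in> insert a I" for i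
      using insert.prems that by (intro measurable_row_entry) auto
    define s where "s i = (if i = a then -1 else 1 :: real)" for i
    let ?g = "\<lambda>x :: nat \<Rightarrow> 'f ^ 'q. \<lambda>i\<in>{..<p}. s i *\<^sub>R x i"
    define f :: "(nat \<Rightarrow> 'f ^ 'q) \<Rightarrow> ennreal" where "f x = (norm (\<Sum>i\<in>insert a I. c i * x i $ k))\<^sup>2"
        for x
    define h :: "(nat \<Rightarrow> 'f ^ 'q) \<Rightarrow> ennreal" where
      "h x = ennreal ((norm (\<Sum>i\<in>I. c i * x i $ k))\<^sup>2) + ennreal ((norm (c a * x a $ k))\<^sup>2)" for x
    have f [measurable]: "f \<in> borel_measurable (mat_space p)"
      unfolding f_def by measurable
    have g [measurable]: "?g \<in> measurable (mat_space p) (mat_space p)"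
      by (intro measurable_into_mat_space) measurable
    have h [measurable]: "h \<in> borel_measurable (mat_space p)"
      unfolding h_def by measurable
    have "f x + f (?g x) = 2 * h x" for x
    proof -
      have "(\<Sum>i\<in>I. c i * ?g x i $ k) = (\<Sum>i\<in>I. c i * x i $ k)"
        using insert by (intro sum.cong) (auto simp: s_def)
      moreover have "c a * ?g x a $ k = - (c a * x a $ k)"
        using insert by (simp add: s_def)
      ultimately have "f (?g x) = ennreal ((norm ((\<Sum>i\<in>I. c i * x i $ k) - c a * x a $ k))\<^sup>2)"
        unfolding f_def sum.insert [OF insert.hyps] by (simp add: norm_minus_commute)
      moreover have "f x = ennreal ((norm ((\<Sum>i\<in>I. c i * x i $ k) + c a * x a $ k))\<^sup>2)"
        unfolding f_def sum.insert [OF insert.hyps] by (simp add: add.commute)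
      ultimately show ?thesis
        by (simp only: h_def ennreal_parallelogram)
    qed
    then have "(\<integral>\<^sup>+x. f x \<partial>\<mu>) = (\<integral>\<^sup>+x. h x \<partial>\<mu>)"
      using measurable_compose [OF g f] f h
      by (intro nn_integral_symmetrise [of f \<mu> ?g h] nn_integral_radial_signs [OF \<mu>])
        (auto simp: s_def measurable_cong_sets [OF \<mu>(2) refl])
    also have "\<dots> = (\<integral>\<^sup>+x. (norm (\<Sum>i\<in>I. c i * x i $ k))\<^sup>2 \<partial>\<mu>)
        + (\<integral>\<^sup>+x. (norm (c a))\<^sup>2 * ennreal ((norm (x a $ k))\<^sup>2) \<partial>\<mu>)"
      unfolding h_def by (subst nn_integral_add)
          (auto simp: norm_mult power_mult_distrib ennreal_mult)
    also have "\<dots> = (\<Sum>i\<in>insert a I. (norm (c i))\<^sup>2 * (\<integral>\<^sup>+x. (norm (x i $ k))\<^sup>2 \<partial>\<mu>))"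
      using insert by (simp add: nn_integral_cmult)
    finally show ?case
      by (simp add: f_def)
  qed
qed

lemma radial_entry_second_moment:
  fixes \<mu> :: "(nat \<Rightarrow> 'f::rch ^ 'q) measure"
  assumes \<mu>: "radial p \<mu>" "sets \<mu> = sets (mat_space p)" and i: "i < p"
  shows "of_nat p * (\<integral>\<^sup>+x. (norm (x i $ k))\<^sup>2 \<partial>\<mu>) = (\<integral>\<^sup>+x. (\<Sum>i<p. (norm (x i $ k))\<^sup>2) \<partial>\<mu>)"
proof -
  note [measurable_cong] = \<mu>(2)
  have "(\<lambda>v :: 'f ^ 'q. v $ k) \<in> borel_measurable borel"
    by (intro borel_measurable_continuous_onI continuous_intros)
  then have f: "(\<lambda>v :: 'f ^ 'q. ennreal ((norm (v $ k))\<^sup>2)) \<in> borel_measurable borel"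
    by measurable
  have "(\<integral>\<^sup>+x. (\<Sum>i<p. (norm (x i $ k))\<^sup>2) \<partial>\<mu>) = (\<Sum>l<p. \<integral>\<^sup>+x. (norm (x l $ k))\<^sup>2 \<partial>\<mu>)"
    by (subst nn_integral_sum [symmetric]) (auto simp: sum_ennreal)
  also have "\<dots> = (\<Sum>l<p. \<integral>\<^sup>+x. (norm (x i $ k))\<^sup>2 \<partial>\<mu>)"
    using nn_integral_radial_swap [OF \<mu> _ i f] by (intro sum.cong) auto
  finally show ?thesis by simp
qed

text \<open>
  The entries of \<open>cross p y x\<close> are linear combinations of entries of \<open>x\<close> in one column. Their
  mixed terms vanish, and the rows of \<open>x\<close> share the total second moment equally. The resulting
  factor \<open>1 / p\<close> is the reason why the off-diagonal terms of the Gram matrix disappear in high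
  dimension. It is written as a factor \<open>p\<close> on the left to avoid division.
\<close>
lemma cross_second_moment:
  fixes \<mu> :: "(nat \<Rightarrow> 'f::rch ^ 'q) measure"
  assumes \<mu>: "radial p \<mu>" "sets \<mu> = sets (mat_space p)"
  shows "of_nat p * (\<integral>\<^sup>+x. (norm (cross p y x))\<^sup>2 \<partial>\<mu>)
      = ennreal (sq_norm p y) * (\<integral>\<^sup>+x. sq_norm p x \<partial>\<mu>)"
proof -
  note [measurable_cong] = \<mu>(2)
  let ?m = "\<lambda>k. \<integral>\<^sup>+x. (\<Sum>i<p. (norm (x i $ k))\<^sup>2) \<partial>\<mu>"
  have "of_nat p * (\<integral>\<^sup>+x. (norm (cross p y x))\<^sup>2 \<partial>\<mu>)
      = of_nat p * (\<integral>\<^sup>+x. (\<Sum>j\<in>UNIV. \<Sum>k\<in>UNIV. ennreal ((norm (\<Sum>i<p. conjugate (y i $ j) * x i $ k))\<^sup>2)) \<partial>\<mu>)"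
    by (simp add: power2_norm_vec cross_def sum_nonneg)
  also have "\<dots> = of_nat p * (\<Sum>j\<in>UNIV. \<Sum>k\<in>UNIV. \<integral>\<^sup>+x. (norm (\<Sum>i<p. conjugate (y i $ j) * x i $ k))\<^sup>2 \<partial>\<mu>)"
    by (subst nn_integral_sum, measurable)+
  also have "\<dots> = of_nat p * (\<Sum>j\<in>UNIV. \<Sum>k\<in>UNIV. \<Sum>i<p. (norm (y i $ j))\<^sup>2 * (\<integral>\<^sup>+x. (norm (x i $ k))\<^sup>2 \<partial>\<mu>))"
    by (simp add: radial_row_combination [OF \<mu> order_refl] norm_conjugate)
  also have "\<dots> = (\<Sum>j\<in>UNIV. \<Sum>k\<in>UNIV. \<Sum>i<p. (norm (y i $ j))\<^sup>2 * (of_nat p * (\<integral>\<^sup>+x. (norm (x i $ k))\<^sup>2 \<partial>\<mu>)))"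
    by (simp add: sum_distrib_left mult_ac)
  also have "\<dots> = (\<Sum>j\<in>UNIV. \<Sum>k\<in>UNIV. \<Sum>i<p. (norm (y i $ j))\<^sup>2 * ?m k)"
    by (intro sum.cong) (auto simp: radial_entry_second_moment [OF \<mu>])
  also have "\<dots> = (\<Sum>j\<in>UNIV. \<Sum>i<p. ennreal ((norm (y i $ j))\<^sup>2)) * (\<Sum>k\<in>UNIV. ?m k)"
    unfolding sum_product unfolding sum_distrib_right ..
  also have "(\<Sum>j\<in>UNIV. \<Sum>i<p. ennreal ((norm (y i $ j))\<^sup>2)) = ennreal (sq_norm p y)"
    unfolding sq_norm_def power2_norm_vec by (subst sum.swap) (simp add: sum_ennreal sum_nonneg)
  also have "(\<Sum>k\<in>UNIV. ?m k) = (\<integral>\<^sup>+x. sq_norm p x \<partial>\<mu>)"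
  proof -
    have "sq_norm p x = (\<Sum>k\<in>UNIV. \<Sum>i<p. (norm (x i $ k))\<^sup>2)" for x :: "nat \<Rightarrow> 'f ^ 'q"
      unfolding sq_norm_def power2_norm_vec by (rule sum.swap)
    then show ?thesis
      by (subst nn_integral_sum [symmetric]) (auto simp: sum_ennreal sum_nonneg)
  qed
  finally show ?thesis .
qed

lemma (in prob_space) nn_integral_indep:
  assumes rv: "random_variable N1 A" "random_variable N2 B"
    and d: "distr M N1 A \<Otimes>\<^sub>M distr M N2 B = distr M (N1 \<Otimes>\<^sub>M N2) (\<lambda>\<omega>. (A \<omega>, B \<omega>))"
    and F: "F \<in> borel_measurable (N1 \<Otimes>\<^sub>M N2)"
  shows "(\<integral>\<^sup>+\<omega>. F (A \<omega>, B \<omega>) \<partial>M) = (\<integral>\<^sup>+\<omega>. \<integral>\<^sup>+b. F (A \<omega>, b) \<partial>distr M N2 B \<partial>M)"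
proof -
  interpret A: prob_space "distr M N1 A" using rv by (intro prob_space_distr)
  interpret B: prob_space "distr M N2 B" using rv by (intro prob_space_distr)
  have F': "F \<in> borel_measurable (distr M N1 A \<Otimes>\<^sub>M distr M N2 B)"
    using F by (simp cong: measurable_cong_sets)
  have "(\<integral>\<^sup>+\<omega>. F (A \<omega>, B \<omega>) \<partial>M) = (\<integral>\<^sup>+z. F z \<partial>(distr M N1 A \<Otimes>\<^sub>M distr M N2 B))"
    unfolding d using rv F by (subst nn_integral_distr) auto
  also have "\<dots> = (\<integral>\<^sup>+a. \<integral>\<^sup>+b. F (a, b) \<partial>distr M N2 B \<partial>distr M N1 A)"
    using F' by (rule B.nn_integral_fst [symmetric])
  also have "\<dots> = (\<integral>\<^sup>+\<omega>. \<integral>\<^sup>+b. F (A \<omega>, b) \<partial>distr M N2 B \<partial>M)"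
    using rv B.borel_measurable_nn_integral_fst [OF F'] by (subst nn_integral_distr) auto
  finally show ?thesis .
qed

definition neg_rows :: "nat \<Rightarrow> (nat \<Rightarrow> 'f::rch ^ 'q) \<Rightarrow> nat \<Rightarrow> 'f ^ 'q" where
  "neg_rows p x = (\<lambda>i\<in>{..<p}. - x i)"

text \<open>
  If \<open>B\<close> is independent of \<open>A\<close> and has a radial law, it may be replaced by its negative, so only
  the part of \<open>F\<close> that is even in \<open>B\<close> contributes.
\<close>
lemma (in prob_space) nn_integral_radial_increment:
  fixes B :: "'a \<Rightarrow> nat \<Rightarrow> 'f::rch ^ 'q"
  assumes rv: "random_variable N1 A" "random_variable (mat_space p) B"
    and d: "distr M N1 A \<Otimes>\<^sub>M distr M (mat_space p) B =
      distr M (N1 \<Otimes>\<^sub>M mat_space p) (\<lambda>\<omega>. (A \<omega>, B \<omega>))"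
    and rad: "radial p (distr M (mat_space p) B)"
    and F: "F \<in> borel_measurable (N1 \<Otimes>\<^sub>M mat_space p)" and G: "G
        \<in> borel_measurable (N1 \<Otimes>\<^sub>M mat_space p)"
    and sym: "\<And>a b. F (a, b) + F (a, neg_rows p b) = 2 * (G (a, b) :: ennreal)"
  shows "(\<integral>\<^sup>+\<omega>. F (A \<omega>, B \<omega>) \<partial>M) = (\<integral>\<^sup>+\<omega>. \<integral>\<^sup>+b. G (A \<omega>, b) \<partial>distr M (mat_space p) B \<partial>M)"
proof -
  have neg: "neg_rows p \<in> measurable (mat_space p :: (nat \<Rightarrow> 'f ^ 'q) measure) (mat_space p)"
    unfolding neg_rows_def [abs_def] by (intro measurable_into_mat_space) measurable
  have "(\<integral>\<^sup>+b. F (A \<omega>, b) \<partial>distr M (mat_space p) B) = (\<integral>\<^sup>+b. G (A \<omega>, b) \<partial>distr M (mat_space p) B)"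
    if "\<omega> \<in> space M" for \<omega>
  proof (rule nn_integral_symmetrise [where g = "neg_rows p"])
    have A: "A \<omega> \<in> space N1"
      using rv(1) that by (rule measurable_space)
    have FA: "(\<lambda>b. F (A \<omega>, b)) \<in> borel_measurable (mat_space p)"
      using F A by measurable
    then show "(\<lambda>b. F (A \<omega>, b)) \<in> borel_measurable (distr M (mat_space p) B)"
      by simp
    show "(\<lambda>b. F (A \<omega>, neg_rows p b)) \<in> borel_measurable (distr M (mat_space p) B)"
      using measurable_compose [OF neg FA] by simp
    show "(\<lambda>b. G (A \<omega>, b)) \<in> borel_measurable (distr M (mat_space p) B)"
      using G A by measurable
    show "(\<integral>\<^sup>+b. F (A \<omega>, neg_rows p b) \<partial>distr M (mat_space p) B) = (\<integral>\<^sup>+b. F (A \<omega>,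
        b) \<partial>distr M (mat_space p) B)"
      using nn_integral_radial_signs [OF rad _ _ FA, of "\<lambda>_. -1"] by (simp add: neg_rows_def
          [abs_def])
    show "F (A \<omega>, b) + F (A \<omega>, neg_rows p b) = 2 * G (A \<omega>, b)" for b
      by (rule sym)
  qed
  then show ?thesis
    unfolding nn_integral_indep [OF rv d F] by (rule nn_integral_cong)
qed

section \<open>The off-diagonal part of the Gram matrix of a random walk\<close>

lemma cross_add_left: "cross p (\<lambda>i\<in>{..<p}. x i + y i) z = cross p x z + cross p y z"
  by (simp add: cross_def vec_eq_iff conjugate_add distrib_right sum.distrib)

lemma cross_add_right: "cross p z (\<lambda>i\<in>{..<p}. x i + y i) = cross p z x + cross p z y"
  by (simp add: cross_def vec_eq_iff distrib_left sum.distrib)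

lemma conjugate_minus: "conjugate (- x) = - conjugate (x :: 'f::rch)"
  by (rule linear_neg [OF linear_conjugate])

lemma cross_neg_rows: "cross p x (neg_rows p y) = - cross p x y" "cross p (neg_rows p y) x
    = - cross p y x"
  by (simp_all add: cross_def neg_rows_def vec_eq_iff sum_negf conjugate_minus)

lemma partial_sum_0: "partial_sum p X 0 \<omega> = (\<lambda>i\<in>{..<p}. 0)"
  by (simp add: partial_sum_def)

lemma partial_sum_Suc:
  "partial_sum p X (Suc n) \<omega> = (\<lambda>i\<in>{..<p}. partial_sum p X n \<omega> i + X (Suc n) \<omega> i)"
  by (auto simp: partial_sum_def add.commute intro: restrict_ext)

text \<open>
  The sum of \<open>(X k)\<^sup>* X l\<close> over all pairs \<open>k \<noteq> l\<close>, written so that its recursion in \<open>n\<close> is immediate.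
\<close>
definition remainder ::
    "nat \<Rightarrow> (nat \<Rightarrow> 'w \<Rightarrow> nat \<Rightarrow> 'f::rch ^ 'q) \<Rightarrow> nat \<Rightarrow> 'w \<Rightarrow> 'f ^ 'q ^ 'q" where
  "remainder p X n \<omega> = gram p (partial_sum p X n \<omega>) - (\<Sum>k=1..n. gram p (X k \<omega>))"

lemma remainder_0: "remainder p X 0 \<omega> = 0"
  by (simp add: remainder_def gram_def partial_sum_0 vec_eq_iff)

lemma remainder_Suc:
  "remainder p X (Suc n) \<omega> = remainder p X n \<omega> +
    (cross p (partial_sum p X n \<omega>) (X (Suc n) \<omega>) + cross p (X (Suc n) \<omega>) (partial_sum p X n \<omega>))"
  by (simp add: remainder_def partial_sum_Suc gram_eq_cross cross_add_left cross_add_right)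

lemma measurable_partial_sum [measurable (raw)]:
  assumes "\<And>k. k \<in> {1..n} \<Longrightarrow> X k \<in> measurable M (mat_space p)"
  shows "partial_sum p X n \<in> measurable M (mat_space p)"
  unfolding partial_sum_def [abs_def] using assms
  by (intro measurable_into_mat_space borel_measurable_sum measurable_compose [OF _ measurable_row])

lemma measurable_remainder [measurable (raw)]:
  assumes X [measurable]: "\<And>k. k \<in> {1..n} \<Longrightarrow> X k \<in> measurable M (mat_space p)"
  shows "remainder p X n \<in> borel_measurable M"
  unfolding remainder_def [abs_def]
  by (intro borel_measurable_diff borel_measurable_sum measurable_gram measurable_partial_sum X)

locale radial_iid = prob_space M for M :: "'w measure" +
  fixes p :: nat and X :: "nat \<Rightarrow> 'w \<Rightarrow> nat \<Rightarrow> 'f::rch ^ 'q" and \<mu> :: "(nat \<Rightarrow> 'f ^ 'q) measure"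
  assumes indep: "indep_vars (\<lambda>_. mat_space p) X {1..}"
    and law: "\<And>k. 1 \<le> k \<Longrightarrow> distr M (mat_space p) (X k) = \<mu>"
    and radial: "radial p \<mu>"
begin

lemma rv: "1 \<le> k \<Longrightarrow> X k \<in> measurable M (mat_space p)"
  using indep by (simp add: indep_vars_def)

lemma sets_law: "sets \<mu> = sets (mat_space p)"
  using law [of 1] by (metis order_refl sets_distr)

lemma prob_space_law: "prob_space \<mu>"
proof -
  have "prob_space (distr M (mat_space p) (X 1))"
    by (intro prob_space_distr rv) simp
  then show ?thesis
    by (simp add: law)
qed

abbreviation "second_moment \<equiv> \<integral>\<^sup>+x. sq_norm p x \<partial>\<mu>"

text \<open>
  The first \<open>n\<close> steps as one random variable: partial sums and remainders are functions of it, and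
  it is independent of the next step.
\<close>
definition history :: "nat \<Rightarrow> 'w \<Rightarrow> nat \<Rightarrow> nat \<Rightarrow> 'f ^ 'q" where
  "history n \<omega> = (\<lambda>k\<in>{1..n}. X k \<omega>)"

lemma partial_sum_history: "partial_sum p (\<lambda>k h. h k) n (history n \<omega>) = partial_sum p X n \<omega>"
  by (auto simp: partial_sum_def history_def intro!: restrict_ext sum.cong)

lemma remainder_history: "remainder p (\<lambda>k h. h k) n (history n \<omega>) = remainder p X n \<omega>"
  unfolding remainder_def partial_sum_history by (auto simp: history_def intro!: sum.cong)

lemma history_component: "k \<in> {1..n} \<Longrightarrow> (\<lambda>h. h k)
    \<in> measurable (PiM {1..n} (\<lambda>_. mat_space p)) (mat_space p)"
  by (rule measurable_component_singleton)

lemma measurable_history: "history n \<in> measurable M (PiM {1..n} (\<lambda>_. mat_space p))"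
  unfolding history_def [abs_def] by (intro measurable_restrict rv) simp

text \<open>
  History and step have values of different types, so their independence is stated as a product law.
  It is obtained from two blocks of indices, the second of which is a singleton and is identified
  with the step.
\<close>
lemma independent_history:
  "distr M (PiM {1..n} (\<lambda>_. mat_space p)) (history n) \<Otimes>\<^sub>M distr M (mat_space p) (X (Suc n)) =
    distr M (PiM {1..n} (\<lambda>_. mat_space p) \<Otimes>\<^sub>M mat_space p) (\<lambda>\<omega>. (history n \<omega>, X (Suc n) \<omega>))"
proof -
  let ?P = "PiM {1..n} (\<lambda>_. mat_space p :: (nat \<Rightarrow> 'f ^ 'q) measure)"
  let ?Q = "PiM {Suc n} (\<lambda>_. mat_space p :: (nat \<Rightarrow> 'f ^ 'q) measure)"
  define latest where "latest \<omega> = (\<lambda>k\<in>{Suc n}. X k \<omega>)" for \<omega>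
  have ind: "indep_var ?P (history n) ?Q latest"
    unfolding history_def [abs_def] latest_def [abs_def] using indep by (rule indep_var_restrict) auto
  then have rvs [measurable]: "history n \<in> measurable M ?P" "latest \<in> measurable M ?Q"
    and joint: "distr M ?P (history n) \<Otimes>\<^sub>M distr M ?Q latest
        = distr M (?P \<Otimes>\<^sub>M ?Q) (\<lambda>\<omega>. (history n \<omega>, latest \<omega>))"
    by (auto simp: indep_var_distribution_eq)
  have comp [measurable]: "(\<lambda>h. h (Suc n)) \<in> measurable ?Q (mat_space p)"
    by (rule measurable_component_singleton) simp
  have X_eq: "distr M (mat_space p) (X (Suc n))
      = distr (distr M ?Q latest) (mat_space p) (\<lambda>h. h (Suc n))"
    by (subst distr_distr) (auto simp: latest_def comp_def)
  have "distr M ?P (history n) \<Otimes>\<^sub>M distr M (mat_space p) (X (Suc n)) =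
      distr (distr M ?P (history n)) ?P (\<lambda>h. h) \<Otimes>\<^sub>M distr (distr M ?Q latest) (mat_space p) (\<lambda>h. h (Suc n))"
    unfolding X_eq by (subst distr_id2 [of ?P]) simp_all
  also have "\<dots> = distr (distr M ?P (history n) \<Otimes>\<^sub>M distr M ?Q latest) (?P \<Otimes>\<^sub>M mat_space p) (\<lambda>(h,
      g). (h, g (Suc n)))"
  proof (rule pair_measure_distr)
    show "sigma_finite_measure (distr (distr M ?Q latest) (mat_space p) (\<lambda>h. h (Suc n)))"
      unfolding X_eq [symmetric] by (intro prob_space_imp_sigma_finite prob_space_distr rv) simp
  qed simp_all
  also have "\<dots> = distr M (?P \<Otimes>\<^sub>M mat_space p) (\<lambda>\<omega>. (history n \<omega>, X (Suc n) \<omega>))"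
  proof -
    have "(\<lambda>\<omega>. (history n \<omega>, latest \<omega>)) \<in> measurable M (?P \<Otimes>\<^sub>M ?Q)"
      by (intro measurable_Pair rvs)
    moreover have "(\<lambda>(h, g). (h, g (Suc n))) \<in> measurable (?P \<Otimes>\<^sub>M ?Q) (?P \<Otimes>\<^sub>M mat_space p)"
      by measurable
    ultimately show ?thesis
      unfolding joint by (simp add: distr_distr comp_def) (simp add: latest_def)
  qed
  finally show ?thesis .
qed

lemma expectation_increment:
  assumes F: "F \<in> borel_measurable (PiM {1..n} (\<lambda>_. mat_space p) \<Otimes>\<^sub>M mat_space p)"
    and G: "G \<in> borel_measurable (PiM {1..n} (\<lambda>_. mat_space p) \<Otimes>\<^sub>M mat_space p)"
    and sym: "\<And>h b. F (h, b) + F (h, neg_rows p b) = 2 * (G (h, b) :: ennreal)"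
  shows "(\<integral>\<^sup>+\<omega>. F (history n \<omega>, X (Suc n) \<omega>) \<partial>M) = (\<integral>\<^sup>+\<omega>. \<integral>\<^sup>+b. G (history n \<omega>, b) \<partial>\<mu> \<partial>M)"
  using nn_integral_radial_increment [OF measurable_history rv independent_history _ F G sym]
    radial law [of "Suc n"] by simp

lemma measurable_history_pair:
  "(\<lambda>(h, b). partial_sum p (\<lambda>k h. h k) n h)
      \<in> measurable (PiM {1..n} (\<lambda>_. mat_space p) \<Otimes>\<^sub>M mat_space p) (mat_space p)"
  "(\<lambda>(h, b). remainder p (\<lambda>k h. h k) n h)
      \<in> borel_measurable (PiM {1..n} (\<lambda>_. mat_space p) \<Otimes>\<^sub>M mat_space p)"
  unfolding split_beta
  by (rule measurable_compose [OF measurable_fst measurable_partial_sum [OF history_component]],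
      assumption)
    (rule measurable_compose [OF measurable_fst measurable_remainder [OF history_component]],
        assumption)

text \<open>
  The increments of the walk are orthogonal, because the next step may be replaced by its negative.
\<close>
lemma second_moment_partial_sum:
  "(\<integral>\<^sup>+\<omega>. sq_norm p (partial_sum p X n \<omega>) \<partial>M) = of_nat n * second_moment"
proof (induction n)
  case 0
  then show ?case
    by (simp add: partial_sum_0 sq_norm_def)
next
  case (Suc n)
  let ?H = "PiM {1..n} (\<lambda>_. mat_space p) \<Otimes>\<^sub>M (mat_space p :: (nat \<Rightarrow> 'f ^ 'q) measure)"
  define S where "S = (\<lambda>(h, b :: nat \<Rightarrow> 'f ^ 'q). partial_sum p (\<lambda>k h. h k :: nat \<Rightarrow> 'f ^ 'q) n h)"
  have S [measurable]: "S \<in> measurable ?H (mat_space p)"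
    unfolding S_def by (rule measurable_history_pair)
  define F where "F z = ennreal (sq_norm p (\<lambda>i\<in>{..<p}. S z i + snd z i))" for z
  define G where "G z = ennreal (sq_norm p (S z)) + ennreal (sq_norm p (snd z))" for z
  have add: "(\<lambda>z. \<lambda>i\<in>{..<p}. S z i + snd z i) \<in> measurable ?H (mat_space p)"
    by (intro measurable_into_mat_space borel_measurable_add measurable_compose [OF S measurable_row]
        measurable_compose [OF measurable_snd measurable_row])
  have "(\<integral>\<^sup>+\<omega>. sq_norm p (partial_sum p X (Suc n) \<omega>) \<partial>M) = (\<integral>\<^sup>+\<omega>. F (history n \<omega>, X (Suc n) \<omega>) \<partial>M)"
    by (simp add: F_def S_def partial_sum_history partial_sum_Suc)
  also have "\<dots> = (\<integral>\<^sup>+\<omega>. \<integral>\<^sup>+b. G (history n \<omega>, b) \<partial>\<mu> \<partial>M)"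
  proof (rule expectation_increment)
    show "F \<in> borel_measurable ?H"
      unfolding F_def using add by measurable
    show "G \<in> borel_measurable ?H"
      unfolding G_def by measurable
    show "F (h, b) + F (h, neg_rows p b) = 2 * G (h, b)" for h b
    proof -
      have "(\<Sum>i<p. (norm (S (h, b) i + b i))\<^sup>2) + (\<Sum>i<p. (norm (S (h, b) i - b i))\<^sup>2)
          = 2 * ((\<Sum>i<p. (norm (S (h, b) i))\<^sup>2) + (\<Sum>i<p. (norm (b i))\<^sup>2))"
        by (simp add: parallelogram sum_distrib_left flip: sum.distrib)
      moreover have "S (h, neg_rows p b) = S (h, b)"
        by (simp add: S_def)
      ultimately show ?thesis
        unfolding F_def G_def
        by (intro ennreal_add_eq_double) (simp_all add: sq_norm_def neg_rows_def sum_nonneg)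
    qed
  qed
  also have "\<dots> = (\<integral>\<^sup>+\<omega>. sq_norm p (partial_sum p X n \<omega>) + second_moment \<partial>M)"
  proof (rule nn_integral_cong)
    fix \<omega>
    show "(\<integral>\<^sup>+b. G (history n \<omega>, b) \<partial>\<mu>) = sq_norm p (partial_sum p X n \<omega>) + second_moment"
      unfolding G_def S_def
      by (subst nn_integral_add)
        (auto simp: partial_sum_history prob_space.emeasure_space_1
            [OF prob_space_law] measurable_cong_sets [OF sets_law refl])
  qed
  also have "\<dots> = of_nat (Suc n) * second_moment"
  proof -
    have "partial_sum p X n \<in> measurable M (mat_space p)"
      by (intro measurable_partial_sum rv) auto
    then show ?thesis
      using Suc.IH by (subst nn_integral_add) (auto simp: emeasure_space_1 distrib_right add.commute)
  qed
  finally show ?case .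
qed

text \<open>
  The increment \<open>S\<^sup>* X + X\<^sup>* S\<close> of the remainder is odd in the new step \<open>X\<close>, so second moments
  of the increments add up. By \<open>cross_second_moment\<close> each is at most \<open>4 n m\<^sup>2 / p\<close>, where \<open>m\<close>
  is the second moment of a single step, and \<open>4 (0 + 1 + \<dots> + (n - 1)) \<le> 2 n\<^sup>2\<close>.
\<close>
lemma second_moment_remainder:
  "of_nat p * (\<integral>\<^sup>+\<omega>. (norm (remainder p X n \<omega>))\<^sup>2 \<partial>M) \<le> of_nat (2 * n\<^sup>2) * second_moment\<^sup>2"
proof (induction n)
  case 0
  then show ?case
    by (simp add: remainder_0)
next
  case (Suc n)
  let ?H = "PiM {1..n} (\<lambda>_. mat_space p) \<Otimes>\<^sub>M (mat_space p :: (nat \<Rightarrow> 'f ^ 'q) measure)"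
  define S where "S = (\<lambda>(h, b :: nat \<Rightarrow> 'f ^ 'q). partial_sum p (\<lambda>k h. h k :: nat \<Rightarrow> 'f ^ 'q) n h)"
  define T where "T = (\<lambda>(h, b :: nat \<Rightarrow> 'f ^ 'q). remainder p (\<lambda>k h. h k :: nat \<Rightarrow> 'f ^ 'q) n h)"
  define W where "W z = cross p (S z) (snd z) + cross p (snd z) (S z)" for z
  have S [measurable]: "S \<in> measurable ?H (mat_space p)"
    unfolding S_def by (rule measurable_history_pair)
  have T [measurable]: "T \<in> borel_measurable ?H"
    unfolding T_def by (rule measurable_history_pair)
  have W [measurable]: "W \<in> borel_measurable ?H"
    unfolding W_def by measurable
  define F where "F z = ennreal ((norm (T z + W z))\<^sup>2)" for z
  define G where "G z = ennreal ((norm (T z))\<^sup>2) + ennreal ((norm (W z))\<^sup>2)" for z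
  let ?R = "\<integral>\<^sup>+\<omega>. (norm (remainder p X n \<omega>))\<^sup>2 \<partial>M"
  have R_meas: "remainder p X n \<in> borel_measurable M" and S_meas: "partial_sum p X n
      \<in> measurable M (mat_space p)"
    by (intro measurable_remainder measurable_partial_sum rv; simp)+
  have "(\<integral>\<^sup>+\<omega>. (norm (remainder p X (Suc n) \<omega>))\<^sup>2 \<partial>M) = (\<integral>\<^sup>+\<omega>. F (history n \<omega>, X (Suc n) \<omega>) \<partial>M)"
    by (simp add: F_def T_def W_def S_def remainder_history partial_sum_history remainder_Suc)
  also have "\<dots> = (\<integral>\<^sup>+\<omega>. \<integral>\<^sup>+b. G (history n \<omega>, b) \<partial>\<mu> \<partial>M)"
  proof (rule expectation_increment)
    show "F \<in> borel_measurable ?H" "G \<in> borel_measurable ?H"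
      unfolding F_def G_def by measurable
    show "F (h, b) + F (h, neg_rows p b) = 2 * G (h, b)" for h b
    proof -
      have "W (h, neg_rows p b) = - W (h, b)" "T (h, neg_rows p b) = T (h, b)"
        by (simp_all add: W_def S_def T_def cross_neg_rows)
      then show ?thesis
        using ennreal_parallelogram [of "T (h, b)" "W (h, b)"] by (simp add: F_def G_def)
    qed
  qed
  finally have eq: "(\<integral>\<^sup>+\<omega>. (norm (remainder p X (Suc n) \<omega>))\<^sup>2 \<partial>M) = (\<integral>\<^sup>+\<omega>. \<integral>\<^sup>+b. G (history n \<omega>,
      b) \<partial>\<mu> \<partial>M)" .
  have inner: "of_nat p * (\<integral>\<^sup>+b. G (history n \<omega>, b) \<partial>\<mu>) \<le>
      of_nat p * ennreal ((norm (remainder p X n \<omega>))\<^sup>2)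
          + 4 * (ennreal (sq_norm p (partial_sum p X n \<omega>)) * second_moment)"
    for \<omega>
  proof -
    let ?y = "partial_sum p X n \<omega>"
    have "G (history n \<omega>, b) \<le> ennreal ((norm (remainder p X n \<omega>))\<^sup>2)
        + 4 * ennreal ((norm (cross p ?y b))\<^sup>2)" for b
    proof -
      have "norm (W (history n \<omega>, b)) \<le> 2 * norm (cross p ?y b)"
        using norm_triangle_ineq [of "cross p ?y b" "cross p b ?y"] norm_adjoint [of "cross p ?y b"]
        by (simp add: W_def S_def partial_sum_history adjoint_cross)
      then have "(norm (W (history n \<omega>, b)))\<^sup>2 \<le> (2 * norm (cross p ?y b))\<^sup>2"
        by (rule power_mono) simp
      then have "ennreal ((norm (W (history n \<omega>, b)))\<^sup>2) \<le> 4 * ennreal ((norm (cross p ?y b))\<^sup>2)"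
        by (simp add: power_mult_distrib ennreal_leI flip: ennreal_mult ennreal_numeral)
      then show ?thesis
        by (simp add: G_def T_def remainder_history add_left_mono)
    qed
    then have "(\<integral>\<^sup>+b. G (history n \<omega>, b) \<partial>\<mu>)
        \<le> (\<integral>\<^sup>+b. ennreal ((norm (remainder p X n \<omega>))\<^sup>2) + 4 * ennreal ((norm (cross p ?y b))\<^sup>2) \<partial>\<mu>)"
      by (intro nn_integral_mono) simp
    also have "\<dots> = ennreal ((norm (remainder p X n \<omega>))\<^sup>2) + 4 * (\<integral>\<^sup>+b. (norm (cross p ?y b))\<^sup>2 \<partial>\<mu>)"
    proof -
      have "?y \<in> space (mat_space p)"
        by (auto simp: partial_sum_def mat_space_def space_PiM)
      then have "(\<lambda>b. cross p ?y b) \<in> borel_measurable \<mu>"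
        unfolding measurable_cong_sets [OF sets_law refl] by (intro measurable_cross) auto
      then show ?thesis
        by (simp add: nn_integral_add nn_integral_cmult prob_space.emeasure_space_1
            [OF prob_space_law])
    qed
    finally have "of_nat p * (\<integral>\<^sup>+b. G (history n \<omega>, b) \<partial>\<mu>) \<le> of_nat p * \<dots>"
      by (intro mult_left_mono) auto
    also have "\<dots> = of_nat p * ennreal ((norm (remainder p X n \<omega>))\<^sup>2)
        + 4 * (of_nat p * (\<integral>\<^sup>+b. (norm (cross p ?y b))\<^sup>2 \<partial>\<mu>))"
      by (simp add: distrib_left mult_ac)
    also have "of_nat p * (\<integral>\<^sup>+b. (norm (cross p ?y b))\<^sup>2 \<partial>\<mu>) = ennreal (sq_norm p ?y) * second_moment"
      by (rule cross_second_moment [OF radial sets_law])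
    finally show ?thesis .
  qed
  have "(\<lambda>\<omega>. \<integral>\<^sup>+b. G (history n \<omega>, b) \<partial>\<mu>) \<in> borel_measurable M"
  proof -
    interpret \<mu>: prob_space \<mu> by (rule prob_space_law)
    have "G \<in> borel_measurable (PiM {1..n} (\<lambda>_. mat_space p) \<Otimes>\<^sub>M \<mu>)"
      unfolding G_def measurable_cong_sets [OF sets_pair_measure_cong [OF refl sets_law] refl]
          by measurable
    from measurable_compose [OF measurable_history \<mu>.borel_measurable_nn_integral_fst [OF this]]
    show ?thesis by simp
  qed
  then have "of_nat p * (\<integral>\<^sup>+\<omega>. (norm (remainder p X (Suc n) \<omega>))\<^sup>2 \<partial>M)
      = (\<integral>\<^sup>+\<omega>. of_nat p * (\<integral>\<^sup>+b. G (history n \<omega>, b) \<partial>\<mu>) \<partial>M)"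
    unfolding eq by (rule nn_integral_cmult [symmetric])
  also have "\<dots> \<le> (\<integral>\<^sup>+\<omega>. of_nat p * ennreal ((norm (remainder p X n \<omega>))\<^sup>2)
        + 4 * (ennreal (sq_norm p (partial_sum p X n \<omega>)) * second_moment) \<partial>M)"
    by (intro nn_integral_mono inner)
  also have "\<dots> = of_nat p * ?R + 4 * ((of_nat n * second_moment) * second_moment)"
    using R_meas S_meas
    by (simp add: nn_integral_add nn_integral_cmult nn_integral_multc second_moment_partial_sum)
  also have "\<dots> \<le> of_nat (2 * n\<^sup>2) * second_moment\<^sup>2 + of_nat (4 * n) * second_moment\<^sup>2"
    using Suc.IH by (intro add_mono) (auto simp: power2_eq_square mult_ac)
  also have "\<dots> = of_nat (2 * n\<^sup>2 + 4 * n) * second_moment\<^sup>2"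
    by (simp add: distrib_right)
  also have "\<dots> \<le> of_nat (2 * (Suc n)\<^sup>2) * second_moment\<^sup>2"
    by (intro mult_right_mono of_nat_mono) (auto simp: power2_eq_square)
  finally show ?case .
qed

end

section \<open>Normal laws and the central limit theorem for characteristic functions\<close>

text \<open>
  The central limit theorem on the level of characteristic functions: expand \<open>char M\<close> to second
  order at 0 and compare with \<open>(1 - v t\<^sup>2 / (2 n)) ^ n\<close>. Variance zero is included, as degenerate
  limits occur.
\<close>
lemma (in real_distribution) char_power_tendsto:
  assumes "integrable M (\<lambda>x. x)" "expectation (\<lambda>x. x) = 0" "integrable M (\<lambda>x. x\<^sup>2)"
  shows "(\<lambda>n. char M (t / sqrt n) ^ n) \<longlonglongrightarrow> exp (- (expectation (\<lambda>x. x\<^sup>2) * t\<^sup>2 / 2))"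
proof -
  define v where "v = expectation (\<lambda>x. x\<^sup>2)"
  define q where "q n = 1 + (- (v * t\<^sup>2 / 2)) / real n" for n
  define I where "I n = expectation (\<lambda>x. min (6 * x\<^sup>2) (\<bar>t / sqrt n\<bar> * \<bar>x\<bar> ^ 3))" for n :: nat
  have "0 \<le> v"
    by (simp add: v_def)
  have bound: "\<forall>\<^sub>F n in sequentially. norm (char M (t / sqrt n) ^ n - complex_of_real (q n ^ n))
      \<le> t\<^sup>2 / 6 * I n"
    \<comment> \<open>From here on q n lies in the unit interval, as needed to compare the n-th powers.\<close>
    using eventually_ge_at_top [of "nat \<lceil>v * t\<^sup>2\<rceil> + 1"]
  proof eventually_elim
    case (elim n)
    then have n: "0 < n" "v * t\<^sup>2 \<le> real n"
      by linarith+
    have "0 \<le> v * t\<^sup>2 / 2 / real n" "v * t\<^sup>2 / 2 / real n \<le> 1"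
      using \<open>0 \<le> v\<close> n by (auto simp: field_simps)
    then have q: "\<bar>q n\<bar> \<le> 1"
      by (simp add: q_def abs_le_iff)
    have "norm (char M (t / sqrt n) - (1 - (t / sqrt n)\<^sup>2 * v / 2)) \<le> (t / sqrt n)\<^sup>2 / 6 * I n"
      unfolding I_def by (rule char_approx3) (use assms in \<open>simp_all add: v_def\<close>)
    moreover have "1 - (t / sqrt n)\<^sup>2 * v / 2 = q n"
      using n by (simp add: q_def power_divide mult.commute)
    ultimately have step: "norm (char M (t / sqrt n) - complex_of_real (q n))
        \<le> (t / sqrt n)\<^sup>2 / 6 * I n"
      by (metis of_real_1 of_real_diff of_real_divide of_real_mult of_real_numeral of_real_power)
    have "norm (char M (t / sqrt n) ^ n - complex_of_real (q n) ^ n)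
        \<le> real n * norm (char M (t / sqrt n) - complex_of_real (q n))"
      using q by (intro norm_power_diff cmod_char_le_1) simp
    also have "\<dots> \<le> real n * ((t / sqrt n)\<^sup>2 / 6 * I n)"
      by (intro mult_left_mono step) simp
    also have "\<dots> = t\<^sup>2 / 6 * I n"
      using n by (simp add: power_divide)
    finally show ?case by simp
  qed
  have "I \<longlonglongrightarrow> expectation (\<lambda>x. 0)"
    unfolding I_def
  proof (rule integral_dominated_convergence [where w = "\<lambda>x. 6 * x\<^sup>2"])
    show "AE x in M. (\<lambda>n. min (6 * x\<^sup>2) (\<bar>t / sqrt n\<bar> * \<bar>x\<bar> ^ 3)) \<longlonglongrightarrow> 0"
    proof (rule AE_I2)
      fix x
      have "(\<lambda>n. inverse (sqrt (real n))) \<longlonglongrightarrow> 0"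
        by (intro tendsto_inverse_0_at_top filterlim_compose
            [OF sqrt_at_top filterlim_real_sequentially])
      then have "(\<lambda>n. \<bar>t * inverse (sqrt (real n))\<bar> * \<bar>x\<bar> ^ 3) \<longlonglongrightarrow> \<bar>t * 0\<bar> * \<bar>x\<bar> ^ 3"
        by (intro tendsto_intros)
      then have "(\<lambda>n. min (6 * x\<^sup>2) (\<bar>t * inverse (sqrt (real n))\<bar> * \<bar>x\<bar> ^ 3))
          \<longlonglongrightarrow> min (6 * x\<^sup>2) (\<bar>t * 0\<bar> * \<bar>x\<bar> ^ 3)"
        by (intro tendsto_min tendsto_const)
      moreover have "min (6 * x\<^sup>2) (\<bar>t * 0\<bar> * \<bar>x\<bar> ^ 3) = 0"
        by simp
      ultimately show "(\<lambda>n. min (6 * x\<^sup>2) (\<bar>t / sqrt n\<bar> * \<bar>x\<bar> ^ 3)) \<longlonglongrightarrow> 0"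
        by (simp only: divide_inverse)
    qed
    show "integrable M (\<lambda>x. 6 * x\<^sup>2)"
      using assms(3) by simp
    show "AE x in M. norm (min (6 * x\<^sup>2) (\<bar>t / sqrt n\<bar> * \<bar>x\<bar> ^ 3)) \<le> 6 * x\<^sup>2" for n :: nat
      by (intro AE_I2) (simp add: abs_le_iff min_le_iff_disj)
  qed measurable
  then have "I \<longlonglongrightarrow> 0"
    by simp
  then have "(\<lambda>n. t\<^sup>2 / 6 * I n) \<longlonglongrightarrow> 0"
    by (rule tendsto_mult_right_zero)
  from Lim_null_comparison [OF bound this]
  have diff: "(\<lambda>n. char M (t / sqrt n) ^ n - complex_of_real (q n ^ n)) \<longlonglongrightarrow> 0" .
  have "(\<lambda>n. q n ^ n) \<longlonglongrightarrow> exp (- (v * t\<^sup>2 / 2))"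
    unfolding q_def by (rule tendsto_exp_limit_sequentially)
  then have "(\<lambda>n. complex_of_real (q n ^ n)) \<longlonglongrightarrow> complex_of_real (exp (- (v * t\<^sup>2 / 2)))"
    by (rule tendsto_of_real)
  from Lim_transform [OF this diff]
  have "(\<lambda>n. char M (t / sqrt n) ^ n) \<longlonglongrightarrow> complex_of_real (exp (- (v * t\<^sup>2 / 2)))" .
  then show ?thesis
    by (simp add: v_def)
qed

lemma prob_space_normal_law_real:
  assumes "0 \<le> v"
  shows "prob_space (normal_law_real m v)"
  using assms prob_space_normal_density [of "sqrt v" m] by (auto simp: normal_law_real_def
      intro!: prob_space_return)

lemma sets_normal_law_real: "sets (normal_law_real m v) = sets borel"
  by (simp add: normal_law_real_def)

lemma char_normal_law_real:
  assumes "0 \<le> v"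
  shows "char (normal_law_real 0 v) t = exp (- (v * t\<^sup>2 / 2))"
proof (cases "v = 0")
  case True
  then show ?thesis
    by (simp add: normal_law_real_def char_def integral_return)
next
  case False
  define s where "s = sqrt v"
  have s: "0 < s" "s\<^sup>2 = v"
    using False assms by (simp_all add: s_def)
  define P where "P = density lborel (normal_density 0 s)"
  interpret P: prob_space P
    unfolding P_def using s(1) by (rule prob_space_normal_density)
  have "distributed P lborel (\<lambda>x. x) (normal_density 0 s)"
    by (simp add: distributed_def P_def distr_id2)
  then have "distributed P lborel (\<lambda>x. (x - 0) / s) std_normal_density"
    by (rule iffD1 [OF P.normal_standard_normal_convert [OF s(1)]])
  then have std: "distr P borel (\<lambda>x. x / s) = std_normal_distribution"
    by (auto simp: distributed_def cong: distr_cong)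
  have "(\<lambda>x. x / s) \<in> borel_measurable P"
    by (simp add: P_def)
  then have "char std_normal_distribution (t * s) = char P t"
    unfolding std [symmetric] char_def using s by (subst integral_distr) auto
  then show ?thesis
    using s False by (simp add: normal_law_real_def char_std_normal_distribution P_def
        power_mult_distrib
        mult.commute s_def [symmetric])
qed

text \<open>
  The characteristic function determines such a measure and is the form in which it enters the
  continuity theorem; that the one-dimensional images are normal is derived from it.
\<close>
definition centred_gaussian :: "('a::euclidean_space \<Rightarrow> 'a \<Rightarrow> real) \<Rightarrow> 'a measure \<Rightarrow> bool" where
  "centred_gaussian C N \<longleftrightarrow> prob_space N \<and> sets N = sets borel \<and>
     (\<forall>a. (\<integral>x. iexp (a \<bullet> x) \<partial>N) = exp (- (C a a / 2)))"

text \<open>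
  If \<open>S\<close> is the symmetric square root of the operator \<open>T\<close> of the form \<open>C\<close>, and \<open>G\<close> has independent
  standard normal coordinates, then \<open>a \<bullet> S G = S a \<bullet> G\<close> has variance \<open>(norm (S a))\<^sup>2 = C a a\<close>.
\<close>
theorem centred_gaussian_exists:
  fixes C :: "'a::euclidean_space \<Rightarrow> 'a \<Rightarrow> real"
  assumes bil: "bilinear C" and sym: "\<And>a b. C a b = C b a" and nonneg: "\<And>a. 0 \<le> C a a"
  shows "\<exists>N. centred_gaussian C N"
proof -
  define T where "T = Blinfun (\<lambda>b. \<Sum>e\<in>Basis. C e b *\<^sub>R e)"
  have linear: "linear (\<lambda>b. C a b)" for a
    using bil by (simp add: bilinear_def)
  have "linear (\<lambda>b. \<Sum>e\<in>Basis. C e b *\<^sub>R e)"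
    by (intro linearI) (simp_all add: linear_add [OF linear] linear_scale [OF linear]
        scaleR_left_distrib sum.distrib scaleR_sum_right)
  then have T: "T b = (\<Sum>e\<in>Basis. C e b *\<^sub>R e)" for b
    unfolding T_def by (simp add: bounded_linear_Blinfun_apply linear_conv_bounded_linear)
  have CT: "a \<bullet> T b = C a b" for a b
  proof -
    have "a \<bullet> T b = (\<Sum>e\<in>Basis. (a \<bullet> e) *\<^sub>R C b e)"
      by (simp add: T inner_sum_right sym [of b] mult.commute)
    also have "\<dots> = C b (\<Sum>e\<in>Basis. (a \<bullet> e) *\<^sub>R e)"
      by (simp only: linear_sum [OF linear] linear_scale [OF linear])
    finally show ?thesis
      by (simp add: euclidean_representation sym)
  qed
  have "psd_operator T"
    using nonneg sym by (simp add: psd_operator_def CT inner_commute [of "T _"])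
  moreover have "closed_subalgebra (UNIV :: ('a \<Rightarrow>\<^sub>L 'a) set)"
    by (simp add: closed_subalgebra_def)
  ultimately obtain S where S: "psd_operator S" "S o\<^sub>L S = T"
    using psd_operator_sqrt by blast
  have norm_S: "(norm (S a))\<^sup>2 = C a a" for a
    using S(1) by (simp add: psd_operator_def power2_norm_eq_inner CT [symmetric] S(2) [symmetric])
  interpret std: prob_space std_normal_distribution
    using real_dist_normal_dist by (simp add: real_distribution_def)
  interpret P: product_sigma_finite "\<lambda>_ :: 'a. std_normal_distribution"
    by standard
  define P where "P = PiM (Basis :: 'a set) (\<lambda>_. std_normal_distribution)"
  interpret P': prob_space P
    unfolding P_def by (intro prob_space_PiM) (rule std.prob_space_axioms)
  define G where "G w = S (\<Sum>e\<in>Basis. w e *\<^sub>R e)" for w :: "'a \<Rightarrow> real"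
  have comp: "(\<lambda>w. w e) \<in> borel_measurable P" if "e \<in> Basis" for e
    using measurable_component_singleton [OF that, of "\<lambda>_. std_normal_distribution"] by
        (simp add: P_def cong: measurable_cong_sets)
  have "(\<lambda>w. \<Sum>e\<in>Basis. w e *\<^sub>R e) \<in> borel_measurable P"
    using comp by (intro borel_measurable_sum borel_measurable_scaleR) auto
  moreover have "blinfun_apply S \<in> borel_measurable borel"
    by (intro borel_measurable_continuous_onI continuous_intros)
  ultimately have G: "G \<in> borel_measurable P"
    unfolding G_def [abs_def] by (rule measurable_compose)
  have "(\<integral>x. iexp (a \<bullet> x) \<partial>distr P borel G) = exp (- (C a a / 2))" for a
  proof -
    have aG: "a \<bullet> G w = (\<Sum>e\<in>Basis. (S a \<bullet> e) * w e)" for w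
    proof -
      have "a \<bullet> G w = S a \<bullet> (\<Sum>e\<in>Basis. w e *\<^sub>R e)"
        using S(1) by (simp add: psd_operator_def G_def)
      then show ?thesis
        by (simp add: inner_sum_right mult.commute)
    qed
    have "(\<integral>x. iexp (a \<bullet> x) \<partial>distr P borel G) = (\<integral>w. iexp (a \<bullet> G w) \<partial>P)"
      using G by (intro integral_distr) auto
    also have "\<dots> = (\<integral>w. (\<Prod>e\<in>Basis. iexp ((S a \<bullet> e) * w e)) \<partial>P)"
      unfolding aG by (simp add: sum_distrib_left exp_sum)
    also have "\<dots> = (\<Prod>e\<in>Basis. \<integral>x. iexp ((S a \<bullet> e) * x) \<partial>std_normal_distribution)"
      unfolding P_def by (intro P.product_integral_prod finite_Basis std.integrable_iexp) auto
    also have "\<dots> = (\<Prod>e\<in>Basis. complex_of_real (exp (- ((S a \<bullet> e)\<^sup>2 / 2))))"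
      using char_std_normal_distribution by (simp add: char_def fun_eq_iff)
    also have "\<dots> = complex_of_real (exp (- ((\<Sum>e\<in>Basis. (S a \<bullet> e)\<^sup>2) / 2)))"
      by (simp add: sum_divide_distrib exp_sum flip: sum_negf of_real_prod)
    also have "(\<Sum>e\<in>Basis. (S a \<bullet> e)\<^sup>2) = C a a"
      unfolding norm_S [symmetric] power2_norm_eq_inner
      by (subst euclidean_inner) (simp add: power2_eq_square)
    finally show ?thesis by simp
  qed
  then have "centred_gaussian C (distr P borel G)"
    using G by (simp add: centred_gaussian_def P'.prob_space_distr)
  then show ?thesis by blast
qed

lemma centred_gaussian_inner:
  assumes N: "centred_gaussian C N" and C: "0 \<le> C a a" "\<And>t. C (t *\<^sub>R a) (t *\<^sub>R a) = t\<^sup>2 * C a a"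
  shows "distr N borel (\<lambda>x. a \<bullet> x) = normal_law_real 0 (C a a)"
proof (rule Levy_uniqueness)
  interpret prob_space N
    using N by (simp add: centred_gaussian_def)
  have meas: "(\<lambda>x. a \<bullet> x) \<in> borel_measurable N"
    using N by (simp add: centred_gaussian_def cong: measurable_cong_sets)
  then show "real_distribution (distr N borel (\<lambda>x. a \<bullet> x))"
    by (rule real_distribution_distr)
  show "real_distribution (normal_law_real 0 (C a a))"
    using prob_space_normal_law_real [OF C(1)] sets_normal_law_real [of 0 "C a a"]
        sets_eq_imp_space_eq [OF sets_normal_law_real [of 0 "C a a"]]
    by (simp add: real_distribution_def real_distribution_axioms_def)
  have "char (distr N borel (\<lambda>x. a \<bullet> x)) t = char (normal_law_real 0 (C a a)) t" for t
  proof -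
    have "char (distr N borel (\<lambda>x. a \<bullet> x)) t = (\<integral>x. iexp ((t *\<^sub>R a) \<bullet> x) \<partial>N)"
      unfolding char_def using meas by (subst integral_distr) simp_all
    also have "\<dots> = exp (- (C (t *\<^sub>R a) (t *\<^sub>R a) / 2))"
      using N unfolding centred_gaussian_def by blast
    also have "\<dots> = char (normal_law_real 0 (C a a)) t"
      by (simp add: char_normal_law_real C mult.commute)
    finally show ?thesis .
  qed
  then show "char (distr N borel (\<lambda>x. a \<bullet> x)) = char (normal_law_real 0 (C a a))"
    by blast
qed

section \<open>The law of the squared radial part\<close>

lemma norm_matrix_mult_le: "norm (s ** t) \<le> norm s * norm t" for s t :: "'f::rch ^ 'q ^ 'q"
proof (rule power2_le_imp_le)
  have "(norm (s ** t))\<^sup>2 = (\<Sum>i\<in>UNIV. \<Sum>j\<in>UNIV. (norm (\<Sum>k\<in>UNIV. s $ i $ k * t $ k $ j))\<^sup>2)"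
    by (simp add: power2_norm_vec matrix_matrix_mult_def)
  also have "\<dots> \<le> (\<Sum>i\<in>UNIV. \<Sum>j\<in>UNIV. (\<Sum>k\<in>UNIV. (norm (s $ i $ k))\<^sup>2) * (\<Sum>k\<in>UNIV. (norm (t $ k $ j))\<^sup>2))"
  proof (intro sum_mono)
    fix i j
    have "norm (\<Sum>k\<in>UNIV. s $ i $ k * t $ k $ j) \<le> (\<Sum>k\<in>UNIV. norm (s $ i $ k) * norm (t $ k $ j))"
      by (rule order_trans [OF norm_sum]) (simp add: norm_mult)
    then have "(norm (\<Sum>k\<in>UNIV. s $ i $ k * t $ k $ j))\<^sup>2
        \<le> (\<Sum>k\<in>UNIV. norm (s $ i $ k) * norm (t $ k $ j))\<^sup>2"
      by (rule power_mono) simp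
    also have "\<dots> \<le> (\<Sum>k\<in>UNIV. (norm (s $ i $ k))\<^sup>2) * (\<Sum>k\<in>UNIV. (norm (t $ k $ j))\<^sup>2)"
      by (rule Cauchy_Schwarz_ineq_sum)
    finally show "(norm (\<Sum>k\<in>UNIV. s $ i $ k * t $ k $ j))\<^sup>2
        \<le> (\<Sum>k\<in>UNIV. (norm (s $ i $ k))\<^sup>2) * (\<Sum>k\<in>UNIV. (norm (t $ k $ j))\<^sup>2)" .
  qed
  also have "\<dots> = (\<Sum>i\<in>UNIV. \<Sum>k\<in>UNIV. (norm (s $ i $ k))\<^sup>2) * (\<Sum>j\<in>UNIV. \<Sum>k\<in>UNIV. (norm (t $ k $ j))\<^sup>2)"
    unfolding sum_product ..
  also have "\<dots> = (norm s * norm t)\<^sup>2"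
    unfolding power_mult_distrib power2_norm_vec by (subst (2) sum.swap) (rule refl)
  finally show "(norm (s ** t))\<^sup>2 \<le> (norm s * norm t)\<^sup>2" .
qed simp

lemma measurable_square: "(\<lambda>s :: 'f::rch ^ 'q ^ 'q. s ** s) \<in> borel_measurable borel"
  by (intro borel_measurable_continuous_onI continuous_intros)

text \<open>
  For \<open>s\<close> distributed according to \<open>\<nu>\<close>, the matrix \<open>s ** s\<close> has the law of the squared radial part
  of every step, whatever the number of rows. Its mean and covariance depend only on \<open>\<nu>\<close>, and the
  fourth moment of \<open>\<nu>\<close> bounds its second moment.
\<close>
locale psd_law = prob_space \<nu> for \<nu> :: "('f::rch ^ 'q ^ 'q) measure" +
  assumes sets_\<nu>: "sets \<nu> = sets (restrict_space borel psd_cone)"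
    and m4: "(\<integral>\<^sup>+ s. ennreal (norm s ^ 4) \<partial>\<nu>) < \<infinity>"
begin

lemma space_\<nu>: "space \<nu> = psd_cone"
  using sets_eq_imp_space_eq [OF sets_\<nu>] by (simp add: space_restrict_space)

lemma borel_measurable_\<nu>: "f \<in> measurable borel N \<Longrightarrow> f \<in> measurable \<nu> N"
  unfolding measurable_cong_sets [OF sets_\<nu> refl] by (rule measurable_restrict_space1)

definition mean :: "'f ^ 'q ^ 'q" where
  "mean = (\<integral>s. s ** s \<partial>\<nu>)"

definition cov :: "'f ^ 'q ^ 'q \<Rightarrow> 'f ^ 'q ^ 'q \<Rightarrow> real" where
  "cov = covariance \<nu> (\<lambda>s. s ** s)"

definition deviation :: "'f ^ 'q ^ 'q \<Rightarrow> 'f ^ 'q ^ 'q" where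
  "deviation s = s ** s - mean"

lemma measurable_square_\<nu>: "(\<lambda>s. s ** s) \<in> borel_measurable \<nu>"
  by (intro borel_measurable_\<nu> measurable_square)

lemma integrable_norm4: "integrable \<nu> (\<lambda>s. norm s ^ 4)"
  using m4 borel_measurable_\<nu> [of "\<lambda>s. norm s ^ 4" borel] by (intro integrableI_nonneg) auto

lemma integrable_norm2: "integrable \<nu> (\<lambda>s. (norm s)\<^sup>2)"
proof (rule square_integrable_imp_integrable)
  show "integrable \<nu> (\<lambda>s. ((norm s)\<^sup>2)\<^sup>2)"
    using integrable_norm4 by simp
qed (intro borel_measurable_\<nu>, measurable)

lemma integrable_square: "integrable \<nu> (\<lambda>s. s ** s)"
  by (rule Bochner_Integration.integrable_bound [OF integrable_norm2 measurable_square_\<nu>])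
    (simp add: norm_matrix_mult_le power2_eq_square)

lemma integrable_deviation2: "integrable \<nu> (\<lambda>s. (norm (deviation s))\<^sup>2)"
proof (rule Bochner_Integration.integrable_bound)
  show "integrable \<nu> (\<lambda>s. 2 * norm s ^ 4 + 2 * (norm mean)\<^sup>2)"
    using integrable_norm4 by simp
  show "(\<lambda>s. (norm (deviation s))\<^sup>2) \<in> borel_measurable \<nu>"
    using measurable_square_\<nu> unfolding deviation_def by measurable
  show "AE s in \<nu>. norm ((norm (deviation s))\<^sup>2) \<le> norm (2 * norm s ^ 4 + 2 * (norm mean)\<^sup>2)"
  proof (rule AE_I2)
    fix s
    have "(norm (deviation s))\<^sup>2 \<le> 2 * ((norm (s ** s))\<^sup>2 + (norm mean)\<^sup>2)"
      unfolding deviation_def parallelogram [of "s ** s" mean, symmetric] by simp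
    also have "(norm (s ** s))\<^sup>2 \<le> (norm s * norm s)\<^sup>2"
      by (intro power_mono norm_matrix_mult_le) simp
    finally show "norm ((norm (deviation s))\<^sup>2) \<le> norm (2 * norm s ^ 4 + 2 * (norm mean)\<^sup>2)"
      by (simp add: power_mult_distrib flip: power_add)
  qed
qed

lemma integrable_deviation_product: "integrable \<nu> (\<lambda>s. (a \<bullet> deviation s) * (b \<bullet> deviation s))"
proof (rule Bochner_Integration.integrable_bound)
  show "integrable \<nu> (\<lambda>s. norm a * norm b * (norm (deviation s))\<^sup>2)"
    using integrable_deviation2 by simp
  show "(\<lambda>s. (a \<bullet> deviation s) * (b \<bullet> deviation s)) \<in> borel_measurable \<nu>"
    using measurable_square_\<nu> unfolding deviation_def by measurable
  have "\<bar>a \<bullet> deviation s\<bar> * \<bar>b \<bullet> deviation s\<bar>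
      \<le> (norm a * norm (deviation s)) * (norm b * norm (deviation s))" for s
    by (intro mult_mono Cauchy_Schwarz_ineq2) auto
  then show "AE s in \<nu>. norm ((a \<bullet> deviation s) * (b \<bullet> deviation s))
      \<le> norm (norm a * norm b * (norm (deviation s))\<^sup>2)"
    by (simp add: abs_mult power2_eq_square mult_ac)
qed

lemma inner_mean: "(\<integral>s. a \<bullet> (s ** s) \<partial>\<nu>) = a \<bullet> mean"
  unfolding mean_def by (intro integral_inner_right) (simp add: integrable_square)

lemma cov_eq: "cov a b = (\<integral>s. (a \<bullet> deviation s) * (b \<bullet> deviation s) \<partial>\<nu>)"
  by (simp add: cov_def covariance_def inner_mean deviation_def inner_diff_right)

lemma integral_deviation: "(\<integral>s. a \<bullet> deviation s \<partial>\<nu>) = 0"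
  using integrable_square by (simp add: deviation_def inner_diff_right inner_mean prob_space)

lemma mean_psd: "mean \<in> psd_cone"
proof -
  have "adjoint_matrix mean = (\<integral>s. adjoint_matrix (s ** s) \<partial>\<nu>)"
    unfolding mean_def using linear_adjoint_matrix integrable_square
    by (intro integral_bounded_linear [symmetric]) (simp_all only: linear_conv_bounded_linear)
  also have "\<dots> = mean"
    unfolding mean_def
    by (intro Bochner_Integration.integral_cong) (auto simp: space_\<nu> psd_cone_def Herm_def
        adjoint_mult)
  finally have "mean \<in> Herm"
    by (simp add: Herm_def)
  moreover have "0 \<le> v \<bullet> (mean *v v)" for v
  proof -
    have "v \<bullet> (mean *v v) = (\<integral>s. v \<bullet> (s ** s *v v) \<partial>\<nu>)"
    proof -
      have "bounded_linear (\<lambda>m :: 'f ^ 'q ^ 'q. m *v v)"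
        using linear_matrix_vector_left [of v] by (simp only: linear_conv_bounded_linear)
      then have "bounded_linear (\<lambda>m :: 'f ^ 'q ^ 'q. v \<bullet> (m *v v))"
        by (rule bounded_linear_compose [OF bounded_linear_inner_right])
      from integral_bounded_linear [OF this integrable_square] show ?thesis
        by (simp add: mean_def)
    qed
    also have "\<dots> \<ge> 0"
      using square_in_psd_cone by (intro integral_nonneg_AE AE_I2) (auto simp: space_\<nu> psd_cone_iff)
    finally show ?thesis .
  qed
  ultimately show ?thesis
    by (simp add: psd_cone_iff)
qed

lemma bilinear_cov: "bilinear cov"
  unfolding bilinear_def
  by (intro conjI allI linearI)
    (simp_all add: cov_eq inner_add_left distrib_left distrib_right integrable_deviation_product
      Bochner_Integration.integral_add [symmetric] mult_ac del: Bochner_Integration.integral_add)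

lemma cov_nonneg: "0 \<le> cov a a"
  by (simp add: cov_eq)

lemma char_deviation_tendsto:
  "(\<lambda>n. char (distr \<nu> borel (\<lambda>s. a \<bullet> deviation s)) (1 / sqrt n) ^ n) \<longlonglongrightarrow> exp (- (cov a a / 2))"
proof -
  have meas: "(\<lambda>s. a \<bullet> deviation s) \<in> borel_measurable \<nu>"
    using measurable_square_\<nu> unfolding deviation_def by measurable
  interpret D: real_distribution "distr \<nu> borel (\<lambda>s. a \<bullet> deviation s)"
    using meas by (rule real_distribution_distr)
  have "integrable \<nu> (\<lambda>s. (a \<bullet> deviation s)\<^sup>2)"
    using integrable_deviation_product [of a a] by (simp add: power2_eq_square)
  moreover from meas this have "integrable \<nu> (\<lambda>s. a \<bullet> deviation s)"
    by (rule square_integrable_imp_integrable)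
  ultimately show ?thesis
    using D.char_power_tendsto [of 1] meas
    by (simp add: integrable_distr_eq integral_distr integral_deviation cov_eq power2_eq_square)
qed

end

section \<open>The squared radial part of a random walk\<close>

text \<open>
  The situation of the theorem for one number \<open>p\<close> of rows.
\<close>
locale radial_sample = radial_iid M p X \<mu> + law: psd_law \<nu>
  for M :: "'w measure" and p :: nat and X :: "nat \<Rightarrow> 'w \<Rightarrow> nat \<Rightarrow> 'f::rch ^ 'q"
    and \<mu> :: "(nat \<Rightarrow> 'f ^ 'q) measure" and \<nu> :: "('f ^ 'q ^ 'q) measure" +
  assumes lift: "distr \<mu> (restrict_space borel psd_cone) (phi p) = \<nu>"
    and p_pos: "0 < p"
begin

lemma phi_X: "1 \<le> k \<Longrightarrow> (\<lambda>\<omega>. phi p (X k \<omega>)) \<in> measurable M (restrict_space borel psd_cone)"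
  using measurable_compose [OF rv measurable_phi] .

lemma gram_X: "1 \<le> k \<Longrightarrow> (\<lambda>\<omega>. gram p (X k \<omega>)) \<in> borel_measurable M"
  by (intro measurable_gram rv)

lemma distr_phi: "1 \<le> k \<Longrightarrow> distr M (restrict_space borel psd_cone) (\<lambda>\<omega>. phi p (X k \<omega>)) = \<nu>"
  using distr_distr [OF measurable_phi rv, of k] lift law [of k] by (simp add: comp_def)

lemma distr_gram:
  assumes k: "1 \<le> k" and g: "g \<in> borel_measurable borel"
  shows "distr M borel (\<lambda>\<omega>. g (gram p (X k \<omega>))) = distr \<nu> borel (\<lambda>s. g (s ** s))"
proof -
  have "(\<lambda>s. g (s ** s)) \<in> borel_measurable (restrict_space borel psd_cone)"
    by (intro measurable_restrict_space1 measurable_compose [OF measurable_square g])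
  from distr_distr [OF this phi_X [OF k]] show ?thesis
    by (simp add: distr_phi [OF k] comp_def phi_square)
qed

lemma integral_gram:
  fixes g :: "'f ^ 'q ^ 'q \<Rightarrow> real"
  assumes k: "1 \<le> k" and g: "g \<in> borel_measurable borel"
  shows "(\<integral>\<omega>. g (gram p (X k \<omega>)) \<partial>M) = (\<integral>s. g (s ** s) \<partial>\<nu>)"
proof -
  have "(\<integral>\<omega>. g (gram p (X k \<omega>)) \<partial>M) = (\<integral>y. y \<partial>distr M borel (\<lambda>\<omega>. g (gram p (X k \<omega>))))"
    using measurable_compose [OF gram_X [OF k] g] by (subst integral_distr) auto
  also have "\<dots> = (\<integral>s. g (s ** s) \<partial>\<nu>)"
    unfolding distr_gram [OF k g]
    using measurable_compose [OF law.measurable_square_\<nu> g] by (subst integral_distr) auto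
  finally show ?thesis .
qed

lemma covariance_phi_square: "covariance M (\<lambda>\<omega>. phi p (X 1 \<omega>) ** phi p (X 1 \<omega>)) = law.cov"
proof (intro ext)
  fix a b
  have [measurable]: "(\<lambda>y :: 'f ^ 'q ^ 'q. a \<bullet> y) \<in> borel_measurable borel" for a
    by measurable
  have mean: "(\<integral>\<omega>. a \<bullet> gram p (X 1 \<omega>) \<partial>M) = (\<integral>s. a \<bullet> (s ** s) \<partial>\<nu>)" for a
    by (rule integral_gram) auto
  show "covariance M (\<lambda>\<omega>. phi p (X 1 \<omega>) ** phi p (X 1 \<omega>)) a b = law.cov a b"
    unfolding law.cov_def covariance_def phi_square mean
    by (rule integral_gram [of 1 "\<lambda>y. (a \<bullet> y - _) * (b \<bullet> y - _)"]) auto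
qed

definition mean_square :: real where
  "mean_square = (\<integral>s. (norm s)\<^sup>2 \<partial>\<nu>)"

lemma mean_square_nonneg: "0 \<le> mean_square"
  by (simp add: mean_square_def)

lemma second_moment_eq: "second_moment = ennreal mean_square"
proof -
  have m: "phi p \<in> measurable \<mu> (restrict_space borel psd_cone)"
    unfolding measurable_cong_sets [OF sets_law refl] by (rule measurable_phi)
  have "second_moment = (\<integral>\<^sup>+s. ennreal ((norm s)\<^sup>2) \<partial>distr \<mu> (restrict_space borel psd_cone) (phi p))"
    by (subst nn_integral_distr [OF m])
        (auto simp: sq_norm_eq_norm_phi intro!: measurable_restrict_space1)
  also have "\<dots> = ennreal mean_square"
    unfolding lift mean_square_def by (intro nn_integral_eq_integral law.integrable_norm2) simp
  finally show ?thesis .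
qed

text \<open>
  Only \<open>n / sqrt p\<close> matters: after division by \<open>sqrt n\<close> the bound tends to zero when \<open>n / p\<close> does.
\<close>
lemma remainder_L1:
  "integrable M (\<lambda>\<omega>. norm (remainder p X n \<omega>))"
  "expectation (\<lambda>\<omega>. norm (remainder p X n \<omega>)) \<le> sqrt 2 * real n * mean_square / sqrt p"
proof -
  let ?R = "\<lambda>\<omega>. norm (remainder p X n \<omega>)"
  define c where "c = 2 * (real n)\<^sup>2 * mean_square\<^sup>2 / p"
  have c: "0 \<le> c"
    by (simp add: c_def)
  have "remainder p X n \<in> borel_measurable M"
    by (intro measurable_remainder rv) simp
  then have meas: "?R \<in> borel_measurable M"
    by measurable
  have "of_nat p * (\<integral>\<^sup>+\<omega>. (?R \<omega>)\<^sup>2 \<partial>M) \<le> of_nat (2 * n\<^sup>2) * (ennreal mean_square)\<^sup>2"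
    using second_moment_remainder [of n] by (simp add: second_moment_eq)
  also have "\<dots> = ennreal (2 * (real n)\<^sup>2 * mean_square\<^sup>2)"
    by (simp add: ennreal_of_nat_eq_real_of_nat ennreal_power mean_square_nonneg flip: ennreal_mult)
  also have "\<dots> = of_nat p * ennreal c"
    using p_pos by (simp add: c_def ennreal_of_nat_eq_real_of_nat flip: ennreal_mult)
  finally have le: "(\<integral>\<^sup>+\<omega>. (?R \<omega>)\<^sup>2 \<partial>M) \<le> ennreal c"
    using p_pos by (simp add: ennreal_mult_le_mult_iff)
  then have int2: "integrable M (\<lambda>\<omega>. (?R \<omega>)\<^sup>2)"
    using meas by (intro integrableI_nonneg) (auto simp: le_less_trans)
  then show int1: "integrable M ?R"
    by (rule square_integrable_imp_integrable [OF meas])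
  have "(expectation ?R)\<^sup>2 \<le> expectation (\<lambda>\<omega>. (?R \<omega>)\<^sup>2)"
    using variance_positive [of ?R] variance_eq [OF int1 int2] by simp
  also have "\<dots> \<le> c"
    using le int2 c by (simp add: nn_integral_eq_integral)
  finally have "expectation ?R \<le> sqrt c"
    by (rule real_le_rsqrt)
  also have "sqrt c = sqrt 2 * real n * mean_square / sqrt p"
    using mean_square_nonneg by (simp add: c_def real_sqrt_mult real_sqrt_divide)
  finally show "expectation ?R \<le> sqrt 2 * real n * mean_square / sqrt p" .
qed

definition fluctuation :: "nat \<Rightarrow> 'w \<Rightarrow> 'f ^ 'q ^ 'q" where
  "fluctuation n \<omega> = (1 / sqrt n) *\<^sub>R (gram p (partial_sum p X n \<omega>) - real n *\<^sub>R law.mean)"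

lemma fluctuation_measurable: "fluctuation n \<in> borel_measurable M"
  unfolding fluctuation_def [abs_def]
  by (intro borel_measurable_scaleR borel_measurable_diff measurable_gram measurable_partial_sum rv) auto

text \<open>
  The diagonal terms \<open>gram p (X k)\<close> are independent and have the law of \<open>s ** s\<close> under \<open>\<nu>\<close>, so the
  number \<open>p\<close> of rows does not occur on the right-hand side.
\<close>
lemma char_diagonal_part:
  "(\<integral>\<omega>. iexp (1 / sqrt n * (\<Sum>k=1..n. a \<bullet> (gram p (X k \<omega>) - law.mean))) \<partial>M) =
    char (distr \<nu> borel (\<lambda>s. a \<bullet> law.deviation s)) (1 / sqrt n) ^ n"
proof -
  define \<xi> where "\<xi> k \<omega> = a \<bullet> (gram p (X k \<omega>) - law.mean)" for k \<omega>
  have g: "(\<lambda>y. a \<bullet> (y - law.mean)) \<in> borel_measurable borel"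
    by measurable
  have ind: "indep_vars (\<lambda>_. borel) \<xi> {1..n}"
    unfolding \<xi>_def [abs_def]
  proof (rule indep_vars_compose2 [where Y = "\<lambda>k x. a \<bullet> (gram p x - law.mean)"])
    show "indep_vars (\<lambda>_. mat_space p) X {1..n}"
      using indep by (rule indep_vars_subset) auto
    show "(\<lambda>x. a \<bullet> (gram p x - law.mean)) \<in> borel_measurable (mat_space p)"
      by measurable
  qed
  have sum: "(\<lambda>\<omega>. \<Sum>k=1..n. \<xi> k \<omega>) \<in> borel_measurable M"
    unfolding \<xi>_def using gram_X by (intro borel_measurable_sum measurable_compose [OF _ g]) auto
  have "(\<integral>\<omega>. iexp (1 / sqrt n * (\<Sum>k=1..n. \<xi> k \<omega>)) \<partial>M)
      = char (distr M borel (\<lambda>\<omega>. \<Sum>k=1..n. \<xi> k \<omega>)) (1 / sqrt n)"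
    unfolding char_def using sum by (subst integral_distr) auto
  also have "\<dots> = (\<Prod>k=1..n. char (distr M borel (\<xi> k)) (1 / sqrt n))"
    by (rule char_distr_sum [OF ind])
  also have "\<dots> = (\<Prod>k=1..n. char (distr \<nu> borel (\<lambda>s. a \<bullet> law.deviation s)) (1 / sqrt n))"
    by (intro prod.cong refl) (simp add: \<xi>_def [abs_def] distr_gram [OF _ g] law.deviation_def
        [abs_def])
  finally show ?thesis
    by (simp add: \<xi>_def)
qed

lemma iexp_diff_le: "cmod (iexp x - iexp y) \<le> \<bar>x - y\<bar>"
proof -
  have "iexp x - iexp y = iexp y * (iexp (x - y) - 1)"
    by (simp add: right_diff_distrib algebra_simps flip: exp_add)
  then have "cmod (iexp x - iexp y) = cmod (iexp (x - y) - 1)"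
    by (simp add: norm_mult)
  also have "\<dots> \<le> \<bar>x - y\<bar>"
    using iexp_approx1 [of "x - y" 0] by simp
  finally show ?thesis .
qed

text \<open>
  The phase changes by \<open>a \<bullet> remainder p X n \<omega> / sqrt n\<close> when the off-diagonal terms are dropped, and
  \<open>iexp\<close> is Lipschitz with constant 1.
\<close>
lemma char_fluctuation:
  "cmod ((\<integral>\<omega>. iexp (a \<bullet> fluctuation n \<omega>) \<partial>M) - char (distr \<nu> borel (\<lambda>s. a \<bullet> law.deviation s)) (1 / sqrt n) ^ n)
    \<le> norm a * mean_square * sqrt (2 * (real n / p))"
proof -
  define d where "d \<omega> = 1 / sqrt n * (\<Sum>k=1..n. a \<bullet> (gram p (X k \<omega>) - law.mean))" for \<omega>
  have d: "d \<in> borel_measurable M"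
    unfolding d_def [abs_def] using gram_X by measurable
  have f: "(\<lambda>\<omega>. a \<bullet> fluctuation n \<omega>) \<in> borel_measurable M"
    using fluctuation_measurable by measurable
  have eq: "a \<bullet> fluctuation n \<omega> - d \<omega> = 1 / sqrt n * (a \<bullet> remainder p X n \<omega>)" for \<omega>
    by (simp add: fluctuation_def d_def remainder_def inner_diff_right inner_sum_right sum_subtractf
        diff_divide_distrib)
  have int: "integrable M (\<lambda>\<omega>. iexp (a \<bullet> fluctuation n \<omega>))" "integrable M (\<lambda>\<omega>. iexp (d \<omega>))"
    using d f by (intro integrable_iexp; simp)+
  have "cmod ((\<integral>\<omega>. iexp (a \<bullet> fluctuation n \<omega>) \<partial>M) - (\<integral>\<omega>. iexp (d \<omega>) \<partial>M))
      = cmod (\<integral>\<omega>. iexp (a \<bullet> fluctuation n \<omega>) - iexp (d \<omega>) \<partial>M)"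
    using int by simp
  also have "\<dots> \<le> (\<integral>\<omega>. cmod (iexp (a \<bullet> fluctuation n \<omega>) - iexp (d \<omega>)) \<partial>M)"
    by (rule integral_norm_bound)
  also have "\<dots> \<le> (\<integral>\<omega>. norm a / sqrt n * norm (remainder p X n \<omega>) \<partial>M)"
  proof (rule integral_mono)
    show "integrable M (\<lambda>\<omega>. cmod (iexp (a \<bullet> fluctuation n \<omega>) - iexp (d \<omega>)))"
      using int by (intro integrable_norm Bochner_Integration.integrable_diff)
    show "integrable M (\<lambda>\<omega>. norm a / sqrt n * norm (remainder p X n \<omega>))"
      using remainder_L1(1) by simp
    fix \<omega>
    have "cmod (iexp (a \<bullet> fluctuation n \<omega>) - iexp (d \<omega>)) \<le> 1 / sqrt n * \<bar>a \<bullet> remainder p X n \<omega>\<bar>"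
      using iexp_diff_le [of "a \<bullet> fluctuation n \<omega>" "d \<omega>"] unfolding eq by (simp add: abs_mult)
    also have "\<dots> \<le> 1 / sqrt n * (norm a * norm (remainder p X n \<omega>))"
      by (intro mult_left_mono Cauchy_Schwarz_ineq2) simp
    finally show "cmod (iexp (a \<bullet> fluctuation n \<omega>) - iexp (d \<omega>))
        \<le> norm a / sqrt n * norm (remainder p X n \<omega>)"
      by simp
  qed
  also have "\<dots> \<le> norm a / sqrt n * (sqrt 2 * real n * mean_square / sqrt p)"
    using remainder_L1(2) [of n] by (simp only: integral_mult_right_zero) (intro mult_left_mono, auto)
  also have "\<dots> = norm a * mean_square * sqrt (2 * (real n / p))"
  proof -
    have "norm a / sqrt n * (sqrt 2 * real n * mean_square / sqrt p)
        = norm a * mean_square * (sqrt 2 * (real n / sqrt n) / sqrt p)"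
      by simp
    then show ?thesis
      by (simp only: real_div_sqrt
          [OF of_nat_0_le_iff] real_sqrt_mult real_sqrt_divide times_divide_eq_right)
  qed
  finally show ?thesis
    using char_diagonal_part [of n a] by (simp only: d_def)
qed

end

text \<open>
  The orthogonal projection onto the Hermitian matrices. It transports the continuity theorem and the
  Gaussian measure from the space of all square matrices to the subspace.
\<close>
definition herm_part :: "'f::rch ^ 'q ^ 'q \<Rightarrow> 'f ^ 'q ^ 'q" where
  "herm_part x = (1 / 2) *\<^sub>R (x + adjoint_matrix x)"

lemma herm_part_in_Herm: "herm_part x \<in> Herm"
  by (simp add: Herm_def herm_part_def linear_scale [OF linear_adjoint_matrix]
      linear_add [OF linear_adjoint_matrix] adjoint_adjoint add.commute)

lemma herm_part_id: "x \<in> Herm \<Longrightarrow> herm_part x = x"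
  by (simp add: Herm_def herm_part_def flip: scaleR_2)

lemma continuous_herm_part: "continuous_on S herm_part"
  unfolding herm_part_def adjoint_matrix_def
  by (intro continuous_intros continuous_on_vec_lambda)

lemma inner_herm_part: "a \<in> Herm \<Longrightarrow> a \<bullet> herm_part x = a \<bullet> x"
  using inner_adjoint [of a x] by (simp add: Herm_def herm_part_def inner_add_right)

lemma normal_on_Herm:
  fixes N :: "('f::rch ^ 'q ^ 'q) measure"
  assumes N: "centred_gaussian C N"
    and C: "\<And>a. 0 \<le> C a a" "\<And>a t. C (t *\<^sub>R a) (t *\<^sub>R a) = t\<^sup>2 * C a a"
  shows "is_normal_on Herm 0 C (distr N (restrict_space borel Herm) herm_part)"
proof -
  interpret prob_space N
    using N unfolding centred_gaussian_def by blast
  have sets: "sets N = sets borel"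
    using N unfolding centred_gaussian_def by blast
  have h: "herm_part \<in> measurable N (restrict_space borel Herm)"
    unfolding measurable_cong_sets [OF sets refl]
    by (intro measurable_restrict_space2 borel_measurable_continuous_onI continuous_herm_part)
      (simp add: herm_part_in_Herm)
  have "distr (distr N (restrict_space borel Herm) herm_part) borel (\<lambda>x. a \<bullet> x)
      = normal_law_real 0 (C a a)"
    if "a \<in> Herm" for a
  proof -
    have "(\<lambda>x. a \<bullet> x) \<in> borel_measurable (restrict_space borel Herm)"
      by (intro measurable_restrict_space1) measurable
    from distr_distr [OF this h]
    have "distr (distr N (restrict_space borel Herm) herm_part) borel (\<lambda>x. a \<bullet> x)
        = distr N borel (\<lambda>x. a \<bullet> x)"
      by (simp add: comp_def inner_herm_part that)
    then show ?thesis
      by (simp add: centred_gaussian_inner [OF N C])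
  qed
  then show ?thesis
    using prob_space_distr [OF h] by (simp add: is_normal_on_def)
qed

lemma converges_in_distribution_HermI:
  fixes Y :: "nat \<Rightarrow> 'w \<Rightarrow> 'f::rch ^ 'q ^ 'q"
  assumes N: "centred_gaussian C N"
    and M: "\<And>n. 1 \<le> n \<Longrightarrow> prob_space (M n)"
    and Y: "\<And>n. 1 \<le> n \<Longrightarrow> Y n \<in> borel_measurable (M n)" "\<And>n \<omega>. Y n \<omega> \<in> Herm"
    and conv: "\<And>a. (\<lambda>n. \<integral>\<omega>. iexp (a \<bullet> Y n \<omega>) \<partial>M n) \<longlonglongrightarrow> exp (- (C a a / 2))"
  shows "converges_in_distribution Herm M Y (distr N (restrict_space borel Herm) herm_part)"
  unfolding converges_in_distribution_def
proof (intro conjI allI impI)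
  show "Y n \<in> measurable (M n) (restrict_space borel Herm)" if "1 \<le> n" for n
    using Y that by (intro measurable_restrict_space2) auto
next
  fix f :: "'f ^ 'q ^ 'q \<Rightarrow> real" assume f: "continuous_on Herm f" "bounded (f ` Herm)"
  obtain B where B: "\<And>x. x \<in> Herm \<Longrightarrow> \<bar>f x\<bar> \<le> B"
    using f(2) by (auto simp: bounded_iff)
  define g where "g x = f (herm_part x)" for x
  have g: "continuous_on UNIV g" "\<And>x. \<bar>g x\<bar> \<le> B"
    unfolding g_def using B herm_part_in_Herm
    by (auto intro!: continuous_on_compose2 [OF f(1)] continuous_herm_part)
  then have g_meas: "g \<in> borel_measurable borel"
    by (intro borel_measurable_continuous_onI)
  have N': "prob_space N" "sets N = sets borel" "\<And>a. (\<integral>x. iexp (a \<bullet> x) \<partial>N) = exp (- (C a a / 2))"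
    using N unfolding centred_gaussian_def by blast+
  \<comment> \<open>The index is shifted because nothing is known about M 0.\<close>
  define L where "L n = distr (M (Suc n)) borel (Y (Suc n))" for n
  have L: "prob_space (L n)" "sets (L n) = sets borel" for n
    using M Y by (auto simp: L_def intro: prob_space.prob_space_distr)
  have "(\<lambda>n. \<integral>x. g x \<partial>L n) \<longlonglongrightarrow> (\<integral>x. g x \<partial>N)"
  proof (rule levy_continuity_euclidean [OF N'(1,2) L _ g])
    fix a
    have "(\<integral>x. iexp (a \<bullet> x) \<partial>L n) = (\<integral>\<omega>. iexp (a \<bullet> Y (Suc n) \<omega>) \<partial>M (Suc n))" for n
      unfolding L_def using Y(1) [of "Suc n"] by (subst integral_distr) auto
    then show "(\<lambda>n. \<integral>x. iexp (a \<bullet> x) \<partial>L n) \<longlonglongrightarrow> (\<integral>x. iexp (a \<bullet> x) \<partial>N)"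
      using LIMSEQ_Suc [OF conv [of a]] by (simp only: N'(3))
  qed
  moreover have "(\<integral>x. g x \<partial>L n) = (\<integral>\<omega>. f (Y (Suc n) \<omega>) \<partial>M (Suc n))" for n
    unfolding L_def using Y g_meas by (subst integral_distr) (auto simp: g_def herm_part_id)
  moreover have "(\<integral>x. f x \<partial>distr N (restrict_space borel Herm) herm_part) = (\<integral>x. g x \<partial>N)"
  proof -
    have "herm_part \<in> measurable N (restrict_space borel Herm)"
      unfolding measurable_cong_sets [OF N'(2) refl]
      by (intro measurable_restrict_space2 borel_measurable_continuous_onI continuous_herm_part)
        (simp add: herm_part_in_Herm)
    then show ?thesis
      unfolding g_def by (intro integral_distr borel_measurable_continuous_on_restrict f)
  qed
  ultimately have "(\<lambda>n. \<integral>\<omega>. f (Y (Suc n) \<omega>) \<partial>M (Suc n))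
      \<longlonglongrightarrow> (\<integral>x. f x \<partial>distr N (restrict_space borel Herm) herm_part)"
    by simp
  then show "(\<lambda>n. \<integral>\<omega>. f (Y n \<omega>) \<partial>M n) \<longlonglongrightarrow> (\<integral>x. f x \<partial>distr N (restrict_space borel Herm) herm_part)"
    by (rule LIMSEQ_imp_Suc)
qed

text \<open>
  For every \<open>a\<close> the characteristic function of the normalized variable is within a bound of order
  \<open>sqrt (n / p n)\<close> of the \<open>n\<close>-th power treated by the central limit theorem; the continuity theorem
  turns this into convergence in distribution.
\<close>
theorem theorem1p7:
  fixes \<nu> :: "('f::rch ^ 'q ^ 'q) measure"
    and \<nu>p :: "nat \<Rightarrow> (nat \<Rightarrow> 'f ^ 'q) measure"
    and M :: "nat \<Rightarrow> 'w measure"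
    and X :: "nat \<Rightarrow> nat \<Rightarrow> 'w \<Rightarrow> nat \<Rightarrow> 'f ^ 'q"
    and p :: "nat \<Rightarrow> nat"
    and \<sigma>2 :: "'f ^ 'q ^ 'q"
  assumes nu: "prob_space \<nu>" "sets \<nu> = sets (restrict_space borel psd_cone)"
    and m4: "(\<integral>\<^sup>+ s. ennreal (norm s ^ 4) \<partial>\<nu>) < \<infinity>"
    and sigma2: "\<sigma>2 = (\<integral>s. s ** s \<partial>\<nu>)"
    and nup: "\<And>r. r \<ge> CARD('q) \<Longrightarrow> radial_lift r \<nu> (\<nu>p r)"
    and X: "\<And>r. r \<ge> CARD('q) \<Longrightarrow> iid_with_law (M r) (mat_space r) (\<nu>p r) (X r)"
    and p: "\<And>n. n \<ge> 1 \<Longrightarrow> p n \<ge> CARD('q)"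
    and growth: "(\<lambda>n. real n ^ 2 / real (p n)) \<longlonglongrightarrow> 0"
  shows "\<sigma>2 \<in> psd_cone \<and>
    (\<exists>\<Sigma>2 N.
      (\<forall>r\<ge>CARD('q). covariance (M r) (\<lambda>\<omega>. phi r (X r 1 \<omega>) ** phi r (X r 1 \<omega>)) = \<Sigma>2) \<and>
      is_normal_on Herm 0 \<Sigma>2 N \<and>
      converges_in_distribution Herm (\<lambda>n. M (p n))
        (\<lambda>n \<omega>. (1 / sqrt (real n)) *\<^sub>R
          (phi (p n) (partial_sum (p n) (X (p n)) n \<omega>) **
           phi (p n) (partial_sum (p n) (X (p n)) n \<omega>) - real n *\<^sub>R \<sigma>2)) N)"
proof -
  interpret law: psd_law \<nu>
    using nu m4 by (simp add: psd_law_def psd_law_axioms_def)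
  have sample: "radial_sample (M r) r (X r) (\<nu>p r) \<nu>" if r: "CARD('q) \<le> r" for r
  proof -
    have "0 < r"
      using r zero_less_card_finite [where 'a = 'q] by linarith
    then show ?thesis
      using nup [OF r] X [OF r] law.psd_law_axioms
      by (simp add: radial_sample_def radial_sample_axioms_def radial_iid_def radial_iid_axioms_def
          radial_lift_def iid_with_law_def)
  qed
  have \<sigma>2: "\<sigma>2 = law.mean"
    by (simp add: sigma2 law.mean_def)
  have cov_scale: "law.cov (t *\<^sub>R a) (t *\<^sub>R a) = t\<^sup>2 * law.cov a a" for t a
    using law.bilinear_cov by (simp add: bilinear_lmul bilinear_rmul power2_eq_square)
  have "law.cov a b = law.cov b a" for a b
    by (simp add: law.cov_eq mult.commute)
  then obtain N where N: "centred_gaussian law.cov N"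
    using centred_gaussian_exists [OF law.bilinear_cov _ law.cov_nonneg] by blast
  define Y where "Y n \<omega> = (1 / sqrt (real n)) *\<^sub>R
      (gram (p n) (partial_sum (p n) (X (p n)) n \<omega>) - real n *\<^sub>R law.mean)" for n \<omega>
  have Y_eq: "Y n = radial_sample.fluctuation (p n) (X (p n)) \<nu> n" if "1 \<le> n" for n
    using radial_sample.fluctuation_def [OF sample [OF p [OF that]]] by (simp add: Y_def fun_eq_iff)
  have conv: "(\<lambda>n. \<integral>\<omega>. iexp (a \<bullet> Y n \<omega>) \<partial>M (p n)) \<longlonglongrightarrow> exp (- (law.cov a a / 2))" for a
  proof -
    define m where "m = (\<integral>s. (norm s)\<^sup>2 \<partial>\<nu>)"
    have "(\<lambda>n. real n / real (p n)) \<longlonglongrightarrow> 0"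
    proof (rule Lim_null_comparison [OF _ growth])
      show "\<forall>\<^sub>F n in sequentially. norm (real n / real (p n)) \<le> real n ^ 2 / real (p n)"
        by (intro always_eventually allI)
            (simp add: divide_right_mono power2_nat_le_imp_le self_le_power)
    qed
    then have "(\<lambda>n. norm a * m * sqrt (2 * (real n / p n))) \<longlonglongrightarrow> norm a * m * sqrt (2 * 0)"
      by (intro tendsto_intros)
    then have small: "(\<lambda>n. norm a * m * sqrt (2 * (real n / p n))) \<longlonglongrightarrow> 0"
      by simp
    have "\<forall>\<^sub>F n in sequentially. norm ((\<integral>\<omega>. iexp (a \<bullet> Y n \<omega>) \<partial>M (p n)) -
        char (distr \<nu> borel (\<lambda>s. a \<bullet> law.deviation s)) (1 / sqrt n) ^ n)
            \<le> norm a * m * sqrt (2 * (real n / p n))"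
      using eventually_ge_at_top [of 1]
    proof eventually_elim
      case (elim n)
      show ?case
        using radial_sample.char_fluctuation [OF sample [OF p [OF elim]], of a n]
        unfolding Y_eq [OF elim] m_def radial_sample.mean_square_def [OF sample [OF p [OF elim]]] .
    qed
    from Lim_null_comparison [OF this small] show ?thesis
      by (rule Lim_transform [OF law.char_deviation_tendsto])
  qed
  have "converges_in_distribution Herm (\<lambda>n. M (p n)) Y (distr N (restrict_space borel Herm) herm_part)"
  proof (rule converges_in_distribution_HermI [OF N _ _ _ conv])
    fix n :: nat assume n: "1 \<le> n"
    show "prob_space (M (p n))"
      using X [OF p [OF n]] by (simp add: iid_with_law_def)
    show "Y n \<in> borel_measurable (M (p n))"
      unfolding Y_eq [OF n] by (rule radial_sample.fluctuation_measurable [OF sample [OF p [OF n]]])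
  next
    fix n \<omega>
    have "gram (p n) (partial_sum (p n) (X (p n)) n \<omega>) \<in> Herm" "law.mean \<in> Herm"
      using gram_psd law.mean_psd by (auto simp: psd_cone_def)
    then show "Y n \<omega> \<in> Herm"
      unfolding Y_def by (intro subspace_scale subspace_diff subspace_Herm)
  qed
  moreover have "is_normal_on Herm 0 law.cov (distr N (restrict_space borel Herm) herm_part)"
    by (rule normal_on_Herm [OF N law.cov_nonneg cov_scale])
  moreover have "covariance (M r) (\<lambda>\<omega>. phi r (X r 1 \<omega>) ** phi r (X r 1 \<omega>)) = law.cov"
    if "CARD('q) \<le> r" for r
    by (rule radial_sample.covariance_phi_square [OF sample [OF that]])
  ultimately show ?thesis
    using law.mean_psd unfolding \<sigma>2 phi_square Y_def [abs_def] by blast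
qed

end
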